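(* Let $(M,[J,\nabla])$ be a conformally Fedosov manifold of dimension $2n\ge 4$ with tractor bundle ${\mathbb T}$. For representatives $(J_{ab},\nabla_a)$ of the structure define a connection on ${\mathbb T}$ (the tractor connection) by $$\nabla_a\begin{bmatrix}\sigma\\ \mu_b\\ \rho\end{bmatrix}=\begin{bmatrix}\nabla_a\sigma-\mu_a\\ \nabla_a\mu_b-J_{ab}\rho+\mathrm{P}_{ab}\sigma-\frac{3}{2n-1}\Phi_{ab}\sigma-J_{ab}\alpha^c\mu_c\\ \nabla_a\rho+\mathrm{P}_{ab}\mu^b-\frac{3}{2n-1}\Phi_{ab}\mu^b-\frac{1}{2n+1}(\nabla^b\Phi_{ab})\sigma-\Big(2\alpha^b\mathrm{P}_{ab}+\alpha^b\nabla_a\alpha_b-\frac{10n+7}{(2n+1)(2n-1)}\alpha^b\Phi_{ab}\Big)\sigma\end{bmatrix}.$$ Then this connection is well-defined, i.e. independent of the choice of representatives $(J_{ab},\nabla_a)$; it preserves the skew form $\langle\ ,\ \rangle$ on ${\mathbb T}$; and in Fedosov gauge its curvature is given by $$(\nabla_a\nabla_b-\nabla_b\nabla_a)\begin{bmatrix}\sigma\\ \mu_c\\ \rho\end{bmatrix}=\begin{bmatrix}0\\ V_{abcd}\mu^d+Y_{abc}\sigma\\ Y_{abc}\mu^c-\frac{1}{2n}(\nabla^cY_{abc}-V_{abce}\Phi^{ce})\sigma\end{bmatrix}-2J_{ab}\begin{bmatrix}\rho\\ S_c\sigma-\Phi_{cd}\mu^d\\ S_c\mu^c-\frac{1}{2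n}(\Phi_{de}\Phi^{de}+\nabla^cS_c)\sigma\end{bmatrix}.$$
   Context: Abstract index notation is used; round (square) brackets on indices denote the symmetric (skew) part, with the factor $1/k!$. Everything is smooth. Conformally Fedosov manifold: a manifold $M$ of dimension $2n\ge4$ with an equivalence class $[J,\nabla]$ of pairs consisting of a non-degenerate $2$-form $J_{ab}$ and a torsion-free affine connection $\nabla_a$ such that $\nabla_aJ_{bc}=2J_{a[b}\alpha_{c]}$ for some closed $1$-form $\alpha_a$ (closedness is automatic for $n\ge3$; $\alpha_a$ is determined by the pair). Pairs are equivalent if they are related by $\hat J_{ab}=\Omega^2J_{ab}$, $\hat\nabla_a\phi_b=\nabla_a\phi_b-\Upsilon_a\phi_b-\Upsilon_b\phi_a$, where $\Upsilon_a=\nabla_a\log\Omega$ and $\Omega>0$ is a smooth function; then $\hat\alpha_a=\alpha_a+\Upsilon_a$. A Fedosov gauge is a representative pair with $\nabla_aJ_{bc}=0$ (equivalently $\alpha_a=0$); such pairs exist locally. Index conventions: $J^{ab}$ is defined by $J_{ac}J^{bc}=\delta_a{}^b$; $\phi^a=J^{ab}\phi_b$, $\psi_b=\psi^aJ_{ab}$, $\nabla^b=J^{bc}\nabla_c$, etc. Curvature: $(\nabla_a\nabla_b-\nabla_b\nabla_a)X^c=R_{ab}{}^c{}_dX^d$ and $R_{abcd}=R_{ab}{}^e{}_dJ_{ec}$. For any representative pair, $R_{abcd}$ decomposes uniquely as $$R_{abcd}=V_{abcd}+2J_{ab}\Phi_{cd}-2\Phi_{c[a}J_{b]d}+\tfrac{6}{2n-1}J_{c[a}\Phi_{b]d}-2J_{c[a}\mathrm{P}_{b]d},$$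 with $\Phi_{ab}$, $\mathrm{P}_{ab}$ symmetric and $V_{abcd}=V_{[ab](cd)}$, $V_{[abc]d}=0$, $J^{ab}V_{abcd}=0$. In Fedosov gauge put $S_a=\frac{1}{2n+1}\nabla^b\Phi_{ab}$ and $Y_{abc}=\nabla_a\Phi_{bc}-\nabla_b\Phi_{ac}+J_{ac}S_b-J_{bc}S_a+2J_{ab}S_c$. Tractor bundle: $\Lambda^0[w]$ is the bundle of conformal densities of weight $w$: it is trivial in the presence of a representative pair, and a section, regarded as a function, changes by $\hat\sigma=\Omega^w\sigma$ when the representative pair $(J_{ab},\nabla_a)$ is replaced by the equivalent pair $(\hat J_{ab},\hat\nabla_a)$ with $\hat J_{ab}=\Omega^2J_{ab}$ and $\hat\nabla_a\phi_b=\nabla_a\phi_b-\Upsilon_a\phi_b-\Upsilon_b\phi_a$, $\Upsilon_a=\nabla_a\log\Omega$; $\Lambda^1[w]=\Lambda^1\otimes\Lambda^0[w]$. For a chosen pair, ${\mathbb T}=\Lambda^0[1]\oplus\Lambda^1[1]\oplus\Lambda^0[-1]$, a section being written as a column with entries $\sigma,\mu_b,\rho$. Under rescaling the splitting changes as weighted quantities (with $J_{ab}$ regarded as having weight $2$) by $\hat\sigma=\sigma$, $\hat\mu_b=\mu_b+\Upsilon_b\sigma$, $\hat\rho=\rho-\Upsilon^b\mu_b+\Upsilon^b\alpha_b\sigma$; in terms of ordinary functions and $1$-forms the right hand sides are multiplied by $\Omega,\Omega,\Omega^{-1}$ respectively, with $\Upsilon^b=J^{bc}\Upsilon_c$. In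 a given gauge $\nabla_a$ acts on densities as on functions. The invariant non-degenerate skew form on ${\mathbb T}$ is $\langle(\sigma,\mu,\rho),(\tilde\sigma,\tilde\mu,\tilde\rho)\rangle=\sigma\tilde\rho-J^{bc}\mu_b\tilde\mu_c-\rho\tilde\sigma$. The commutator $(\nabla_a\nabla_b-\nabla_b\nabla_a)$ on sections of ${\mathbb T}$ is formed using any torsion-free connection on $\Lambda^1$. *)

theory Defs
  imports "HOL-Analysis.Analysis"
begin

section \<open>Smooth functions on open subsets of coordinate space\<close>

definition partial :: "'d::finite \<Rightarrow> (real^'d \<Rightarrow> 'b::real_normed_vector) \<Rightarrow> real^'d \<Rightarrow> 'b" where
  "partial i f x = frechet_derivative f (at x) (axis i 1)"

primrec Ck_on :: "nat \<Rightarrow> (real^'d::finite) set \<Rightarrow> (real^'d \<Rightarrow> 'b::real_normed_vector) \<Rightarrow> bool" where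
  "Ck_on 0 S f \<longleftrightarrow> continuous_on S f"
| "Ck_on (Suc k) S f \<longleftrightarrow> (\<forall>x\<in>S. f differentiable (at x)) \<and> (\<forall>i. Ck_on k S (partial i f))"

text \<open>Only used for open \<open>S\<close>.\<close>
definition smooth_on :: "(real^'d::finite) set \<Rightarrow> (real^'d \<Rightarrow> 'b::real_normed_vector) \<Rightarrow> bool" where
  "smooth_on S f \<longleftrightarrow> (\<forall>k. Ck_on k S f)"


section \<open>Manifolds\<close>

type_synonym ('m, 'd) chart = "'m set \<times> ('m \<Rightarrow> real^'d)"

definition region :: "'m set \<Rightarrow> ('m, 'd) chart \<Rightarrow> (real^'d) set" where
  "region U c = snd c ` (fst c \<inter> U)"

definition transition :: "('m, 'd) chart \<Rightarrow> ('m, 'd) chart \<Rightarrow> real^'d \<Rightarrow> real^'d" where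
  "transition c c' = snd c' \<circ> inv_into (fst c) (snd c)"

definition jacobian :: "('m, 'd::finite) chart \<Rightarrow> ('m, 'd) chart \<Rightarrow> real^'d \<Rightarrow> real^'d^'d" where
  "jacobian c c' x = (\<chi> k i. partial i (transition c c') x $ k)"

text \<open>The manifold is the set \<^term>\<open>\<Union>(fst ` A)\<close> covered by the charts of the atlas \<open>A\<close>.\<close>
definition smooth_atlas ::
    "('m::{t2_space, second_countable_topology}, 'd::finite) chart set \<Rightarrow> bool" where
  "smooth_atlas A \<longleftrightarrow>
     (\<forall>(D, \<phi>)\<in>A. open D \<and> open (\<phi> ` D) \<and> (\<exists>\<psi>. homeomorphism D (\<phi> ` D) \<phi> \<psi>)) \<and>
     (\<forall>c\<in>A. \<forall>c'\<in>A. smooth_on (region (fst c') c) (transition c c'))"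

definition points :: "('m, 'd) chart set \<Rightarrow> 'm set" where
  "points A = \<Union>(fst ` A)"


section \<open>Fields on open subsets of a manifold\<close>

text \<open>A field assigns to every chart its components there, as functions of the coordinates;
  components in different charts obey the transformation law of the kind of field. Covariant indices
  are listed from left to right: \<open>T $ a $ b\<close> is $T_{ab}$.\<close>

type_synonym ('m, 'd, 'b) field = "('m, 'd) chart \<Rightarrow> real^'d \<Rightarrow> 'b"

definition smooth_field ::
    "('m, 'd::finite) chart set \<Rightarrow> 'm set \<Rightarrow> ('m, 'd, 'b::real_normed_vector) field \<Rightarrow> bool" where
  "smooth_field A U F \<longleftrightarrow> (\<forall>c\<in>A. smooth_on (region U c) (F c))"

definition scalar_field ::
    "('m, 'd::finite) chart set \<Rightarrow> 'm set \<Rightarrow> ('m, 'd, real) field \<Rightarrow> bool" where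
  "scalar_field A U f \<longleftrightarrow> smooth_field A U f \<and>
     (\<forall>c\<in>A. \<forall>c'\<in>A. \<forall>x\<in>region (U \<inter> fst c') c. f c x = f c' (transition c c' x))"

definition one_form ::
    "('m, 'd::finite) chart set \<Rightarrow> 'm set \<Rightarrow> ('m, 'd, real^'d) field \<Rightarrow> bool" where
  "one_form A U \<omega> \<longleftrightarrow> smooth_field A U \<omega> \<and>
     (\<forall>c\<in>A. \<forall>c'\<in>A. \<forall>x\<in>region (U \<inter> fst c') c.
        \<omega> c x = \<omega> c' (transition c c' x) v* jacobian c c' x)"

definition closed_one_form ::
    "('m, 'd::finite) chart set \<Rightarrow> 'm set \<Rightarrow> ('m, 'd, real^'d) field \<Rightarrow> bool" where
  "closed_one_form A U \<omega> \<longleftrightarrow> one_form A U \<omega> \<and>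
     (\<forall>c\<in>A. \<forall>x\<in>region U c. \<forall>a b. partial a (\<omega> c) x $ b = partial b (\<omega> c) x $ a)"

definition nondegenerate_two_form ::
    "('m, 'd::finite) chart set \<Rightarrow> 'm set \<Rightarrow> ('m, 'd, real^'d^'d) field \<Rightarrow> bool" where
  "nondegenerate_two_form A U J \<longleftrightarrow> smooth_field A U J \<and>
     (\<forall>c\<in>A. \<forall>c'\<in>A. \<forall>x\<in>region (U \<inter> fst c') c.
        J c x = transpose (jacobian c c' x) ** J c' (transition c c' x) ** jacobian c c' x) \<and>
     (\<forall>c\<in>A. \<forall>x\<in>region U c. transpose (J c x) = - J c x \<and> invertible (J c x))"

text \<open>\<open>\<Gamma> $ c $ a $ b\<close> is the Christoffel symbol $\Gamma^c_{ab}$, the component along the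
  \<open>c\<close>-th coordinate field of the derivative in direction \<open>a\<close> of the \<open>b\<close>-th coordinate field.\<close>
definition torsion_free_connection ::
    "('m, 'd::finite) chart set \<Rightarrow> 'm set \<Rightarrow> ('m, 'd, real^'d^'d^'d) field \<Rightarrow> bool" where
  "torsion_free_connection A U \<Gamma> \<longleftrightarrow> smooth_field A U \<Gamma> \<and>
     (\<forall>c\<in>A. \<forall>c'\<in>A. \<forall>x\<in>region (U \<inter> fst c') c. \<forall>l i j.
        (\<Sum>k\<in>UNIV. jacobian c c' x $ l $ k * \<Gamma> c x $ k $ i $ j) =
        partial i (\<lambda>y. jacobian c c' y $ l $ j) x +
        (\<Sum>p\<in>UNIV. \<Sum>q\<in>UNIV. jacobian c c' x $ p $ i * jacobian c c' x $ q $ j *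
            \<Gamma> c' (transition c c' x) $ l $ p $ q)) \<and>
     (\<forall>c\<in>A. \<forall>x\<in>region U c. \<forall>k i j. \<Gamma> c x $ k $ i $ j = \<Gamma> c x $ k $ j $ i)"


section \<open>Covariant derivatives and curvature in one chart\<close>

text \<open>The new index comes first: \<open>cov1 \<Gamma> \<phi> x $ a $ b\<close> is $\nabla_a\phi_b$.\<close>

definition cov1 :: "(real^'d \<Rightarrow> real^'d^'d^'d) \<Rightarrow> (real^'d \<Rightarrow> real^'d) \<Rightarrow> real^'d \<Rightarrow>
    real^'d^'d::finite" where
  "cov1 \<Gamma> \<phi> x = (\<chi> a b. partial a \<phi> x $ b - (\<Sum>e\<in>UNIV. \<Gamma> x $ e $ a $ b * \<phi> x $ e))"

definition cov2 :: "(real^'d \<Rightarrow> real^'d^'d^'d) \<Rightarrow> (real^'d \<Rightarrow> real^'d^'d) \<Rightarrow> real^'d \<Rightarrow>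
    real^'d^'d^'d::finite" where
  "cov2 \<Gamma> T x = (\<chi> a b c. partial a T x $ b $ c
      - (\<Sum>e\<in>UNIV. \<Gamma> x $ e $ a $ b * T x $ e $ c)
      - (\<Sum>e\<in>UNIV. \<Gamma> x $ e $ a $ c * T x $ b $ e))"

definition cov3 :: "(real^'d \<Rightarrow> real^'d^'d^'d) \<Rightarrow> (real^'d \<Rightarrow> real^'d^'d^'d) \<Rightarrow> real^'d \<Rightarrow>
    real^'d^'d^'d^'d::finite" where
  "cov3 \<Gamma> T x = (\<chi> a b c d. partial a T x $ b $ c $ d
      - (\<Sum>e\<in>UNIV. \<Gamma> x $ e $ a $ b * T x $ e $ c $ d)
      - (\<Sum>e\<in>UNIV. \<Gamma> x $ e $ a $ c * T x $ b $ e $ d)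
      - (\<Sum>e\<in>UNIV. \<Gamma> x $ e $ a $ d * T x $ b $ c $ e))"

text \<open>\<open>cov_vec \<Gamma> X x $ b $ c\<close> is $\nabla_b X^c$, and \<open>cov_mix \<Gamma> T x $ a $ b $ c\<close> is
  $\nabla_a T_b{}^c$.\<close>

definition cov_vec :: "(real^'d \<Rightarrow> real^'d^'d^'d) \<Rightarrow> (real^'d \<Rightarrow> real^'d) \<Rightarrow> real^'d \<Rightarrow>
    real^'d^'d::finite" where
  "cov_vec \<Gamma> X x = (\<chi> b c. partial b X x $ c + (\<Sum>e\<in>UNIV. \<Gamma> x $ c $ b $ e * X x $ e))"

definition cov_mix :: "(real^'d \<Rightarrow> real^'d^'d^'d) \<Rightarrow> (real^'d \<Rightarrow> real^'d^'d) \<Rightarrow> real^'d \<Rightarrow>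
    real^'d^'d^'d::finite" where
  "cov_mix \<Gamma> T x = (\<chi> a b c. partial a T x $ b $ c
      - (\<Sum>e\<in>UNIV. \<Gamma> x $ e $ a $ b * T x $ e $ c)
      + (\<Sum>e\<in>UNIV. \<Gamma> x $ c $ a $ e * T x $ b $ e))"

text \<open>The component $R_{ab}{}^c{}_d$ is read off from
  $(\nabla_a\nabla_b-\nabla_b\nabla_a)X^c=R_{ab}{}^c{}_dX^d$ for \<open>X\<close> the \<open>d\<close>-th coordinate field.\<close>
definition curvature :: "(real^'d \<Rightarrow> real^'d^'d^'d) \<Rightarrow> real^'d \<Rightarrow> real^'d^'d^'d^'d::finite" where
  "curvature \<Gamma> x = (\<chi> a b c d.
     let DDX = cov_mix \<Gamma> (cov_vec \<Gamma> (\<lambda>y. axis d 1)) x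
     in DDX $ a $ b $ c - DDX $ b $ a $ c)"

definition curvature_low :: "(real^'d \<Rightarrow> real^'d^'d) \<Rightarrow> (real^'d \<Rightarrow> real^'d^'d^'d) \<Rightarrow> real^'d \<Rightarrow>
    real^'d^'d^'d^'d::finite" where
  "curvature_low J \<Gamma> x =
     (\<chi> a b c d. \<Sum>e\<in>UNIV. curvature \<Gamma> x $ a $ b $ e $ d * J x $ e $ c)"

text \<open>The matrix $J^{ab}$ with $J_{ac}J^{bc}=\delta_a{}^b$. Note the transposition.\<close>
definition Jup :: "real^'d^'d \<Rightarrow> real^'d^'d::finite" where
  "Jup J = transpose (matrix_inv J)"

definition raise :: "real^'d^'d \<Rightarrow> real^'d \<Rightarrow> real^'d::finite" where
  "raise J \<phi> = (\<chi> a. \<Sum>b\<in>UNIV. Jup J $ a $ b * \<phi> $ b)"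

definition raise2 :: "real^'d^'d \<Rightarrow> real^'d^'d \<Rightarrow> real^'d^'d::finite" where
  "raise2 J T = (\<chi> a b. \<Sum>c\<in>UNIV. \<Sum>d\<in>UNIV. Jup J $ a $ c * Jup J $ b $ d * T $ c $ d)"

definition alt :: "('d \<Rightarrow> 'd \<Rightarrow> real) \<Rightarrow> 'd \<Rightarrow> 'd \<Rightarrow> real" where
  "alt F a b = (F a b - F b a) / 2"

definition curvature_decomposition :: "nat \<Rightarrow> real^'d^'d \<Rightarrow> real^'d^'d^'d^'d \<Rightarrow>
    real^'d^'d^'d^'d \<Rightarrow> real^'d^'d \<Rightarrow> real^'d^'d::finite \<Rightarrow> bool" where
  "curvature_decomposition n J R V \<Phi> P \<longleftrightarrow>
     transpose \<Phi> = \<Phi> \<and> transpose P = P \<and>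
     (\<forall>a b c d. V $ a $ b $ c $ d = - V $ b $ a $ c $ d) \<and>
     (\<forall>a b c d. V $ a $ b $ c $ d = V $ a $ b $ d $ c) \<and>
     (\<forall>a b c d. (V $ a $ b $ c $ d + V $ b $ c $ a $ d + V $ c $ a $ b $ d
                - V $ b $ a $ c $ d - V $ a $ c $ b $ d - V $ c $ b $ a $ d) / 6 = 0) \<and>
     (\<forall>c d. (\<Sum>a\<in>UNIV. \<Sum>b\<in>UNIV. Jup J $ a $ b * V $ a $ b $ c $ d) = 0) \<and>
     (\<forall>a b c d. R $ a $ b $ c $ d =
        V $ a $ b $ c $ d + 2 * J $ a $ b * \<Phi> $ c $ d
        - 2 * alt (\<lambda>a b. \<Phi> $ c $ a * J $ b $ d) a b
        + 6 / (2 * real n - 1) * alt (\<lambda>a b. J $ c $ a * \<Phi> $ b $ d) a b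
        - 2 * alt (\<lambda>a b. J $ c $ a * P $ b $ d) a b)"

text \<open>The parts $V_{abcd}$, $\Phi_{ab}$, $\mathrm{P}_{ab}$ of the curvature, in one chart.\<close>

definition Vten :: "nat \<Rightarrow> (real^'d \<Rightarrow> real^'d^'d) \<Rightarrow> (real^'d \<Rightarrow> real^'d^'d^'d) \<Rightarrow> real^'d \<Rightarrow>
    real^'d^'d^'d^'d::finite" where
  "Vten n J \<Gamma> x = (THE V. \<exists>\<Phi> P. curvature_decomposition n (J x) (curvature_low J \<Gamma> x) V \<Phi> P)"

definition Phi :: "nat \<Rightarrow> (real^'d \<Rightarrow> real^'d^'d) \<Rightarrow> (real^'d \<Rightarrow> real^'d^'d^'d) \<Rightarrow> real^'d \<Rightarrow>
    real^'d^'d::finite" where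
  "Phi n J \<Gamma> x = (THE \<Phi>. \<exists>V P. curvature_decomposition n (J x) (curvature_low J \<Gamma> x) V \<Phi> P)"

definition Rho :: "nat \<Rightarrow> (real^'d \<Rightarrow> real^'d^'d) \<Rightarrow> (real^'d \<Rightarrow> real^'d^'d^'d) \<Rightarrow> real^'d \<Rightarrow>
    real^'d^'d::finite" where
  "Rho n J \<Gamma> x = (THE P. \<exists>V \<Phi>. curvature_decomposition n (J x) (curvature_low J \<Gamma> x) V \<Phi> P)"

text \<open>$\nabla^b\Phi_{ab}=J^{bc}\nabla_c\Phi_{ab}$\<close>
definition divPhi :: "nat \<Rightarrow> (real^'d \<Rightarrow> real^'d^'d) \<Rightarrow> (real^'d \<Rightarrow> real^'d^'d^'d) \<Rightarrow> real^'d \<Rightarrow>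
    real^'d::finite" where
  "divPhi n J \<Gamma> x =
     (\<chi> a. \<Sum>b\<in>UNIV. \<Sum>c\<in>UNIV. Jup (J x) $ b $ c * cov2 \<Gamma> (Phi n J \<Gamma>) x $ c $ a $ b)"

definition Sten :: "nat \<Rightarrow> (real^'d \<Rightarrow> real^'d^'d) \<Rightarrow> (real^'d \<Rightarrow> real^'d^'d^'d) \<Rightarrow> real^'d \<Rightarrow>
    real^'d::finite" where
  "Sten n J \<Gamma> x = (1 / (2 * real n + 1)) *\<^sub>R divPhi n J \<Gamma> x"

definition Yten :: "nat \<Rightarrow> (real^'d \<Rightarrow> real^'d^'d) \<Rightarrow> (real^'d \<Rightarrow> real^'d^'d^'d) \<Rightarrow> real^'d \<Rightarrow>
    real^'d^'d^'d::finite" where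
  "Yten n J \<Gamma> x = (let D\<Phi> = cov2 \<Gamma> (Phi n J \<Gamma>) x; S = Sten n J \<Gamma> x in
     \<chi> a b c. D\<Phi> $ a $ b $ c - D\<Phi> $ b $ a $ c
       + J x $ a $ c * S $ b - J x $ b $ c * S $ a + 2 * J x $ a $ b * S $ c)"


section \<open>Conformally Fedosov structures\<close>

text \<open>A pair \<open>(J, \<Gamma>)\<close> stands for $(J_{ab},\nabla_a)$, the connection being given by its
  Christoffel symbols.\<close>
type_synonym ('m, 'd) pair = "('m, 'd, real^'d^'d) field \<times> ('m, 'd, real^'d^'d^'d) field"

text \<open>$\nabla_aJ_{bc}=2J_{a[b}\alpha_{c]}$ at the point \<open>x\<close>\<close>
definition is_alpha_at :: "(real^'d \<Rightarrow> real^'d^'d) \<Rightarrow> (real^'d \<Rightarrow> real^'d^'d^'d) \<Rightarrow> real^'d \<Rightarrow>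
    real^'d::finite \<Rightarrow> bool" where
  "is_alpha_at J \<Gamma> x \<alpha> \<longleftrightarrow> (\<forall>a b c. cov2 \<Gamma> J x $ a $ b $ c =
     2 * alt (\<lambda>b c. J x $ a $ b * \<alpha> $ c) b c)"

definition alpha :: "(real^'d \<Rightarrow> real^'d^'d) \<Rightarrow> (real^'d \<Rightarrow> real^'d^'d^'d) \<Rightarrow> real^'d \<Rightarrow>
    real^'d::finite" where
  "alpha J \<Gamma> x = (THE \<alpha>. is_alpha_at J \<Gamma> x \<alpha>)"

definition conf_fedosov_pair ::
    "('m, 'd::finite) chart set \<Rightarrow> 'm set \<Rightarrow> ('m, 'd) pair \<Rightarrow> bool" where
  "conf_fedosov_pair A U p \<longleftrightarrow>
     nondegenerate_two_form A U (fst p) \<and> torsion_free_connection A U (snd p) \<and>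
     (\<exists>\<alpha>. closed_one_form A U \<alpha> \<and>
        (\<forall>c\<in>A. \<forall>x\<in>region U c. is_alpha_at (fst p c) (snd p c) x (\<alpha> c x)))"

definition Upsilon :: "(real^'d \<Rightarrow> real) \<Rightarrow> real^'d \<Rightarrow> real^'d::finite" where
  "Upsilon \<Omega> x = (\<chi> a. partial a (\<lambda>y. ln (\<Omega> y)) x)"

definition rescaling :: "('m, 'd::finite) chart set \<Rightarrow> 'm set \<Rightarrow> ('m, 'd, real) field \<Rightarrow>
    ('m, 'd) pair \<Rightarrow> ('m, 'd) pair \<Rightarrow> bool" where
  "rescaling A U \<Omega> p q \<longleftrightarrow> scalar_field A U \<Omega> \<and>
     (\<forall>c\<in>A. \<forall>x\<in>region U c. \<Omega> c x > 0 \<and>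
        fst q c x = (\<Omega> c x)\<^sup>2 *\<^sub>R fst p c x \<and>
        (\<forall>\<phi>. smooth_on (region U c) \<phi> \<longrightarrow> (\<forall>a b.
           cov1 (snd q c) \<phi> x $ a $ b = cov1 (snd p c) \<phi> x $ a $ b
             - Upsilon (\<Omega> c) x $ a * \<phi> x $ b - Upsilon (\<Omega> c) x $ b * \<phi> x $ a)))"

definition conformally_fedosov ::
    "('m::{t2_space, second_countable_topology}, 'd::finite) chart set \<Rightarrow>
     ('m, 'd) pair set \<Rightarrow> bool" where
  "conformally_fedosov A C \<longleftrightarrow> smooth_atlas A \<and>
     (\<exists>p. conf_fedosov_pair A (points A) p \<and>
        C = {q. conf_fedosov_pair A (points A) q \<and> (\<exists>\<Omega>. rescaling A (points A) \<Omega> p q)})"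

text \<open>The pairs on the open subset \<open>U\<close> representing the restriction of the structure \<open>C\<close>. They are
  needed because Fedosov gauges exist only locally.\<close>
definition representatives :: "('m, 'd::finite) chart set \<Rightarrow> ('m, 'd) pair set \<Rightarrow> 'm set \<Rightarrow>
    ('m, 'd) pair set" where
  "representatives A C U =
     {q. conf_fedosov_pair A U q \<and> (\<exists>p\<in>C. \<exists>\<Omega>. rescaling A U \<Omega> p q)}"

definition fedosov_gauge ::
    "('m, 'd::finite) chart set \<Rightarrow> 'm set \<Rightarrow> ('m, 'd) pair \<Rightarrow> bool" where
  "fedosov_gauge A U q \<longleftrightarrow> (\<forall>c\<in>A. \<forall>x\<in>region U c. cov2 (snd q c) (fst q c) x = 0)"


section \<open>The tractor bundle\<close>

text \<open>\<open>(\<sigma>, \<mu>, \<rho>)\<close>, in a given gauge and a given chart\<close>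
type_synonym 'd tractor = "real \<times> (real^'d) \<times> real"

definition tractor_pullback :: "real^'d^'d \<Rightarrow> 'd tractor \<Rightarrow> 'd::finite tractor" where
  "tractor_pullback B = (\<lambda>(\<sigma>, \<mu>, \<rho>). (\<sigma>, \<mu> v* B, \<rho>))"

text \<open>Change of splitting, in terms of ordinary functions and 1-forms; \<open>J\<close> and \<open>\<Gamma>\<close> are those
  before the change.\<close>
definition tractor_rescale :: "(real^'d \<Rightarrow> real) \<Rightarrow> (real^'d \<Rightarrow> real^'d^'d) \<Rightarrow>
    (real^'d \<Rightarrow> real^'d^'d^'d) \<Rightarrow> real^'d \<Rightarrow> 'd tractor \<Rightarrow> 'd::finite tractor" where
  "tractor_rescale \<Omega> J \<Gamma> x = (\<lambda>(\<sigma>, \<mu>, \<rho>).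
     let \<Upsilon> = Upsilon \<Omega> x; \<Upsilon>up = raise (J x) \<Upsilon>; \<alpha> = alpha J \<Gamma> x in
       (\<Omega> x * \<sigma>,
        \<Omega> x *\<^sub>R (\<mu> + \<sigma> *\<^sub>R \<Upsilon>),
        inverse (\<Omega> x) * (\<rho> - (\<Sum>b\<in>UNIV. \<Upsilon>up $ b * \<mu> $ b) + (\<Sum>b\<in>UNIV. \<Upsilon>up $ b * \<alpha> $ b) * \<sigma>)))"

text \<open>A section over \<open>U\<close> assigns a triple of fields to every representative pair on \<open>U\<close>,
  compatibly with rescaling.\<close>
type_synonym ('m, 'd) tractor_field = "('m, 'd) pair \<Rightarrow> ('m, 'd, 'd tractor) field"

definition tractor_section :: "('m, 'd::finite) chart set \<Rightarrow> ('m, 'd) pair set \<Rightarrow> 'm set \<Rightarrow>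
    ('m, 'd) tractor_field \<Rightarrow> bool" where
  "tractor_section A C U s \<longleftrightarrow>
     (\<forall>q\<in>representatives A C U. smooth_field A U (s q) \<and>
        (\<forall>c\<in>A. \<forall>c'\<in>A. \<forall>x\<in>region (U \<inter> fst c') c.
           s q c x = tractor_pullback (jacobian c c' x) (s q c' (transition c c' x)))) \<and>
     (\<forall>q\<in>representatives A C U. \<forall>q'\<in>representatives A C U. \<forall>\<Omega>. rescaling A U \<Omega> q q' \<longrightarrow>
        (\<forall>c\<in>A. \<forall>x\<in>region U c.
           s q' c x = tractor_rescale (\<Omega> c) (fst q c) (snd q c) x (s q c x)))"

text \<open>\<open>t q c a x\<close> is the \<open>a\<close>-th component of the tractor-valued 1-form \<open>t\<close>.\<close>
type_synonym ('m, 'd) tractor_form =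
  "('m, 'd) pair \<Rightarrow> ('m, 'd) chart \<Rightarrow> 'd \<Rightarrow> real^'d \<Rightarrow> 'd tractor"

definition tractor_one_form :: "('m, 'd::finite) chart set \<Rightarrow> ('m, 'd) pair set \<Rightarrow> 'm set \<Rightarrow>
    ('m, 'd) tractor_form \<Rightarrow> bool" where
  "tractor_one_form A C U t \<longleftrightarrow>
     (\<forall>q\<in>representatives A C U.
        (\<forall>c\<in>A. \<forall>a. smooth_on (region U c) (t q c a)) \<and>
        (\<forall>c\<in>A. \<forall>c'\<in>A. \<forall>x\<in>region (U \<inter> fst c') c. \<forall>a.
           t q c a x = (\<Sum>k\<in>UNIV. jacobian c c' x $ k $ a *\<^sub>R
             tractor_pullback (jacobian c c' x) (t q c' k (transition c c' x))))) \<and>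
     (\<forall>q\<in>representatives A C U. \<forall>q'\<in>representatives A C U. \<forall>\<Omega>. rescaling A U \<Omega> q q' \<longrightarrow>
        (\<forall>c\<in>A. \<forall>x\<in>region U c. \<forall>a.
           t q' c a x = tractor_rescale (\<Omega> c) (fst q c) (snd q c) x (t q c a x)))"

definition is_connection :: "('m, 'd::finite) chart set \<Rightarrow> ('m, 'd) pair set \<Rightarrow> 'm set \<Rightarrow>
    (('m, 'd) tractor_field \<Rightarrow> ('m, 'd) tractor_form) \<Rightarrow> bool" where
  "is_connection A C U D \<longleftrightarrow>
     (\<forall>s. tractor_section A C U s \<longrightarrow> tractor_one_form A C U (D s)) \<and>
     (\<forall>s t. tractor_section A C U s \<longrightarrow> tractor_section A C U t \<longrightarrow>
        (\<forall>q\<in>representatives A C U. \<forall>c\<in>A. \<forall>x\<in>region U c. \<forall>a.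
           D (\<lambda>q c y. s q c y + t q c y) q c a x = D s q c a x + D t q c a x)) \<and>
     (\<forall>f s. scalar_field A U f \<longrightarrow> tractor_section A C U s \<longrightarrow>
        (\<forall>q\<in>representatives A C U. \<forall>c\<in>A. \<forall>x\<in>region U c. \<forall>a.
           D (\<lambda>q c y. f c y *\<^sub>R s q c y) q c a x =
           f c x *\<^sub>R D s q c a x + partial a (f c) x *\<^sub>R s q c x))"

definition skew_form :: "real^'d^'d \<Rightarrow> 'd tractor \<Rightarrow> 'd::finite tractor \<Rightarrow> real" where
  "skew_form J = (\<lambda>(\<sigma>, \<mu>, \<rho>) (\<sigma>', \<mu>', \<rho>').
     \<sigma> * \<rho>' - (\<Sum>b\<in>UNIV. \<Sum>c\<in>UNIV. Jup J $ b $ c * \<mu> $ b * \<mu>' $ c) - \<rho> * \<sigma>')"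


section \<open>The tractor connection\<close>

definition tractor_deriv :: "nat \<Rightarrow> (real^'d \<Rightarrow> real^'d^'d) \<Rightarrow> (real^'d \<Rightarrow> real^'d^'d^'d) \<Rightarrow>
    (real^'d \<Rightarrow> 'd tractor) \<Rightarrow> 'd \<Rightarrow> real^'d \<Rightarrow> 'd::finite tractor" where
  "tractor_deriv n J \<Gamma> s a x =
     (let \<sigma> = (\<lambda>y. fst (s y)); \<mu> = (\<lambda>y. fst (snd (s y))); \<rho> = (\<lambda>y. snd (snd (s y)));
          \<mu>up = raise (J x) (\<mu> x);
          \<alpha>up = raise (J x) (alpha J \<Gamma> x);
          D\<alpha> = cov1 \<Gamma> (alpha J \<Gamma>) x;
          P = Rho n J \<Gamma> x;
          \<Phi> = Phi n J \<Gamma> x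
      in
       (partial a \<sigma> x - \<mu> x $ a,
        \<chi> b. cov1 \<Gamma> \<mu> x $ a $ b - J x $ a $ b * \<rho> x + P $ a $ b * \<sigma> x
          - 3 / (2 * real n - 1) * \<Phi> $ a $ b * \<sigma> x
          - J x $ a $ b * (\<Sum>c\<in>UNIV. \<alpha>up $ c * \<mu> x $ c),
        partial a \<rho> x + (\<Sum>b\<in>UNIV. P $ a $ b * \<mu>up $ b)
          - 3 / (2 * real n - 1) * (\<Sum>b\<in>UNIV. \<Phi> $ a $ b * \<mu>up $ b)
          - 1 / (2 * real n + 1) * divPhi n J \<Gamma> x $ a * \<sigma> x
          - (2 * (\<Sum>b\<in>UNIV. \<alpha>up $ b * P $ a $ b)
             + (\<Sum>b\<in>UNIV. \<alpha>up $ b * D\<alpha> $ a $ b)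
             - (10 * real n + 7) / ((2 * real n + 1) * (2 * real n - 1))
                * (\<Sum>b\<in>UNIV. \<alpha>up $ b * \<Phi> $ a $ b)) * \<sigma> x))"

definition tractor_connection ::
    "nat \<Rightarrow> ('m, 'd::finite) tractor_field \<Rightarrow> ('m, 'd) tractor_form" where
  "tractor_connection n s = (\<lambda>q c a x. tractor_deriv n (fst q c) (snd q c) (s q c) a x)"

text \<open>$\nabla_a\nabla_b s$, where the derivative of the tractor-valued 1-form $\nabla_b s$ is formed
  with the tractor connection of \<open>(J, \<Gamma>)\<close> and the connection \<open>\<Gamma>'\<close> on 1-forms.\<close>
definition tractor_deriv2 :: "nat \<Rightarrow> (real^'d \<Rightarrow> real^'d^'d) \<Rightarrow> (real^'d \<Rightarrow> real^'d^'d^'d) \<Rightarrow>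
    (real^'d \<Rightarrow> real^'d^'d^'d) \<Rightarrow> (real^'d \<Rightarrow> 'd tractor) \<Rightarrow> 'd \<Rightarrow> 'd \<Rightarrow> real^'d \<Rightarrow>
    'd::finite tractor" where
  "tractor_deriv2 n J \<Gamma> \<Gamma>' s a b x =
     tractor_deriv n J \<Gamma> (tractor_deriv n J \<Gamma> s b) a x
     - (\<Sum>e\<in>UNIV. \<Gamma>' x $ e $ a $ b *\<^sub>R tractor_deriv n J \<Gamma> s e x)"

definition tractor_commutator :: "nat \<Rightarrow> (real^'d \<Rightarrow> real^'d^'d) \<Rightarrow> (real^'d \<Rightarrow> real^'d^'d^'d) \<Rightarrow>
    (real^'d \<Rightarrow> real^'d^'d^'d) \<Rightarrow> (real^'d \<Rightarrow> 'd tractor) \<Rightarrow> 'd \<Rightarrow> 'd \<Rightarrow> real^'d \<Rightarrow>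
    'd::finite tractor" where
  "tractor_commutator n J \<Gamma> \<Gamma>' s a b x =
     tractor_deriv2 n J \<Gamma> \<Gamma>' s a b x - tractor_deriv2 n J \<Gamma> \<Gamma>' s b a x"

text \<open>The right hand side of the curvature formula in Fedosov gauge, at the point \<open>x\<close> and applied to
  \<open>(\<sigma>, \<mu>, \<rho>)\<close>. Derivatives with raised index: $\nabla^c=J^{cd}\nabla_d$.\<close>
definition tractor_curvature :: "nat \<Rightarrow> (real^'d \<Rightarrow> real^'d^'d) \<Rightarrow> (real^'d \<Rightarrow> real^'d^'d^'d) \<Rightarrow>
    real^'d \<Rightarrow> 'd \<Rightarrow> 'd \<Rightarrow> 'd tractor \<Rightarrow> 'd::finite tractor" where
  "tractor_curvature n J \<Gamma> x a b = (\<lambda>(\<sigma>, \<mu>, \<rho>).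
     let \<mu>up = raise (J x) \<mu>;
         V = Vten n J \<Gamma> x;
         \<Phi> = Phi n J \<Gamma> x; \<Phi>up = raise2 (J x) \<Phi>;
         S = Sten n J \<Gamma> x; DS = cov1 \<Gamma> (Sten n J \<Gamma>) x;
         Y = Yten n J \<Gamma> x; DY = cov3 \<Gamma> (Yten n J \<Gamma>) x
     in
       (0,
        \<chi> c. (\<Sum>d\<in>UNIV. V $ a $ b $ c $ d * \<mu>up $ d) + Y $ a $ b $ c * \<sigma>,
        (\<Sum>c\<in>UNIV. Y $ a $ b $ c * \<mu>up $ c)
          - 1 / (2 * real n) *
            ((\<Sum>c\<in>UNIV. \<Sum>d\<in>UNIV. Jup (J x) $ c $ d * DY $ d $ a $ b $ c)
             - (\<Sum>c\<in>UNIV. \<Sum>e\<in>UNIV. V $ a $ b $ c $ e * \<Phi>up $ c $ e)) * \<sigma>)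
       - (2 * J x $ a $ b) *\<^sub>R
       (\<rho>,
        \<chi> c. S $ c * \<sigma> - (\<Sum>d\<in>UNIV. \<Phi> $ c $ d * \<mu>up $ d),
        (\<Sum>c\<in>UNIV. S $ c * \<mu>up $ c)
          - 1 / (2 * real n) *
            ((\<Sum>d\<in>UNIV. \<Sum>e\<in>UNIV. \<Phi> $ d $ e * \<Phi>up $ d $ e)
             + (\<Sum>c\<in>UNIV. \<Sum>d\<in>UNIV. Jup (J x) $ c $ d * DS $ d $ c)) * \<sigma>))"

end

theory Submission
  imports Defs
begin

text \<open>Put $A_{ab}=\nabla_a\alpha_b+\alpha_a\alpha_b$. Commuting derivatives on $J_{cd}$ shows that
  $R_{abcd}-J_{ca}A_{bd}+J_{cb}A_{ad}$ is symmetric in $cd$, so after this correction a general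
  representative pair behaves algebraically like a Fedosov gauge: $\Phi$ is a multiple of the trace
  over $ab$, and $\mathrm{P}_{ab}-\frac{3}{2n-1}\Phi_{ab}=\Phi_{ab}-A_{ab}$. Hence the connection is given
  by $\Phi$, $\alpha$ and their derivatives alone. Under a rescaling $\Phi$ does not change and
  $\hat A_{ab}=A_{ab}+\nabla_a\Upsilon_b-\Upsilon_a\Upsilon_b$; these two facts make the three slots
  transform as claimed. For the pairing $\langle\varphi,\psi\rangle=\varphi^b\psi_b$ one has
  $\nabla_a\langle\varphi,\psi\rangle=\langle\nabla_a\varphi,\psi\rangle+\langle\varphi,\nabla_a\psi\rangle
  +\varphi_a\langle\alpha,\psi\rangle-\psi_a\langle\alpha,\varphi\rangle$, and the term $J_{ab}\alpha^c\mu_c$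
  of the connection compensates the last two summands. In Fedosov gauge the curvature is obtained
  by commuting derivatives; the $\sigma$-coefficient of the last slot needs only the Ricci identity
  for $\Phi$ and the algebraic symmetries of the curvature.\<close>

section \<open>Partial derivatives and smooth functions\<close>

text \<open>The parts V, \<Phi>, P of the curvature are given by definite descriptions, so nothing,
  not even smoothness, is known of them before the decomposition has been solved explicitly; the
  closed formulas then serve smoothness, rescaling and change of chart alike. Fields are families of
  components, so each ingredient of the connection must also be shown to obey its transformation law
  between charts. The constants come from traces in dimension 2n: 4n+4 is the trace factor of the
  \<Phi>-terms in the corrected curvature, and 10n+7 is the value for which the last slot contains,
  besides $2\<alpha>^b\<Phi>_{ab}$, the combination
  $(\<nabla>^b\<Phi>_{ab}+\<alpha>^b\<Phi>_{ab})/(2n+1)$, which a rescaling merely multiplies by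
  $\<Omega>^{-2}$. Throughout, a derivative index is a fixed label and the remaining indices are
  packed into vectors and matrices, so that most index computations become the product rule and
  associativity.\<close>

lemma has_partial: "(f has_derivative f') (at x) \<Longrightarrow> partial i f x = f' (axis i 1)"
  unfolding partial_def using frechet_derivative_at[of f f' x] by simp

text \<open>Functions that agree near x have exactly the same candidate derivatives there, so the
  choice inside \<open>frechet_derivative\<close> returns the same value for both, differentiable or
  not.\<close>

lemma partial_cong:
  assumes "open S" "x \<in> S" "\<And>y. y \<in> S \<Longrightarrow> f y = g y"
  shows "partial i f x = partial i g x"
proof -
  have "(f has_derivative f') (at x) \<longleftrightarrow> (g has_derivative f') (at x)" for f'
    using assms has_derivative_transform_within_open[of f f' x UNIV S g]
      has_derivative_transform_within_open[of g f' x UNIV S f] by auto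
  then show ?thesis by (simp add: partial_def frechet_derivative_def)
qed

lemma differentiable_cong:
  assumes "open S" "x \<in> S" "\<And>y. y \<in> S \<Longrightarrow> f y = g y"
  shows "f differentiable (at x) \<longleftrightarrow> g differentiable (at x)"
  using assms has_derivative_transform_within_open[of f _ x UNIV S g]
      has_derivative_transform_within_open[of g _ x UNIV S f] unfolding differentiable_def by metis

lemma partial_const [simp]: "partial i (\<lambda>x. c) x = 0"
  by (simp add: partial_def)

lemma partial_add:
  "f differentiable (at x) \<Longrightarrow> g differentiable (at x) \<Longrightarrow>
   partial i (\<lambda>y. f y + g y) x = partial i f x + partial i g x"
  unfolding frechet_derivative_works
  by (subst has_partial[OF has_derivative_add], assumption+) (simp add: partial_def)

lemma partial_diff:
  "f differentiable (at x) \<Longrightarrow> g differentiable (at x) \<Longrightarrow>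
   partial i (\<lambda>y. f y - g y) x = partial i f x - partial i g x"
  unfolding frechet_derivative_works
  by (subst has_partial[OF has_derivative_diff], assumption+) (simp add: partial_def)

lemma partial_linear:
  assumes "bounded_linear L" "f differentiable (at x)"
  shows "partial i (\<lambda>y. L (f y)) x = L (partial i f x)"
  using assms(2) unfolding frechet_derivative_works
  by (subst has_partial[OF bounded_linear.has_derivative[OF assms(1)]], assumption)
     (simp add: partial_def)

text \<open>One product rule for scalars, matrices, inner products and outer products alike.\<close>

lemma partial_bilinear:
  assumes "bounded_bilinear p" "f differentiable (at x)" "g differentiable (at x)"
  shows "partial i (\<lambda>y. p (f y) (g y)) x = p (f x) (partial i g x) + p (partial i f x) (g x)"
proof -
  have "((\<lambda>y. p (f y) (g y)) has_derivative
      (\<lambda>h. p (f x) (frechet_derivative g (at x) h) + p (frechet_derivative f (at x) h) (g x))) (at x)"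
    using assms(2,3) unfolding frechet_derivative_works by (rule bounded_bilinear.FDERIV[OF assms(1)])
  from has_partial[OF this] show ?thesis by (simp add: partial_def)
qed

lemmas partial_scaleR = partial_bilinear[OF bounded_bilinear_scaleR]
lemmas partial_mult = partial_bilinear[OF bounded_bilinear_mult]
lemmas partial_nth = partial_linear[OF bounded_linear_vec_nth]
lemmas partial_cmult = partial_linear[OF bounded_linear_mult_right]

lemma partial_sum:
  assumes "\<And>k. k \<in> I \<Longrightarrow> f k differentiable (at x)"
  shows "partial i (\<lambda>y. \<Sum>k\<in>I. f k y) x = (\<Sum>k\<in>I. partial i (f k) x)"
  using assms unfolding frechet_derivative_works
  by (subst has_partial[OF has_derivative_sum], assumption) (simp add: partial_def)

lemma vec_expand: "f = (\<Sum>k\<in>UNIV. f $ k *\<^sub>R (axis k 1 :: real^'e))"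
  by (simp add: vec_eq_iff axis_def if_distrib[of "(*) _"] cong: if_cong)

lemma partial_chain:
  assumes "f differentiable (at (\<psi> x))" "\<psi> differentiable (at x)"
  shows "partial i (\<lambda>y. f (\<psi> y)) x = (\<Sum>k\<in>UNIV. partial i \<psi> x $ k *\<^sub>R partial k f (\<psi> x))"
proof -
  let ?f = "frechet_derivative f (at (\<psi> x))" and ?p = "frechet_derivative \<psi> (at x)"
  have d: "(f has_derivative ?f) (at (\<psi> x))" "(\<psi> has_derivative ?p) (at x)"
    using assms unfolding frechet_derivative_works .
  have l: "linear ?f" using d(1) has_derivative_linear by blast
  have "partial i (\<lambda>y. f (\<psi> y)) x = ?f (?p (axis i 1))"
    by (rule has_partial[OF has_derivative_compose[OF d(2,1)]])
  also have "\<dots> = ?f (\<Sum>k\<in>UNIV. ?p (axis i 1) $ k *\<^sub>R axis k 1)"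
    by (subst vec_expand) (rule refl)
  also have "\<dots> = (\<Sum>k\<in>UNIV. ?p (axis i 1) $ k *\<^sub>R ?f (axis k 1))"
    by (simp only: linear_sum[OF l] linear_cmul[OF l])
  finally show ?thesis by (simp add: partial_def)
qed

lemma differentiable_linear:
  "bounded_linear L \<Longrightarrow> f differentiable (at x) \<Longrightarrow> (\<lambda>y. L (f y)) differentiable (at x)"
  unfolding differentiable_def using bounded_linear.has_derivative by blast

lemma differentiable_bilinear:
  "bounded_bilinear p \<Longrightarrow> f differentiable (at x) \<Longrightarrow> g differentiable (at x) \<Longrightarrow>
   (\<lambda>y. p (f y) (g y)) differentiable (at x)"
  unfolding differentiable_def using bounded_bilinear.FDERIV by blast

section \<open>Closure properties of smooth functions\<close>

lemma Ck_on_cong: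
  assumes "open S" "\<And>y. y \<in> S \<Longrightarrow> f y = g y"
  shows "Ck_on k S f \<longleftrightarrow> Ck_on k S g"
  using assms(2)
proof (induction k arbitrary: f g)
  case 0 then show ?case by (simp cong: continuous_on_cong)
next
  case (Suc k)
  have "Ck_on k S (partial i f) = Ck_on k S (partial i g)" for i
    by (rule Suc.IH) (rule partial_cong[OF assms(1)], use Suc.prems in auto)
  moreover have "f differentiable (at x) \<longleftrightarrow> g differentiable (at x)" if "x \<in> S" for x
    by (rule differentiable_cong[OF assms(1) that Suc.prems])
  ultimately show ?case by simp
qed

text \<open>The successor clause of \<open>Ck_on\<close> does not mention continuity; in the base
  case it comes from differentiability.\<close>

lemma Ck_on_Suc_imp: "Ck_on (Suc k) S f \<Longrightarrow> Ck_on k S f"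
proof (induction k arbitrary: f)
  case 0 then show ?case
    by (auto intro!: continuous_at_imp_continuous_on differentiable_imp_continuous_within)
next
  case (Suc k) then show ?case by (metis Ck_on.simps(2))
qed

lemma Ck_on_const: "Ck_on k (S :: (real^'d::finite) set) (\<lambda>x. c :: 'b::real_normed_vector)"
proof (induction k arbitrary: c)
  case (Suc k)
  have "partial i (\<lambda>x. c) = (\<lambda>x. 0)" for i :: 'd by auto
  then show ?case using Suc by simp
qed simp

lemma Ck_on_add:
  assumes "open S" "Ck_on k S f" "Ck_on k S g"
  shows "Ck_on k S (\<lambda>x. f x + g x)"
  using assms(2,3)
proof (induction k arbitrary: f g)
  case 0 then show ?case by (simp add: continuous_on_add)
next
  case (Suc k)
  have "Ck_on k S (partial i (\<lambda>x. f x + g x))" for i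
    by (subst Ck_on_cong[OF assms(1), where g="\<lambda>x. partial i f x + partial i g x"])
       (use Suc in \<open>auto simp: partial_add\<close>)
  with Suc.prems show ?case by simp
qed

lemma Ck_on_linear:
  assumes "open S" "bounded_linear L" "Ck_on k S f"
  shows "Ck_on k S (\<lambda>x. L (f x))"
  using assms(3)
proof (induction k arbitrary: f)
  case 0 then show ?case using bounded_linear.continuous_on[OF assms(2)] by simp
next
  case (Suc k)
  have "Ck_on k S (partial i (\<lambda>x. L (f x)))" for i
    by (subst Ck_on_cong[OF assms(1), where g="\<lambda>x. L (partial i f x)"])
       (use Suc in \<open>auto simp: partial_linear[OF assms(2)]\<close>)
  with Suc.prems show ?case by (simp add: differentiable_linear[OF assms(2)])
qed

text \<open>The product rule pairs a derivative of one factor with the other factor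
  undifferentiated, so the order of the latter is lowered by \<open>Ck_on_Suc_imp\<close> before the
  induction hypothesis applies.\<close>

lemma Ck_on_bilinear:
  assumes "open S" "bounded_bilinear p" "Ck_on k S f" "Ck_on k S g"
  shows "Ck_on k S (\<lambda>x. p (f x) (g x))"
  using assms(3,4)
proof (induction k arbitrary: f g)
  case 0 then show ?case using bounded_bilinear.continuous_on[OF assms(2)] by simp
next
  case (Suc k)
  have "Ck_on k S (partial i (\<lambda>x. p (f x) (g x)))" for i
  proof (subst Ck_on_cong[OF assms(1)])
    show "partial i (\<lambda>x. p (f x) (g x)) y = p (f y) (partial i g y) + p (partial i f y) (g y)"
      if "y \<in> S" for y
      using Suc.prems that by (simp add: partial_bilinear[OF assms(2)])
    show "Ck_on k S (\<lambda>y. p (f y) (partial i g y) + p (partial i f y) (g y))"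
      using Suc.prems Ck_on_Suc_imp[OF Suc.prems(1)] Ck_on_Suc_imp[OF Suc.prems(2)]
      by (intro Ck_on_add[OF assms(1)] Suc.IH) auto
  qed
  with Suc.prems show ?case by (simp add: differentiable_bilinear[OF assms(2)])
qed

lemma smooth_on_cong:
  "open S \<Longrightarrow> (\<And>y. y \<in> S \<Longrightarrow> f y = g y) \<Longrightarrow> smooth_on S f \<longleftrightarrow> smooth_on S g"
  unfolding smooth_on_def using Ck_on_cong by blast

text \<open>Transfers smoothness from an explicit formula valid on S. This is how it reaches
  functions such as \<open>Phi\<close> that are defined by a description.\<close>

lemma smooth_on_eq:
  "open S \<Longrightarrow> smooth_on S g \<Longrightarrow> (\<And>x. x \<in> S \<Longrightarrow> f x = g x) \<Longrightarrow> smooth_on S f"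
  using smooth_on_cong[of S f g] by simp

lemma smooth_on_differentiable: "smooth_on S f \<Longrightarrow> x \<in> S \<Longrightarrow> f differentiable (at x)"
  unfolding smooth_on_def by (metis Ck_on.simps(2))

lemma smooth_on_partial: "smooth_on S f \<Longrightarrow> smooth_on S (partial i f)"
  unfolding smooth_on_def by (metis Ck_on.simps(2))

lemma smooth_on_continuous: "smooth_on S f \<Longrightarrow> continuous_on S f"
  unfolding smooth_on_def by (metis Ck_on.simps(1))

lemma Ck_on_subset: "Ck_on k S f \<Longrightarrow> T \<subseteq> S \<Longrightarrow> Ck_on k T f"
  by (induction k arbitrary: f) (auto intro: continuous_on_subset)

lemma smooth_on_subset: "smooth_on S f \<Longrightarrow> T \<subseteq> S \<Longrightarrow> smooth_on T f"
  unfolding smooth_on_def using Ck_on_subset by blast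

lemma smooth_on_const [simp]: "smooth_on S (\<lambda>x. c)"
  by (simp add: smooth_on_def Ck_on_const)

lemma smooth_on_add: "open S \<Longrightarrow> smooth_on S f \<Longrightarrow> smooth_on S g \<Longrightarrow> smooth_on S (\<lambda>x. f x + g x)"
  by (simp add: smooth_on_def Ck_on_add)

lemma smooth_on_linear:
  "bounded_linear L \<Longrightarrow> open S \<Longrightarrow> smooth_on S f \<Longrightarrow> smooth_on S (\<lambda>x. L (f x))"
  by (simp add: smooth_on_def Ck_on_linear)

lemma smooth_on_bilinear:
  "bounded_bilinear p \<Longrightarrow> open S \<Longrightarrow> smooth_on S f \<Longrightarrow> smooth_on S g \<Longrightarrow> smooth_on S (\<lambda>x. p (f x) (g x))"
  by (simp add: smooth_on_def Ck_on_bilinear)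

lemmas smooth_on_minus = smooth_on_linear[OF bounded_linear_minus[OF bounded_linear_ident]]
lemmas smooth_on_mult = smooth_on_bilinear[OF bounded_bilinear_mult]
lemmas smooth_on_scaleR = smooth_on_bilinear[OF bounded_bilinear_scaleR]
lemmas smooth_on_nth = smooth_on_linear[OF bounded_linear_vec_nth]
lemmas smooth_on_fst = smooth_on_linear[OF bounded_linear_fst]
lemmas smooth_on_snd = smooth_on_linear[OF bounded_linear_snd]

lemma smooth_on_diff:
  "open S \<Longrightarrow> smooth_on S f \<Longrightarrow> smooth_on S g \<Longrightarrow> smooth_on S (\<lambda>x. f x - g x)"
  using smooth_on_add[of S f "\<lambda>x. - g x"] smooth_on_minus[of S g] by simp

lemma smooth_on_sum:
  assumes "open S" "\<And>k. k \<in> I \<Longrightarrow> smooth_on S (f k)"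
  shows "smooth_on S (\<lambda>x. \<Sum>k\<in>I. f k x)"
  using assms(2) by (induction I rule: infinite_finite_induct) (auto intro!: smooth_on_add assms(1))

lemma smooth_on_prod:
  fixes f :: "'i \<Rightarrow> real^'d::finite \<Rightarrow> real"
  assumes "open S" "\<And>k. k \<in> I \<Longrightarrow> smooth_on S (f k)"
  shows "smooth_on S (\<lambda>x. \<Prod>k\<in>I. f k x)"
  using assms(2) by (induction I rule: infinite_finite_induct) (auto intro!: smooth_on_mult assms(1))

lemma bounded_linear_axis: "bounded_linear (axis k :: 'b::euclidean_space \<Rightarrow> 'b^'e::finite)"
  by (auto intro!: linearI simp: linear_conv_bounded_linear[symmetric] vec_eq_iff axis_def)

lemma smooth_on_vec:
  fixes f :: "'e::finite \<Rightarrow> real^'d::finite \<Rightarrow> 'b::euclidean_space"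
  assumes "open S" "\<And>k. smooth_on S (f k)"
  shows "smooth_on S (\<lambda>x. \<chi> k. f k x)"
proof -
  have "(\<lambda>x. \<chi> k. f k x) = (\<lambda>x. \<Sum>k\<in>UNIV. axis k (f k x))"
    by (simp add: fun_eq_iff vec_eq_iff axis_def if_distrib cong: if_cong)
  then show ?thesis
    using assms by (auto intro!: smooth_on_sum smooth_on_linear[OF bounded_linear_axis])
qed

lemma smooth_on_Pair:
  assumes "open S" "smooth_on S f" "smooth_on S g"
  shows "smooth_on S (\<lambda>x. (f x, g x))"
proof -
  have "bounded_linear (\<lambda>x. (x, 0))" "bounded_linear (\<lambda>y. (0, y))"
    by (intro bounded_linear_Pair bounded_linear_ident bounded_linear_zero)+
  then have "smooth_on S (\<lambda>x. (f x, 0) + (0, g x))"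
    using assms by (intro smooth_on_add smooth_on_linear[of "\<lambda>x. (x, 0)"] smooth_on_linear[of "\<lambda>y. (0, y)"])
  then show ?thesis by simp
qed

text \<open>The derivative of 1/f is -(1/f) f' (1/f), in which 1/f reappears at the lower order
  covered by the induction hypothesis.\<close>

lemma Ck_on_inverse:
  fixes f :: "real^'d::finite \<Rightarrow> real"
  assumes "open S" "\<And>x. x \<in> S \<Longrightarrow> f x \<noteq> 0" "Ck_on k S f"
  shows "Ck_on k S (\<lambda>x. inverse (f x))"
  using assms(3)
proof (induction k)
  case 0 then show ?case using assms(2) by (auto intro: continuous_on_inverse)
next
  case (Suc k)
  have d: "f differentiable at y" if "y \<in> S" for y using Suc.prems that by simp
  have "Ck_on k S (partial i (\<lambda>x. inverse (f x)))" for i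
  proof (subst Ck_on_cong[OF assms(1)])
    show "partial i (\<lambda>x. inverse (f x)) y = - ((inverse (f y) * partial i f y) * inverse (f y))"
      if "y \<in> S" for y
      using d[OF that] assms(2)[OF that] unfolding frechet_derivative_works
      by (subst has_partial[OF Deriv.has_derivative_inverse]) (auto simp: partial_def)
    have "bounded_linear (\<lambda>z::real. - z)"
      by (intro bounded_linear_minus bounded_linear_ident)
    then show "Ck_on k S (\<lambda>y. - ((inverse (f y) * partial i f y) * inverse (f y)))"
      using Suc.IH[OF Ck_on_Suc_imp[OF Suc.prems]] Suc.prems
      by (intro Ck_on_linear[OF assms(1), where L=uminus] Ck_on_bilinear[OF assms(1) bounded_bilinear_mult]) simp_all
  qed
  then show ?case using d assms(2) by (auto intro: differentiable_inverse)
qed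

lemma smooth_on_inverse:
  fixes f :: "real^'d::finite \<Rightarrow> real"
  shows "open S \<Longrightarrow> (\<And>x. x \<in> S \<Longrightarrow> f x \<noteq> 0) \<Longrightarrow> smooth_on S f \<Longrightarrow> smooth_on S (\<lambda>x. inverse (f x))"
  by (simp add: smooth_on_def Ck_on_inverse)

lemma partial_ln:
  fixes f :: "real^'d::finite \<Rightarrow> real"
  assumes "f x > 0" "f differentiable (at x)"
  shows "partial i (\<lambda>y. ln (f y)) x = partial i f x * inverse (f x)"
    and "(\<lambda>y. ln (f y)) differentiable (at x)"
proof -
  have "((\<lambda>y. ln (f y)) has_derivative (\<lambda>h. frechet_derivative f (at x) h * inverse (f x))) (at x)"
    using assms unfolding frechet_derivative_works by (auto intro!: derivative_eq_intros simp: field_simps)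
  then show "partial i (\<lambda>y. ln (f y)) x = partial i f x * inverse (f x)"
    and "(\<lambda>y. ln (f y)) differentiable (at x)"
    using has_partial by (fastforce simp: partial_def differentiable_def)+
qed

text \<open>Both mixed partials are limits of the second difference quotient of \<open>f\<close> over a small square.\<close>
lemma second_difference:
  fixes f :: "real^'d::finite \<Rightarrow> real"
  assumes S: "\<And>a b. a \<in> {0..s} \<Longrightarrow> b \<in> {0..s} \<Longrightarrow> x + a *\<^sub>R axis i 1 + b *\<^sub>R axis j 1 \<in> S"
    and f: "\<And>y. y \<in> S \<Longrightarrow> f differentiable (at y)"
    and fi: "\<And>y. y \<in> S \<Longrightarrow> partial i f differentiable (at y)" and s: "s > 0"
  obtains a b where "a \<in> {0<..<s}" "b \<in> {0<..<s}"
    "f (x + s *\<^sub>R axis i 1 + s *\<^sub>R axis j 1) - f (x + s *\<^sub>R axis i 1) - f (x + s *\<^sub>R axis j 1) + f x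
     = s * s * partial j (partial i f) (x + a *\<^sub>R axis i 1 + b *\<^sub>R axis j 1)"
proof -
  have der: "((\<lambda>t. g (z + t *\<^sub>R axis k 1)) has_real_derivative partial k g (z + t *\<^sub>R axis k 1)) (at t)"
    if "g differentiable (at (z + t *\<^sub>R axis k 1))" for g :: "real^'d \<Rightarrow> real" and z k t
  proof -
    let ?g = "frechet_derivative g (at (z + t *\<^sub>R axis k 1))"
    have g: "(g has_derivative ?g) (at (z + t *\<^sub>R axis k 1))"
      using that unfolding frechet_derivative_works .
    have "((\<lambda>t. z + t *\<^sub>R axis k 1) has_derivative (\<lambda>h. h *\<^sub>R axis k 1)) (at t)"
      by (auto intro!: derivative_eq_intros)
    from has_derivative_compose[OF this g]
    have "((\<lambda>t. g (z + t *\<^sub>R axis k 1)) has_derivative (\<lambda>h. ?g (h *\<^sub>R axis k 1))) (at t)" .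
    moreover have "?g (h *\<^sub>R axis k 1) = partial k g (z + t *\<^sub>R axis k 1) * h" for h
      using linear_cmul[OF has_derivative_linear[OF g], of h] by (simp add: partial_def mult.commute)
    ultimately show ?thesis by (simp add: has_field_derivative_def)
  qed
  \<comment> \<open>The difference of f across the square in direction j, as a function of the
    position in direction i. The mean value theorem is applied to it first, and then to
    \<open>partial i f\<close> in direction j.\<close>
  let ?p = "\<lambda>t. f (x + s *\<^sub>R axis j 1 + t *\<^sub>R axis i 1) - f (x + t *\<^sub>R axis i 1)"
  let ?p' = "\<lambda>t. partial i f (x + s *\<^sub>R axis j 1 + t *\<^sub>R axis i 1) - partial i f (x + t *\<^sub>R axis i 1)"
  have "\<exists>a. 0 < a \<and> a < s \<and> ?p s - ?p 0 = (s - 0) * ?p' a"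
  proof (rule MVT2[OF s])
    show "(?p has_real_derivative ?p' t) (at t)" if "0 \<le> t" "t \<le> s" for t
      using S[of t s] S[of t 0] that s
      by (intro DERIV_diff der f) (auto simp: algebra_simps)
  qed
  then obtain a where a: "0 < a" "a < s" "?p s - ?p 0 = s * ?p' a" by auto
  let ?q = "\<lambda>t. partial i f (x + a *\<^sub>R axis i 1 + t *\<^sub>R axis j 1)"
  have "\<exists>b. 0 < b \<and> b < s \<and> ?q s - ?q 0 = (s - 0) * partial j (partial i f) (x + a *\<^sub>R axis i 1 + b *\<^sub>R axis j 1)"
  proof (rule MVT2[OF s])
    show "(?q has_real_derivative partial j (partial i f) (x + a *\<^sub>R axis i 1 + t *\<^sub>R axis j 1)) (at t)"
      if "0 \<le> t" "t \<le> s" for t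
      using S[of a t] that a by (intro der fi) auto
  qed
  then obtain b where b: "0 < b" "b < s"
    "?q s - ?q 0 = s * partial j (partial i f) (x + a *\<^sub>R axis i 1 + b *\<^sub>R axis j 1)" by auto
  have "?p s - ?p 0 = s * (?q s - ?q 0)" using a(3) by (simp add: add_ac)
  also have "\<dots> = s * s * partial j (partial i f) (x + a *\<^sub>R axis i 1 + b *\<^sub>R axis j 1)"
    using b(3) by simp
  finally have "f (x + s *\<^sub>R axis i 1 + s *\<^sub>R axis j 1) - f (x + s *\<^sub>R axis i 1) - f (x + s *\<^sub>R axis j 1) + f x
     = s * s * partial j (partial i f) (x + a *\<^sub>R axis i 1 + b *\<^sub>R axis j 1)"
    by (simp add: add_ac)
  then show ?thesis using that a b by auto
qed

text \<open>On a small square both mixed partials stay close to their values at x, and by the second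
  difference they take a common value at suitable points of it. Different values at x are therefore
  impossible.\<close>

lemma partial_commute_real:
  fixes f :: "real^'d::finite \<Rightarrow> real"
  assumes "open S" "smooth_on S f" "x \<in> S"
  shows "partial i (partial j f) x = partial j (partial i f) x"
proof (rule ccontr)
  let ?A = "partial i (partial j f)" and ?B = "partial j (partial i f)"
  assume "?A x \<noteq> ?B x"
  then have e: "dist (?A x) (?B x) / 2 > 0" (is "?e > 0") by simp
  have "continuous_on S ?A" "continuous_on S ?B"
    using assms(2) smooth_on_continuous smooth_on_partial by blast+
  then have "isCont ?A x" "isCont ?B x" using assms(1,3) continuous_on_eq_continuous_at by blast+
  moreover have "\<exists>d>0. \<forall>y. dist y x < d \<longrightarrow> dist (g y) (g x) < ?e" if "isCont g x" for g :: "real^'d \<Rightarrow> real"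
  proof -
    from that e obtain d where "d > 0" "\<forall>y. y \<noteq> x \<and> dist y x < d \<longrightarrow> dist (g y) (g x) < ?e"
      unfolding isCont_def tendsto_iff eventually_at by blast
    then show ?thesis using e by (metis dist_self)
  qed
  ultimately obtain d1 d2 where d: "d1 > 0" "\<And>y. dist y x < d1 \<Longrightarrow> dist (?A y) (?A x) < ?e"
    "d2 > 0" "\<And>y. dist y x < d2 \<Longrightarrow> dist (?B y) (?B x) < ?e"
    by metis
  obtain d0 where d0: "d0 > 0" "ball x d0 \<subseteq> S" using assms(1,3) open_contains_ball by blast
  \<comment> \<open>A point of the square of side s has distance at most 2s from x; dividing by 3
    keeps this strictly below all three radii.\<close>
  define s where "s = min d0 (min d1 d2) / 3"
  have s: "s > 0" using d d0 by (simp add: s_def)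
  have near: "dist (x + a *\<^sub>R axis k 1 + b *\<^sub>R axis l 1) x < min d0 (min d1 d2)"
    if "a \<in> {0..s}" "b \<in> {0..s}" for a b k l
  proof -
    have "norm (a *\<^sub>R axis k 1 + b *\<^sub>R (axis l 1 :: real^'d)) \<le> a + b"
      using that by (intro order_trans[OF norm_triangle_ineq]) simp
    also have "\<dots> < 3 * s" using that s by auto
    finally show ?thesis by (simp add: dist_norm s_def add.assoc)
  qed
  then have S: "x + a *\<^sub>R axis k 1 + b *\<^sub>R axis l 1 \<in> S" if "a \<in> {0..s}" "b \<in> {0..s}" for a b k l
  proof -
    have "dist (x + a *\<^sub>R axis k 1 + b *\<^sub>R axis l 1) x < d0" using near[OF that, of k l] by simp
    then show ?thesis using d0(2) by (auto simp: dist_commute)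
  qed
  have df: "f differentiable (at y)" "partial k f differentiable (at y)" if "y \<in> S" for y k
    using assms(2) smooth_on_partial smooth_on_differentiable that by blast+
  obtain a b where 1: "a \<in> {0<..<s}" "b \<in> {0<..<s}"
    "f (x + s *\<^sub>R axis i 1 + s *\<^sub>R axis j 1) - f (x + s *\<^sub>R axis i 1) - f (x + s *\<^sub>R axis j 1) + f x
     = s * s * ?B (x + a *\<^sub>R axis i 1 + b *\<^sub>R axis j 1)"
    by (rule second_difference[OF S df(1) df(2) s])
  obtain a' b' where 2: "a' \<in> {0<..<s}" "b' \<in> {0<..<s}"
    "f (x + s *\<^sub>R axis j 1 + s *\<^sub>R axis i 1) - f (x + s *\<^sub>R axis j 1) - f (x + s *\<^sub>R axis i 1) + f x
     = s * s * ?A (x + a' *\<^sub>R axis j 1 + b' *\<^sub>R axis i 1)"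
    by (rule second_difference[OF S df(1) df(2) s])
  \<comment> \<open>The second difference itself is symmetric in i and j.\<close>
  have "s * s * ?B (x + a *\<^sub>R axis i 1 + b *\<^sub>R axis j 1) = s * s * ?A (x + a' *\<^sub>R axis j 1 + b' *\<^sub>R axis i 1)"
    unfolding 1(3)[symmetric] 2(3)[symmetric] by (simp add: add_ac)
  then have "?B (x + a *\<^sub>R axis i 1 + b *\<^sub>R axis j 1) = ?A (x + a' *\<^sub>R axis j 1 + b' *\<^sub>R axis i 1)"
    using s by simp
  moreover have "dist (?B (x + a *\<^sub>R axis i 1 + b *\<^sub>R axis j 1)) (?B x) < ?e"
    using near[of a b i j] 1 by (intro d(4)) auto
  moreover have "dist (?A (x + a' *\<^sub>R axis j 1 + b' *\<^sub>R axis i 1)) (?A x) < ?e"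
    using near[of a' b' j i] 2 by (intro d(2)) auto
  ultimately show False
    by (simp add: dist_real_def abs_if split: if_splits)
qed

lemma partial_commute:
  fixes f :: "real^'d::finite \<Rightarrow> 'b::euclidean_space"
  assumes "open S" "smooth_on S f" "x \<in> S"
  shows "partial i (partial j f) x = partial j (partial i f) x"
proof (rule euclidean_eqI)
  fix b :: 'b
  have L: "bounded_linear (\<lambda>v. v \<bullet> b)" by (rule bounded_linear_inner_left)
  have "partial k (partial l f) x \<bullet> b = partial k (partial l (\<lambda>y. f y \<bullet> b)) x" for k l
  proof -
    have "partial k (partial l f) x \<bullet> b = partial k (\<lambda>y. partial l f y \<bullet> b) x"
      using assms by (intro partial_linear[OF L, symmetric] smooth_on_differentiable smooth_on_partial) auto
    also have "\<dots> = partial k (partial l (\<lambda>y. f y \<bullet> b)) x"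
      using assms by (intro partial_cong[OF assms(1,3)] partial_linear[OF L, symmetric] smooth_on_differentiable)
    finally show ?thesis .
  qed
  then show "partial i (partial j f) x \<bullet> b = partial j (partial i f) x \<bullet> b"
    using partial_commute_real[OF assms(1) smooth_on_linear[OF L assms(1,2)] assms(3)] by metis
qed

section \<open>Covariant derivatives and the Ricci identities\<close>

lemma bounded_bilinear_matrix_mult: "bounded_bilinear ((**) :: real^'b^'a \<Rightarrow> real^'c^'b \<Rightarrow> real^'c^'a)"
  unfolding bilinear_conv_bounded_bilinear[symmetric]
  by (auto simp: bilinear_def matrix_matrix_mult_def vec_eq_iff sum.distrib sum_distrib_left algebra_simps intro!: linearI)

lemma bounded_bilinear_matrix_vector_mult: "bounded_bilinear ((*v) :: real^'b^'a \<Rightarrow> real^'b \<Rightarrow> real^'a)"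
  unfolding bilinear_conv_bounded_bilinear[symmetric]
  by (auto simp: bilinear_def matrix_vector_mult_def vec_eq_iff sum.distrib sum_distrib_left algebra_simps intro!: linearI)

lemma bounded_bilinear_vector_matrix_mult: "bounded_bilinear ((v*) :: real^'a \<Rightarrow> real^'b^'a \<Rightarrow> real^'b)"
  unfolding bilinear_conv_bounded_bilinear[symmetric]
  by (auto simp: bilinear_def vector_matrix_mult_def vec_eq_iff sum.distrib sum_distrib_left algebra_simps intro!: linearI)

lemma bounded_linear_transpose: "bounded_linear (transpose :: real^'b^'a \<Rightarrow> real^'a^'b)"
  by (auto intro!: linearI simp: linear_conv_bounded_linear[symmetric] vec_eq_iff transpose_def)

text \<open>The connection as the matrix by which it acts on covectors: the upper index becomes the
  column. In this form the Ricci identities reduce to the product rule and associativity.\<close>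

definition conn :: "(real^'d \<Rightarrow> real^'d^'d^'d) \<Rightarrow> 'd \<Rightarrow> real^'d \<Rightarrow> real^'d^'d::finite" where
  "conn \<Gamma> a x = (\<chi> c e. \<Gamma> x $ e $ a $ c)"

text \<open>The direction a is a fixed label and not a tensor index, so iterating \<open>D1\<close>
  gives the second covariant derivative without its term in $\<Gamma>^e_{ab}$. For symmetric
  Christoffel symbols that term drops out of commutators.\<close>

definition D1 :: "(real^'d \<Rightarrow> real^'d^'d^'d) \<Rightarrow> 'd \<Rightarrow> (real^'d \<Rightarrow> real^'d) \<Rightarrow> real^'d \<Rightarrow> real^'d::finite" where
  "D1 \<Gamma> a \<phi> x = partial a \<phi> x - conn \<Gamma> a x *v \<phi> x"

definition D2 :: "(real^'d \<Rightarrow> real^'d^'d^'d) \<Rightarrow> 'd \<Rightarrow> (real^'d \<Rightarrow> real^'d^'d) \<Rightarrow> real^'d \<Rightarrow> real^'d^'d::finite" where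
  "D2 \<Gamma> a T x = partial a T x - conn \<Gamma> a x ** T x - T x ** transpose (conn \<Gamma> a x)"

text \<open>The \<open>(c, d)\<close> entry of \<open>curv \<Gamma> a b x\<close> is $R_{ab}{}^d{}_c$.\<close>
definition curv :: "(real^'d \<Rightarrow> real^'d^'d^'d) \<Rightarrow> 'd \<Rightarrow> 'd \<Rightarrow> real^'d \<Rightarrow> real^'d^'d::finite" where
  "curv \<Gamma> a b x = partial a (conn \<Gamma> b) x - partial b (conn \<Gamma> a) x
     - conn \<Gamma> a x ** conn \<Gamma> b x + conn \<Gamma> b x ** conn \<Gamma> a x"

lemma cov1_D1: "cov1 \<Gamma> \<phi> x $ a = D1 \<Gamma> a \<phi> x"
  by (simp add: cov1_def D1_def conn_def matrix_vector_mult_def vec_eq_iff)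

lemma cov2_D2: "cov2 \<Gamma> T x $ a = D2 \<Gamma> a T x"
  by (simp add: cov2_def D2_def conn_def matrix_matrix_mult_def transpose_def vec_eq_iff mult.commute)

lemma differentiable_nth: "f differentiable (at x) \<Longrightarrow> (\<lambda>y. f y $ b) differentiable (at x)"
  by (rule differentiable_linear[OF bounded_linear_vec_nth])

text \<open>Differentiating a row as a covector ignores the row index b; the sum restores its
  connection term.\<close>

lemma D1_row:
  assumes "T differentiable (at x)"
  shows "D1 \<Gamma> a (\<lambda>y. T y $ b) x = D2 \<Gamma> a T x $ b + (\<Sum>e\<in>UNIV. \<Gamma> x $ e $ a $ b *\<^sub>R T x $ e)"
  using assms
  by (simp add: D1_def D2_def partial_nth[OF assms] conn_def matrix_matrix_mult_def matrix_vector_mult_def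
      transpose_def vec_eq_iff mult.commute)

text \<open>The sum is the connection term of the index b that labels the slice, which the matrix
  derivative of the slice does not see.\<close>

lemma cov3_D2:
  assumes "X differentiable (at x)"
  shows "cov3 \<Gamma> X x $ a $ b = D2 \<Gamma> a (\<lambda>y. X y $ b) x - (\<Sum>e\<in>UNIV. \<Gamma> x $ e $ a $ b *\<^sub>R X x $ e)"
  by (simp add: cov3_def D2_def partial_nth[OF assms] conn_def matrix_matrix_mult_def
      transpose_def vec_eq_iff mult.commute algebra_simps)

lemma D1_cong: "open S \<Longrightarrow> x \<in> S \<Longrightarrow> (\<And>y. y \<in> S \<Longrightarrow> f y = g y) \<Longrightarrow> D1 \<Gamma> a f x = D1 \<Gamma> a g x"
  unfolding D1_def using partial_cong[of S x f g a] by simp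

lemma D2_cong: "open S \<Longrightarrow> x \<in> S \<Longrightarrow> (\<And>y. y \<in> S \<Longrightarrow> f y = g y) \<Longrightarrow> D2 \<Gamma> a f x = D2 \<Gamma> a g x"
  unfolding D2_def using partial_cong[of S x f g a] by simp

lemma D1_add: "f differentiable (at x) \<Longrightarrow> g differentiable (at x) \<Longrightarrow>
    D1 \<Gamma> a (\<lambda>y. f y + g y) x = D1 \<Gamma> a f x + D1 \<Gamma> a g x"
  by (simp add: D1_def partial_add matrix_vector_right_distrib)

lemma D1_diff: "f differentiable (at x) \<Longrightarrow> g differentiable (at x) \<Longrightarrow>
    D1 \<Gamma> a (\<lambda>y. f y - g y) x = D1 \<Gamma> a f x - D1 \<Gamma> a g x"
  by (simp add: D1_def partial_diff matrix_vector_mult_diff_distrib)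

lemma D1_scaleR: "r differentiable (at x) \<Longrightarrow> f differentiable (at x) \<Longrightarrow>
    D1 \<Gamma> a (\<lambda>y. r y *\<^sub>R f y) x = partial a r x *\<^sub>R f x + r x *\<^sub>R D1 \<Gamma> a f x"
  by (simp add: D1_def partial_scaleR matrix_vector_mult_scaleR algebra_simps)

lemma matrix_add_rdistrib': "(A + B) ** C = A ** C + B ** (C :: real^'c^'b)"
  using bounded_bilinear.add_left[OF bounded_bilinear_matrix_mult] .

lemma matrix_diff_rdistrib': "(A - B) ** C = A ** C - B ** (C :: real^'c^'b)"
  using bounded_bilinear.diff_left[OF bounded_bilinear_matrix_mult] .

lemma matrix_diff_ldistrib': "C ** (A - B) = C ** A - C ** (B :: real^'c^'b)"
  using bounded_bilinear.diff_right[OF bounded_bilinear_matrix_mult] .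

lemma matrix_minus_left: "(- A) ** B = - (A ** (B :: real^'c^'b))"
  using bounded_bilinear.minus_left[OF bounded_bilinear_matrix_mult] .

lemma matrix_minus_right: "A ** (- B) = - (A ** (B :: real^'c^'b))"
  using bounded_bilinear.minus_right[OF bounded_bilinear_matrix_mult] .

lemma transpose_linear: "transpose (A + B) = transpose A + transpose (B :: real^'b^'a)"
  "transpose (A - B) = transpose A - transpose (B :: real^'b^'a)" "transpose (- A) = - transpose (A :: real^'b^'a)"
  by (simp_all add: vec_eq_iff transpose_def)

lemmas matrix_algebra = matrix_add_rdistrib' matrix_add_ldistrib matrix_diff_rdistrib' matrix_diff_ldistrib'
  matrix_minus_left matrix_minus_right matrix_mul_assoc matrix_transpose_mul transpose_linear

lemma smooth_on_conn:
  assumes "open S" "smooth_on S \<Gamma>"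
  shows "smooth_on S (conn \<Gamma> a)"
  unfolding conn_def[abs_def]
  by (intro smooth_on_vec smooth_on_nth assms)

lemma smooth_on_D1:
  assumes "open S" "smooth_on S \<Gamma>" "smooth_on S \<phi>"
  shows "smooth_on S (D1 \<Gamma> a \<phi>)"
  unfolding D1_def[abs_def]
  by (intro smooth_on_diff smooth_on_partial smooth_on_bilinear[OF bounded_bilinear_matrix_vector_mult]
      smooth_on_conn assms)

lemma smooth_on_D2:
  assumes "open S" "smooth_on S \<Gamma>" "smooth_on S T"
  shows "smooth_on S (D2 \<Gamma> a T)"
  unfolding D2_def[abs_def]
  by (intro smooth_on_diff smooth_on_partial smooth_on_bilinear[OF bounded_bilinear_matrix_mult]
      smooth_on_conn smooth_on_linear[OF bounded_linear_transpose] assms)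

lemma smooth_on_curv:
  assumes "open S" "smooth_on S \<Gamma>"
  shows "smooth_on S (curv \<Gamma> a b)"
  unfolding curv_def[abs_def]
  by (intro smooth_on_diff smooth_on_add smooth_on_partial smooth_on_bilinear[OF bounded_bilinear_matrix_mult]
      smooth_on_conn assms)

lemma smooth_on_cov1:
  assumes "open S" "smooth_on S \<Gamma>" "smooth_on S \<phi>"
  shows "smooth_on S (cov1 \<Gamma> \<phi>)"
proof -
  have "cov1 \<Gamma> \<phi> = (\<lambda>x. \<chi> a. D1 \<Gamma> a \<phi> x)" by (simp add: fun_eq_iff vec_eq_iff flip: cov1_D1)
  then show ?thesis using assms by (simp add: smooth_on_vec smooth_on_D1)
qed

lemma smooth_on_cov2:
  assumes "open S" "smooth_on S \<Gamma>" "smooth_on S T"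
  shows "smooth_on S (cov2 \<Gamma> T)"
proof -
  have "cov2 \<Gamma> T = (\<lambda>x. \<chi> a. D2 \<Gamma> a T x)" by (simp add: fun_eq_iff vec_eq_iff flip: cov2_D2)
  then show ?thesis using assms by (simp add: smooth_on_vec smooth_on_D2)
qed

text \<open>Second partials cancel and the terms with first derivatives of \<phi> are symmetric in a
  and b. What remains is the curvature, with the minus sign of its action on covectors.\<close>

lemma ricci_vector:
  assumes S: "open S" "x \<in> S" and s: "smooth_on S \<Gamma>" "smooth_on S \<phi>"
  shows "D1 \<Gamma> a (D1 \<Gamma> b \<phi>) x - D1 \<Gamma> b (D1 \<Gamma> a \<phi>) x = - (curv \<Gamma> a b x *v \<phi> x)"
proof -
  have [simp]: "conn \<Gamma> c differentiable (at x)" "\<phi> differentiable (at x)"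
    "partial c \<phi> differentiable (at x)" for c
    using S s smooth_on_conn smooth_on_partial smooth_on_differentiable by blast+
  note bil = bounded_bilinear_matrix_vector_mult
  have eq: "D1 \<Gamma> e \<phi> = (\<lambda>y. partial e \<phi> y - conn \<Gamma> e y *v \<phi> y)" for e
    by (simp add: fun_eq_iff D1_def)
  have "D1 \<Gamma> c (D1 \<Gamma> e \<phi>) x = partial c (partial e \<phi>) x - conn \<Gamma> e x *v partial c \<phi> x
      - partial c (conn \<Gamma> e) x *v \<phi> x - conn \<Gamma> c x *v partial e \<phi> x + (conn \<Gamma> c x ** conn \<Gamma> e x) *v \<phi> x" for c e
    by (simp add: eq D1_def[of \<Gamma> c] partial_diff partial_bilinear[OF bil]
        differentiable_bilinear[OF bil] matrix_vector_mul_assoc matrix_vector_mult_diff_distrib)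
  then show ?thesis
    by (simp add: partial_commute[OF S(1) s(2) S(2), of a b] curv_def
        matrix_vector_mult_diff_rdistrib matrix_vector_mult_add_rdistrib)
qed

lemma ricci_matrix:
  assumes S: "open S" "x \<in> S" and s: "smooth_on S \<Gamma>" "smooth_on S T"
  shows "D2 \<Gamma> a (D2 \<Gamma> b T) x - D2 \<Gamma> b (D2 \<Gamma> a T) x = - (curv \<Gamma> a b x ** T x) - T x ** transpose (curv \<Gamma> a b x)"
proof -
  have d [simp]: "conn \<Gamma> c differentiable (at x)" "T differentiable (at x)"
    "partial c T differentiable (at x)" for c
    using S s smooth_on_conn smooth_on_partial smooth_on_differentiable by blast+
  have [simp]: "(\<lambda>x. transpose (conn \<Gamma> c x)) differentiable (at x)" for c
    by (intro differentiable_linear[OF bounded_linear_transpose] d)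
  note bil = bounded_bilinear_matrix_mult
  have eq: "D2 \<Gamma> e T = (\<lambda>y. partial e T y - conn \<Gamma> e y ** T y - T y ** transpose (conn \<Gamma> e y))" for e
    by (simp add: fun_eq_iff D2_def)
  have "D2 \<Gamma> c (D2 \<Gamma> e T) x = partial c (partial e T) x - conn \<Gamma> e x ** partial c T x
      - partial c (conn \<Gamma> e) x ** T x - T x ** transpose (partial c (conn \<Gamma> e) x)
      - partial c T x ** transpose (conn \<Gamma> e x)
      - conn \<Gamma> c x ** (partial e T x - conn \<Gamma> e x ** T x - T x ** transpose (conn \<Gamma> e x))
      - (partial e T x - conn \<Gamma> e x ** T x - T x ** transpose (conn \<Gamma> e x)) ** transpose (conn \<Gamma> c x)" for c e
    by (simp add: eq D2_def[of \<Gamma> c] partial_diff partial_bilinear[OF bil]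
        differentiable_bilinear[OF bil] partial_linear[OF bounded_linear_transpose])
  then show ?thesis
    by (simp add: partial_commute[OF S(1) s(2) S(2), of a b] curv_def matrix_algebra)
qed

lemma partial_conn:
  assumes "\<Gamma> differentiable (at x)"
  shows "partial a (conn \<Gamma> b) x $ c $ e = partial a \<Gamma> x $ e $ b $ c"
proof -
  have "linear (\<lambda>X :: real^'a^'a^'a. \<chi> c e. X $ e $ b $ c)"
    by (auto intro!: linearI simp: vec_eq_iff)
  then have "bounded_linear (\<lambda>X :: real^'a^'a^'a. \<chi> c e. X $ e $ b $ c)"
    by (simp add: linear_conv_bounded_linear)
  from partial_linear[OF this assms, of a] show ?thesis by (simp add: conn_def[abs_def])
qed

lemma curvature_curv:
  assumes "\<Gamma> differentiable (at x)" "\<And>k i j. \<Gamma> x $ k $ i $ j = \<Gamma> x $ k $ j $ i"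
  shows "curvature \<Gamma> x $ a $ b $ d $ c = curv \<Gamma> a b x $ c $ d"
proof -
  have v: "cov_vec \<Gamma> (\<lambda>y. axis c 1) = (\<lambda>y. \<chi> b d. \<Gamma> y $ d $ b $ c)"
    by (auto simp: cov_vec_def fun_eq_iff vec_eq_iff axis_def if_distrib cong: if_cong)
  have "linear (\<lambda>X :: real^'a^'a^'a. \<chi> b d. X $ d $ b $ c)"
    by (auto intro!: linearI simp: vec_eq_iff)
  then have l: "bounded_linear (\<lambda>X :: real^'a^'a^'a. \<chi> b d. X $ d $ b $ c)"
    by (simp add: linear_conv_bounded_linear)
  have p: "partial a (\<lambda>y. \<chi> b d. \<Gamma> y $ d $ b $ c) x $ b $ d = partial a \<Gamma> x $ d $ b $ c" for a b d
    using partial_linear[OF l assms(1), of a] by simp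
  \<comment> \<open>The terms in $\<Gamma>^e_{ab}$ cancel in the commutator because the connection
    is torsion-free.\<close>
  have "(\<Sum>e\<in>UNIV. \<Gamma> x $ e $ b $ a * \<Gamma> x $ d $ e $ c) = (\<Sum>e\<in>UNIV. \<Gamma> x $ e $ a $ b * \<Gamma> x $ d $ e $ c)"
    by (simp add: assms(2)[of _ b a])
  then show ?thesis
    by (simp add: curvature_def v cov_mix_def p curv_def partial_conn[OF assms(1)] matrix_matrix_mult_def
        conn_def mult.commute)
qed

text \<open>Written out, derivatives and products of Christoffel symbols cancel in pairs by the
  symmetry of the lower indices. The derivatives inherit this symmetry because it holds on an open
  set.\<close>

lemma first_bianchi:
  assumes S: "open S" "x \<in> S" and s: "smooth_on S \<Gamma>"
    and sym: "\<And>y k i j. y \<in> S \<Longrightarrow> \<Gamma> y $ k $ i $ j = \<Gamma> y $ k $ j $ i"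
  shows "curv \<Gamma> a b x $ d $ e + curv \<Gamma> b d x $ a $ e + curv \<Gamma> d a x $ b $ e = 0"
proof -
  have d: "\<Gamma> differentiable (at x)" using S s smooth_on_differentiable by blast
  have p: "partial a \<Gamma> x $ k $ i $ j = partial a \<Gamma> x $ k $ j $ i" for a k i j
  proof -
    have "partial a \<Gamma> x $ k $ i $ j = partial a (\<lambda>y. \<Gamma> y $ k $ i $ j) x" for i j
      using d by (simp add: partial_nth differentiable_nth)
    then show ?thesis using partial_cong[OF S, of "\<lambda>y. \<Gamma> y $ k $ i $ j" "\<lambda>y. \<Gamma> y $ k $ j $ i" a] sym by simp
  qed
  show ?thesis
    by (simp add: curv_def partial_conn[OF d] conn_def matrix_matrix_mult_def
       p[of _ _ b a] p[of _ _ d a] p[of _ _ d b] sym[OF S(2), of _ b a] sym[OF S(2), of _ d a] sym[OF S(2), of _ d b])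
qed

section \<open>Symplectic contractions and the curvature decomposition\<close>

text \<open>The argument is a function of two indices rather than a matrix, so that any two indices
  of an expression can be contracted with the others held fixed.\<close>

definition ctr :: "real^'d^'d \<Rightarrow> ('d \<Rightarrow> 'd \<Rightarrow> real) \<Rightarrow> real" where
  "ctr J F = (\<Sum>a\<in>UNIV. \<Sum>b\<in>UNIV. Jup J $ a $ b * F a b)"

text \<open>The pairing $\<phi>^b\<psi>_b$, with the index raised on the first argument.\<close>

definition pr :: "real^'d^'d \<Rightarrow> real^'d \<Rightarrow> real^'d \<Rightarrow> real" where
  "pr J \<phi> \<psi> = (Jup J *v \<phi>) \<bullet> \<psi>"

lemma raise_eq: "raise J \<phi> = Jup J *v \<phi>"
  by (simp add: raise_def matrix_vector_mult_def)

lemma pr_raise: "(\<Sum>b\<in>UNIV. raise J \<phi> $ b * \<psi> $ b) = pr J \<phi> \<psi>"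
  by (simp add: pr_def raise_eq inner_vec_def)

lemma pr_linear [simp]:
  "pr J (u + v) w = pr J u w + pr J v w" "pr J w (u + v) = pr J w u + pr J w v"
  "pr J (u - v) w = pr J u w - pr J v w" "pr J w (u - v) = pr J w u - pr J w v"
  "pr J (c *\<^sub>R u) w = c * pr J u w" "pr J w (c *\<^sub>R u) = c * pr J w u"
  "pr J (- u) w = - pr J u w" "pr J w (- u) = - pr J w u"
  "pr J 0 w = 0" "pr J w 0 = 0"
  by (simp_all add: pr_def inner_left_distrib inner_right_distrib inner_diff_left inner_diff_right
      matrix_vector_right_distrib matrix_vector_mult_diff_distrib matrix_vector_mult_scaleR
      bounded_bilinear.minus_right[OF bounded_bilinear_matrix_vector_mult])

lemma ctr_linear:
  "ctr J (\<lambda>a b. F a b + G a b) = ctr J F + ctr J G"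
  "ctr J (\<lambda>a b. F a b - G a b) = ctr J F - ctr J G"
  "ctr J (\<lambda>a b. - F a b) = - ctr J F"
  "ctr J (\<lambda>a b. c * F a b) = c * ctr J F"
  "ctr J (\<lambda>a b. F a b * c) = ctr J F * c"
  "ctr J (\<lambda>a b. 0) = 0"
  by (simp_all add: ctr_def algebra_simps sum.distrib sum_subtractf sum_negf sum_distrib_left sum_distrib_right)

locale symplectic =
  fixes J :: "real^'d^'d::finite"
  assumes skew: "transpose J = - J" and inv: "invertible J"
begin

lemma J_swap: "J $ a $ b = - J $ b $ a"
  using arg_cong[OF skew, of "\<lambda>M. M $ b $ a"] by (simp add: transpose_def)

lemma matrix_inv_mult: "J ** matrix_inv J = mat 1" "matrix_inv J ** J = mat 1"
  using someI_ex[OF inv[unfolded invertible_def]] by (simp_all add: matrix_inv_def)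

lemma J_transpose_Jup: "J ** transpose (Jup J) = mat 1" "transpose (Jup J) ** J = mat 1"
  using matrix_inv_mult by (simp_all add: Jup_def)

lemma Jup_skew: "transpose (Jup J) = - Jup J"
proof -
  let ?M = "matrix_inv J"
  have "transpose (J ** ?M) = mat 1" using matrix_inv_mult by simp
  then have "- (transpose ?M ** J) = mat 1"
    by (simp add: matrix_transpose_mul skew matrix_minus_right)
  then have "(- (transpose ?M ** J)) ** ?M = ?M" by simp
  then have "- transpose ?M = ?M"
    using matrix_inv_mult by (simp add: matrix_minus_left flip: matrix_mul_assoc)
  then show ?thesis by (simp add: Jup_def)
qed

lemma Jup_swap: "Jup J $ a $ b = - Jup J $ b $ a"
  using arg_cong[OF Jup_skew, of "\<lambda>M. M $ b $ a"] by (simp add: transpose_def)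

text \<open>The convention $J_{ac}J^{bc}=\<delta>_a^b$ contracts second indices, so $J^{ab}$ is
  minus the inverse matrix. This is the source of the signs in \<open>pr_row_right\<close> and
  \<open>ctr_contract\<close>.\<close>

lemma J_Jup: "J ** Jup J = - mat 1" "Jup J ** J = - mat 1"
proof -
  have "- (J ** Jup J) = mat 1" "- (Jup J ** J) = mat 1"
    using J_transpose_Jup by (simp_all add: Jup_skew matrix_minus_left matrix_minus_right)
  then show "J ** Jup J = - mat 1" "Jup J ** J = - mat 1"
    by (metis add.inverse_inverse)+
qed

lemma pr_swap: "pr J \<phi> \<psi> = - pr J \<psi> \<phi>"
proof -
  have "pr J \<phi> \<psi> = \<phi> \<bullet> (transpose (Jup J) *v \<psi>)"
    by (simp add: pr_def dot_lmul_matrix[symmetric] transpose_matrix_vector inner_commute)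
  then show ?thesis
    by (simp add: Jup_skew pr_def inner_commute bounded_bilinear.minus_left[OF bounded_bilinear_matrix_vector_mult])
qed

lemma pr_self [simp]: "pr J \<phi> \<phi> = 0"
  using pr_swap[of \<phi> \<phi>] by simp

lemma pr_row_right [simp]: "pr J \<phi> (J $ a) = - \<phi> $ a"
proof -
  have "pr J \<phi> (J $ a) = (J *v (Jup J *v \<phi>)) $ a"
    by (simp add: pr_def matrix_vector_mult_def[of J] inner_vec_def mult.commute)
  then show ?thesis
    by (simp add: matrix_vector_mul_assoc J_Jup bounded_bilinear.minus_left[OF bounded_bilinear_matrix_vector_mult])
qed

lemma pr_row_left [simp]: "pr J (J $ a) \<phi> = \<phi> $ a"
  using pr_swap[of "J $ a" \<phi>] by simp

lemma ctr_swap: "ctr J F = - ctr J (\<lambda>a b. F b a)"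
proof -
  have "ctr J F = (\<Sum>b\<in>UNIV. \<Sum>a\<in>UNIV. Jup J $ a $ b * F a b)"
    unfolding ctr_def by (rule sum.swap)
  also have "\<dots> = (\<Sum>b\<in>UNIV. \<Sum>a\<in>UNIV. - (Jup J $ b $ a * F a b))"
    by (subst Jup_swap) simp
  finally show ?thesis by (simp add: ctr_def sum_negf)
qed

lemma ctr_sym: "(\<And>a b. F a b = F b a) \<Longrightarrow> ctr J F = 0"
  using ctr_swap[of F] by simp

lemma Jup_J_sum: "(\<Sum>b\<in>UNIV. Jup J $ a $ b * J $ b $ d) = - (if a = d then 1 else 0)"
proof -
  have "(Jup J ** J) $ a $ d = - (if a = d then 1 else 0)" by (simp add: J_Jup mat_def)
  then show ?thesis by (simp add: matrix_matrix_mult_def)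
qed

lemma ctr_J: "ctr J (\<lambda>a b. J $ a $ b) = real CARD('d)"
proof -
  have "ctr J (\<lambda>a b. J $ a $ b) = - (\<Sum>a\<in>UNIV. \<Sum>b\<in>UNIV. Jup J $ a $ b * J $ b $ a)"
    by (subst J_swap) (simp add: ctr_def sum_negf)
  then show ?thesis by (simp add: Jup_J_sum sum_negf)
qed

lemma ctr_contract1: "ctr J (\<lambda>a b. f a * J $ b $ d) = - f d"
proof -
  have "ctr J (\<lambda>a b. f a * J $ b $ d) = (\<Sum>a\<in>UNIV. f a * (\<Sum>b\<in>UNIV. Jup J $ a $ b * J $ b $ d))"
    by (simp add: ctr_def sum_distrib_left mult_ac)
  then show ?thesis by (simp add: Jup_J_sum sum_negf if_distrib cong: if_cong)
qed

text \<open>All orientations and orders of factors are listed, so that the simplifier can match a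
  contraction without commuting products or swapping the indices of J.\<close>

lemma ctr_contract:
  "ctr J (\<lambda>a b. f a * J $ d $ b) = f d"
  "ctr J (\<lambda>a b. f b * J $ a $ d) = f d"
  "ctr J (\<lambda>a b. f b * J $ d $ a) = - f d"
  "ctr J (\<lambda>a b. J $ b $ d * f a) = - f d"
  "ctr J (\<lambda>a b. J $ d $ b * f a) = f d"
  "ctr J (\<lambda>a b. J $ a $ d * f b) = f d"
  "ctr J (\<lambda>a b. J $ d $ a * f b) = - f d"
proof -
  show *: "ctr J (\<lambda>a b. f a * J $ d $ b) = f d" for f d
    using ctr_contract1[of f d] by (subst J_swap) (simp add: ctr_linear)
  show **: "ctr J (\<lambda>a b. f b * J $ a $ d) = f d" for f d
    using ctr_contract1[of f d] by (subst ctr_swap) simp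
  show ***: "ctr J (\<lambda>a b. f b * J $ d $ a) = - f d"
    using *[of f d] by (subst ctr_swap) simp
  show "ctr J (\<lambda>a b. J $ b $ d * f a) = - f d" "ctr J (\<lambda>a b. J $ d $ b * f a) = f d"
    "ctr J (\<lambda>a b. J $ a $ d * f b) = f d" "ctr J (\<lambda>a b. J $ d $ a * f b) = - f d"
    using * ** *** ctr_contract1[of f d] by (simp_all add: mult.commute)
qed

lemmas ctr_simps = ctr_linear ctr_J ctr_contract1 ctr_contract

end

text \<open>In the applications \<open>A\<close> is $\nabla_a\alpha_b+\alpha_a\alpha_b$, which makes \<open>Q_of\<close> symmetric in
  its last two indices; this symmetry forces $\mathrm{P}-\frac{3}{2n-1}\Phi+A=\Phi$.\<close>

definition Q_of :: "real^'d^'d \<Rightarrow> real^'d^'d^'d^'d \<Rightarrow> real^'d^'d \<Rightarrow> 'd \<Rightarrow> 'd \<Rightarrow> 'd \<Rightarrow> 'd \<Rightarrow> real" where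
  "Q_of J R A a b c d = R $ a $ b $ c $ d - J $ c $ a * A $ b $ d + J $ c $ b * A $ a $ d"

text \<open>The trace over ab of the \<Phi>-terms of Q is $(4n+4)\<Phi>_{cd}$: the term
  $2J_{ab}\<Phi>_{cd}$ contributes 4n and each of the other four terms contributes 1.\<close>

definition Phi_of :: "nat \<Rightarrow> real^'d^'d \<Rightarrow> real^'d^'d^'d^'d \<Rightarrow> real^'d^'d \<Rightarrow> real^'d^'d" where
  "Phi_of n J R A = (\<chi> c d. ctr J (\<lambda>a b. Q_of J R A a b c d) / (4 * real n + 4))"

text \<open>The factor equals 1 + 3/(2n-1), whose second summand is the multiple of \<Phi> that the
  decomposition writes separately from P.\<close>

definition Rho_of :: "nat \<Rightarrow> real^'d^'d \<Rightarrow> real^'d^'d^'d^'d \<Rightarrow> real^'d^'d \<Rightarrow> real^'d^'d" where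
  "Rho_of n J R A = ((2 * real n + 2) / (2 * real n - 1)) *\<^sub>R Phi_of n J R A - A"

definition V_of :: "nat \<Rightarrow> real^'d^'d \<Rightarrow> real^'d^'d^'d^'d \<Rightarrow> real^'d^'d \<Rightarrow> real^'d^'d^'d^'d" where
  "V_of n J R A = (let F = Phi_of n J R A in
     \<chi> a b c d. Q_of J R A a b c d - 2 * J $ a $ b * F $ c $ d + F $ c $ a * J $ b $ d - F $ c $ b * J $ a $ d
       + J $ c $ a * F $ b $ d - J $ c $ b * F $ a $ d)"

text \<open>The pointwise algebra, free of derivatives, with A a symmetric correction that makes Q
  symmetric in its last two indices. In Fedosov gauge the correction is zero.\<close>

locale curvature_algebra = symplectic J for J :: "real^'d^'d::finite" +
  fixes n :: nat and R :: "real^'d^'d^'d^'d" and A :: "real^'d^'d"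
  assumes dim: "CARD('d) = 2 * n" "2 * n \<ge> 4"
    and A_sym: "A $ a $ b = A $ b $ a"
    and R_skew: "R $ a $ b $ c $ d = - R $ b $ a $ c $ d"
    and R_bianchi: "R $ a $ b $ c $ d + R $ b $ d $ c $ a + R $ d $ a $ c $ b = 0"
    and Q_sym: "Q_of J R A a b c d = Q_of J R A a b d c"
begin

lemma Q_skew: "Q_of J R A a b c d = - Q_of J R A b a c d"
  using R_skew[of a b c d] by (simp add: Q_of_def)

text \<open>The Bianchi identity of R cycles the first two indices with the fourth, and
  \<open>Q_sym\<close> moves it to the third. The A-terms cancel because A is symmetric.\<close>

lemma Q_cyclic: "Q_of J R A a b c d + Q_of J R A b c a d + Q_of J R A c a b d = 0"
proof -
  have "Q_of J R A a b d c + Q_of J R A b c d a + Q_of J R A c a d b = 0"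
    using R_bianchi[of a b d c] A_sym[of b c] A_sym[of a c] A_sym[of a b] by (simp add: Q_of_def)
  then show ?thesis by (simp add: Q_sym[of a b c d] Q_sym[of b c a d] Q_sym[of c a b d])
qed

text \<open>Being an equivalence, this yields existence and uniqueness together and evaluates all
  three descriptions. For uniqueness, the part of Q skew in c and d involves only M, and a trace of
  it gives (2-2n)M = 0, which determines P from \<Phi>. The trace over ab then gives \<Phi>, and V
  is what is left.\<close>

lemma curvature_decomposition_iff:
  "curvature_decomposition n J R V F P \<longleftrightarrow> V = V_of n J R A \<and> F = Phi_of n J R A \<and> P = Rho_of n J R A"
proof
  let ?Q = "Q_of J R A"
  have n: "real n \<ge> 2" "2 * real n - 1 \<noteq> 0" using dim by auto
  have alts: "6 / (2 * real n - 1) * alt G a b = 3 / (2 * real n - 1) * (G a b - G b a)"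
    "2 * alt G a b = G a b - G b a" for G :: "'d \<Rightarrow> 'd \<Rightarrow> real" and a b
    using n(2) by (simp_all add: alt_def divide_simps) (simp add: algebra_simps)
  {
    assume dec: "curvature_decomposition n J R V F P"
    then have "transpose F = F" "transpose P = P"
      unfolding curvature_decomposition_def by blast+
    then have F: "F $ a $ b = F $ b $ a" and P: "P $ a $ b = P $ b $ a" for a b
      by (auto simp: vec_eq_iff transpose_def)
    have V: "V $ a $ b $ c $ d = V $ a $ b $ d $ c" "ctr J (\<lambda>a b. V $ a $ b $ c $ d) = 0"
      and R: "R $ a $ b $ c $ d =
        V $ a $ b $ c $ d + 2 * J $ a $ b * F $ c $ d
        - 2 * alt (\<lambda>a b. F $ c $ a * J $ b $ d) a b
        + 6 / (2 * real n - 1) * alt (\<lambda>a b. J $ c $ a * F $ b $ d) a b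
        - 2 * alt (\<lambda>a b. J $ c $ a * P $ b $ d) a b" for a b c d
      using dec unfolding curvature_decomposition_def ctr_def by blast+
    \<comment> \<open>The defect in the expected relation between P and \<Phi>. Once it is split
      off, all other terms of Q are symmetric in c and d.\<close>
    define M where "M = (\<lambda>a b. P $ a $ b - 3 / (2 * real n - 1) * F $ a $ b + A $ a $ b - F $ a $ b)"
    have M: "M a b = M b a" for a b by (simp add: M_def F[of a b] P[of a b] A_sym[of a b])
    have Q: "?Q a b c d = V $ a $ b $ c $ d + 2 * J $ a $ b * F $ c $ d - F $ c $ a * J $ b $ d + F $ c $ b * J $ a $ d
      - J $ c $ a * F $ b $ d + J $ c $ b * F $ a $ d - J $ c $ a * M b d + J $ c $ b * M a d" for a b c d
      by (simp only: R Q_of_def alts M_def) (simp add: algebra_simps)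
    have "M b d = 0" for b d
    proof -
      have "- J $ c $ a * M b d + J $ c $ b * M a d + J $ d $ a * M b c - J $ d $ b * M a c = 0" for a c
        using Q[of a b c d] Q[of a b d c] Q_sym[of a b c d] V(1)[of a b c d]
          J_swap[of b d] J_swap[of a c] J_swap[of b c] J_swap[of a d] F[of c d] F[of c a] F[of c b] F[of b d] F[of a d]
        by simp
      \<comment> \<open>Contraction over c and a: the term with $J_{ca}$ gives -2n, two terms give 1
        each, and the last is the trace of a symmetric tensor.\<close>
      then have "ctr J (\<lambda>c a. - J $ c $ a * M b d + J $ c $ b * M a d + J $ d $ a * M b c - J $ d $ b * M a c) = ctr J (\<lambda>c a. 0)"
        by simp
      moreover have "ctr J (\<lambda>c a. M a c) = 0" by (rule ctr_sym) (rule M)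
      ultimately have "(2 - 2 * real n) * M b d = 0"
        by (simp add: ctr_simps dim algebra_simps M[of d b])
      then show ?thesis using n by simp
    qed
    note M0 = this
    have Fv: "F = Phi_of n J R A"
    proof -
      have "ctr J (\<lambda>a b. ?Q a b c d) = (4 * real n + 4) * F $ c $ d" for c d
        by (simp add: Q M0 ctr_simps V(2) dim algebra_simps F[of c d])
      then show ?thesis using n by (simp add: vec_eq_iff Phi_of_def)
    qed
    have "P = Rho_of n J R A"
      using M0 n by (simp add: vec_eq_iff Rho_of_def M_def Fv[symmetric] field_simps)
    moreover have "V = V_of n J R A"
      by (simp add: V_of_def Fv[symmetric] vec_eq_iff Q M0)
    ultimately show "V = V_of n J R A \<and> F = Phi_of n J R A \<and> P = Rho_of n J R A" using Fv by simp
  }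
  assume "V = V_of n J R A \<and> F = Phi_of n J R A \<and> P = Rho_of n J R A"
  then have V: "V $ a $ b $ c $ d = ?Q a b c d - 2 * J $ a $ b * F $ c $ d + F $ c $ a * J $ b $ d - F $ c $ b * J $ a $ d
       + J $ c $ a * F $ b $ d - J $ c $ b * F $ a $ d"
    and F: "F $ c $ d = ctr J (\<lambda>a b. ?Q a b c d) / (4 * real n + 4)"
    and P: "P $ a $ b = (2 * real n + 2) / (2 * real n - 1) * F $ a $ b - A $ a $ b" for a b c d
    by (simp_all add: V_of_def Phi_of_def Rho_of_def)
  have Fs: "F $ a $ b = F $ b $ a" for a b by (simp add: F Q_sym[of _ _ a b])
  have Vskew: "V $ a $ b $ c $ d = - V $ b $ a $ c $ d" for a b c d
    using Q_skew[of a b c d] J_swap[of a b] by (simp add: V)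
  show "curvature_decomposition n J R V F P"
    unfolding curvature_decomposition_def
  proof (intro conjI allI)
    show "transpose F = F" by (simp add: vec_eq_iff transpose_def Fs)
    show "transpose P = P" by (simp add: vec_eq_iff transpose_def P Fs A_sym)
    fix a b c d
    show "V $ a $ b $ c $ d = - V $ b $ a $ c $ d" by (rule Vskew)
    show "V $ a $ b $ c $ d = V $ a $ b $ d $ c"
      using Q_sym[of a b c d] J_swap[of b d] J_swap[of a c] J_swap[of b c] J_swap[of a d]
        Fs[of c d] Fs[of c a] Fs[of c b] Fs[of b d] Fs[of a d]
      by (simp add: V)
    have "V $ a $ b $ c $ d + V $ b $ c $ a $ d + V $ c $ a $ b $ d = 0"
      using Q_cyclic[of a b c d] J_swap[of b a] J_swap[of c a] J_swap[of c b] Fs[of c a] Fs[of c b] Fs[of a b]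
      by (simp add: V)
    then show "(V $ a $ b $ c $ d + V $ b $ c $ a $ d + V $ c $ a $ b $ d
                - V $ b $ a $ c $ d - V $ a $ c $ b $ d - V $ c $ b $ a $ d) / 6 = 0"
      using Vskew[of a b c d] Vskew[of b c a d] Vskew[of c a b d] by simp
    show "(\<Sum>a\<in>UNIV. \<Sum>b\<in>UNIV. Jup J $ a $ b * V $ a $ b $ c $ d) = 0"
    proof -
      have "ctr J (\<lambda>a b. ?Q a b c d) = (4 * real n + 4) * F $ c $ d"
        using n by (simp add: F)
      then have "ctr J (\<lambda>a b. V $ a $ b $ c $ d) = 0"
        by (simp add: V ctr_simps dim algebra_simps Fs[of c d])
      then show ?thesis by (simp add: ctr_def)
    qed
    have e: "P $ a $ b = F $ a $ b + 3 / (2 * real n - 1) * F $ a $ b - A $ a $ b" for a b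
      using n by (simp add: P field_simps)
    show "R $ a $ b $ c $ d =
        V $ a $ b $ c $ d + 2 * J $ a $ b * F $ c $ d
        - 2 * alt (\<lambda>a b. F $ c $ a * J $ b $ d) a b
        + 6 / (2 * real n - 1) * alt (\<lambda>a b. J $ c $ a * F $ b $ d) a b
        - 2 * alt (\<lambda>a b. J $ c $ a * P $ b $ d) a b"
      by (simp only: V e Q_of_def alts) (simp add: algebra_simps)
  qed
qed

end

lemma (in curvature_algebra) decomposition_the:
  "(THE V. \<exists>F P. curvature_decomposition n J R V F P) = V_of n J R A"
  "(THE F. \<exists>V P. curvature_decomposition n J R V F P) = Phi_of n J R A"
  "(THE P. \<exists>V F. curvature_decomposition n J R V F P) = Rho_of n J R A"
  by (simp_all add: curvature_decomposition_iff)

lemma (in curvature_algebra) Phi_of_sym: "Phi_of n J R A $ a $ b = Phi_of n J R A $ b $ a"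
  by (simp add: Phi_of_def Q_sym[of _ _ a b])

section \<open>Calculus in one gauge and one chart\<close>

definition outer :: "real^'d \<Rightarrow> real^'d \<Rightarrow> real^'d^'d::finite" where
  "outer u v = (\<chi> c d. u $ c * v $ d)"

lemma outer_nth [simp]: "outer u v $ c $ d = u $ c * v $ d"
  by (simp add: outer_def)

lemma bounded_bilinear_outer: "bounded_bilinear outer"
  unfolding bilinear_conv_bounded_bilinear[symmetric]
  by (auto simp: bilinear_def outer_def vec_eq_iff algebra_simps intro!: linearI)

lemma matrix_mult_outer: "M ** outer u v = outer (M *v u) v" "outer u v ** transpose M = outer u (M *v v)"
  by (simp_all add: vec_eq_iff matrix_matrix_mult_def matrix_vector_mult_def transpose_def
      sum_distrib_left sum_distrib_right mult_ac)

lemma outer_mult_vector: "outer u v *v w = (v \<bullet> w) *\<^sub>R u"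
  by (simp add: vec_eq_iff matrix_vector_mult_def inner_vec_def sum_distrib_left mult_ac)

lemma D2_outer:
  assumes "u differentiable (at x)" "v differentiable (at x)"
  shows "D2 \<Gamma> a (\<lambda>y. outer (u y) (v y)) x = outer (D1 \<Gamma> a u x) (v x) + outer (u x) (D1 \<Gamma> a v x)"
  by (simp add: D2_def D1_def partial_bilinear[OF bounded_bilinear_outer assms] matrix_mult_outer
      bounded_bilinear.diff_left[OF bounded_bilinear_outer] bounded_bilinear.diff_right[OF bounded_bilinear_outer])

lemma D2_diff: "f differentiable (at x) \<Longrightarrow> g differentiable (at x) \<Longrightarrow>
    D2 \<Gamma> a (\<lambda>y. f y - g y) x = D2 \<Gamma> a f x - D2 \<Gamma> a g x"
  by (simp add: D2_def partial_diff matrix_algebra)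

text \<open>Presents the entries of the inverse as quotients of determinants, hence as smooth
  functions of the entries of M.\<close>

lemma matrix_inv_cramer:
  fixes M :: "real^'d^'d"
  assumes "invertible M"
  shows "matrix_inv M $ j $ i = det (\<chi> r s. if s = j then axis i 1 $ r else M $ r $ s) / det M"
proof -
  have "M ** matrix_inv M = mat 1"
    using someI_ex[OF assms[unfolded invertible_def]] by (simp add: matrix_inv_def)
  then have "M *v (matrix_inv M *v axis i 1) = axis i 1"
    by (simp add: matrix_vector_mul_assoc)
  moreover have "det M \<noteq> 0" using assms by (simp add: invertible_det_nz)
  ultimately have "matrix_inv M *v axis i 1 = (\<chi> k. det (\<chi> r s. if s = k then axis i 1 $ r else M $ r $ s) / det M)"
    using cramer by blast
  then have "(matrix_inv M *v axis i 1) $ j = det (\<chi> r s. if s = j then axis i 1 $ r else M $ r $ s) / det M"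
    by simp
  then show ?thesis by (simp add: matrix_vector_mult_basis column_def)
qed

lemma smooth_on_det:
  fixes M :: "real^'e::finite \<Rightarrow> real^'d^'d::finite"
  assumes "open S" "\<And>i j. smooth_on S (\<lambda>x. M x $ i $ j)"
  shows "smooth_on S (\<lambda>x. det (M x))"
  unfolding det_def by (intro smooth_on_sum smooth_on_mult smooth_on_prod smooth_on_const assms)

lemma smooth_on_Jup:
  fixes J :: "real^'e::finite \<Rightarrow> real^'d^'d::finite"
  assumes S: "open S" and sm: "smooth_on S J" and inv: "\<And>x. x \<in> S \<Longrightarrow> invertible (J x)"
  shows "smooth_on S (\<lambda>x. Jup (J x))"
proof -
  let ?f = "\<lambda>x. \<chi> i j. det (\<chi> r s. if s = j then axis i 1 $ r else J x $ r $ s) * inverse (det (J x))"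
  have e: "smooth_on S (\<lambda>x. J x $ r $ s)" for r s by (intro smooth_on_nth S sm)
  have "smooth_on S (\<lambda>x. if s = j then c else J x $ r $ s)" for s j r c
    by (cases "s = j") (simp_all add: e)
  then have "smooth_on S ?f"
    using inv by (intro smooth_on_vec S smooth_on_mult smooth_on_det smooth_on_inverse e)
      (simp_all add: invertible_det_nz)
  moreover have "Jup (J x) = ?f x" if "x \<in> S" for x
    by (simp add: vec_eq_iff Jup_def transpose_def matrix_inv_cramer[OF inv[OF that]] divide_inverse)
  ultimately show ?thesis by (rule smooth_on_eq[OF S])
qed

text \<open>One representative pair in one chart. The form \<alpha> is a parameter, so that
  smoothness and closedness are hypotheses on a named function; \<open>alpha_eq\<close> identifies
  it on \<open>S\<close> with the described \<open>alpha J \<Gamma>\<close>.\<close>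

locale gauge =
  fixes S :: "(real^'d::finite) set" and n :: nat and J :: "real^'d \<Rightarrow> real^'d^'d"
    and \<Gamma> :: "real^'d \<Rightarrow> real^'d^'d^'d" and \<alpha> :: "real^'d \<Rightarrow> real^'d"
  assumes dim: "CARD('d) = 2 * n" "2 * n \<ge> 4"
    and S: "open S"
    and smooth_J: "smooth_on S J" and smooth_\<Gamma>: "smooth_on S \<Gamma>" and smooth_\<alpha>: "smooth_on S \<alpha>"
    and symplectic: "x \<in> S \<Longrightarrow> symplectic (J x)"
    and torsion_free: "x \<in> S \<Longrightarrow> \<Gamma> x $ k $ i $ j = \<Gamma> x $ k $ j $ i"
    and closed: "x \<in> S \<Longrightarrow> partial a \<alpha> x $ b = partial b \<alpha> x $ a"
    and is_alpha: "x \<in> S \<Longrightarrow> is_alpha_at J \<Gamma> x (\<alpha> x)"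
begin

lemma smooth_Jup: "smooth_on S (\<lambda>x. Jup (J x))"
  using symplectic by (intro smooth_on_Jup S smooth_J) (simp add: symplectic_def)

lemma n_pos: "real n \<ge> 2" "2 * real n - 1 > 0" "real n \<noteq> 0"
  using dim by auto

lemma is_alpha_D2: "is_alpha_at J \<Gamma> x \<beta> \<Longrightarrow> D2 \<Gamma> a J x = outer (J x $ a) \<beta> - outer \<beta> (J x $ a)"
proof -
  assume "is_alpha_at J \<Gamma> x \<beta>"
  then have "cov2 \<Gamma> J x $ a $ b $ c = J x $ a $ b * \<beta> $ c - J x $ a $ c * \<beta> $ b" for b c
  proof -
    assume "is_alpha_at J \<Gamma> x \<beta>"
    then have "cov2 \<Gamma> J x $ a $ b $ c = 2 * alt (\<lambda>b c. J x $ a $ b * \<beta> $ c) b c"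
      unfolding is_alpha_at_def by blast
    moreover have "2 * alt F b c = F b c - F c b" for F :: "'d \<Rightarrow> 'd \<Rightarrow> real" by (simp add: alt_def)
    ultimately show ?thesis by (simp only:)
  qed
  then show ?thesis by (simp add: vec_eq_iff mult.commute flip: cov2_D2)
qed

lemmas D2_J = is_alpha_D2[OF is_alpha]

text \<open>Tracing the defining equation over a and b leaves $(2n-1)\<beta>_c$, which determines
  \<beta>.\<close>

lemma alpha_unique:
  assumes x: "x \<in> S" and \<beta>: "is_alpha_at J \<Gamma> x \<beta>"
  shows "\<beta> = \<alpha> x"
proof -
  interpret symplectic "J x" by (rule symplectic[OF x])
  have "(2 * real n - 1) * \<beta> $ c = ctr (J x) (\<lambda>a b. D2 \<Gamma> a J x $ b $ c)" if "is_alpha_at J \<Gamma> x \<beta>" for \<beta> c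
    by (simp add: is_alpha_D2[OF that] ctr_simps dim algebra_simps)
  from this[OF \<beta>] this[OF is_alpha[OF x]]
  have "\<beta> $ c = \<alpha> x $ c" for c using n_pos by (metis less_irrefl mult_cancel_left)
  then show ?thesis by (simp add: vec_eq_iff)
qed

lemma alpha_eq: "x \<in> S \<Longrightarrow> alpha J \<Gamma> x = \<alpha> x"
  unfolding alpha_def using is_alpha alpha_unique by (metis the_equality)

lemmas smooth_differentiable = smooth_on_differentiable[of S]

lemma differentiable [simp]:
  assumes "x \<in> S"
  shows "J differentiable (at x)" "\<Gamma> differentiable (at x)" "\<alpha> differentiable (at x)"
    "(\<lambda>y. Jup (J y)) differentiable (at x)" "(\<lambda>y. J y $ a) differentiable (at x)"
  using assms smooth_J smooth_\<Gamma> smooth_\<alpha> smooth_Jup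
  by (auto intro!: smooth_differentiable smooth_on_nth[OF S])

lemma D1_J_row:
  assumes "x \<in> S"
  shows "D1 \<Gamma> a (\<lambda>y. J y $ b) x =
    J x $ a $ b *\<^sub>R \<alpha> x - \<alpha> x $ b *\<^sub>R J x $ a + (\<Sum>e\<in>UNIV. \<Gamma> x $ e $ a $ b *\<^sub>R J x $ e)"
  using assms by (simp add: D1_row D2_J vec_eq_iff)

definition A :: "real^'d \<Rightarrow> real^'d^'d" where
  "A x = cov1 \<Gamma> \<alpha> x + outer (\<alpha> x) (\<alpha> x)"

lemma A_row: "A x $ a = D1 \<Gamma> a \<alpha> x + \<alpha> x $ a *\<^sub>R \<alpha> x"
  by (simp add: A_def cov1_D1 vec_eq_iff)

lemma cov1_alpha_sym: "x \<in> S \<Longrightarrow> D1 \<Gamma> a \<alpha> x $ b = D1 \<Gamma> b \<alpha> x $ a"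
  using closed[of x a b] by (simp add: D1_def conn_def matrix_vector_mult_def torsion_free[of x _ a b])

lemma A_sym: "x \<in> S \<Longrightarrow> A x $ a $ b = A x $ b $ a"
  using cov1_alpha_sym by (simp add: A_row)

lemma smooth_A: "smooth_on S A"
  unfolding A_def[abs_def]
  by (intro smooth_on_add smooth_on_cov1 smooth_on_bilinear[OF bounded_bilinear_outer] S smooth_\<Gamma> smooth_\<alpha>)

lemma curvature_low_eq:
  "x \<in> S \<Longrightarrow> curvature_low J \<Gamma> x $ a $ b $ c $ d = (curv \<Gamma> a b x ** J x) $ d $ c"
  by (simp add: curvature_low_def curvature_curv torsion_free matrix_matrix_mult_def)

text \<open>In $\<nabla>_bJ_{cd}=J_{bc}\<alpha>_d-J_{bd}\<alpha>_c$ the rows of J are differentiated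
  once more by the same rule. This produces the products $\<alpha>_a\<alpha>_b$ of \<open>A\<close>;
  terms $\<alpha>_c\<alpha>_d$ cancel by skewness in c and d, and the $\<Gamma>^e_{ab}$-terms cancel
  in the commutator.\<close>

lemma Q_symmetric:
  assumes x: "x \<in> S"
  shows "Q_of (J x) (curvature_low J \<Gamma> x) (A x) a b c d = Q_of (J x) (curvature_low J \<Gamma> x) (A x) a b d c"
proof -
  interpret symplectic "J x" by (rule symplectic[OF x])
  have dd: "(\<lambda>y. outer (J y $ b) (\<alpha> y)) differentiable (at x)" "(\<lambda>y. outer (\<alpha> y) (J y $ b)) differentiable (at x)" for b
    using x by (auto intro!: differentiable_bilinear[OF bounded_bilinear_outer])
  have D: "D2 \<Gamma> a (D2 \<Gamma> b J) x = outer (D1 \<Gamma> a (\<lambda>y. J y $ b) x) (\<alpha> x) + outer (J x $ b) (D1 \<Gamma> a \<alpha> x)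
      - (outer (D1 \<Gamma> a \<alpha> x) (J x $ b) + outer (\<alpha> x) (D1 \<Gamma> a (\<lambda>y. J y $ b) x))" for a b
  proof -
    have "D2 \<Gamma> a (D2 \<Gamma> b J) x = D2 \<Gamma> a (\<lambda>y. outer (J y $ b) (\<alpha> y) - outer (\<alpha> y) (J y $ b)) x"
      by (rule D2_cong[OF S x]) (rule D2_J)
    then show ?thesis using x by (simp add: D2_diff dd D2_outer)
  qed
  have "(- (curv \<Gamma> a b x ** J x) - J x ** transpose (curv \<Gamma> a b x)) $ c $ d =
     (D2 \<Gamma> a (D2 \<Gamma> b J) x - D2 \<Gamma> b (D2 \<Gamma> a J) x) $ c $ d"
    by (simp only: ricci_matrix[OF S x smooth_\<Gamma> smooth_J])
  also have "\<dots> = J x $ b $ c * A x $ a $ d - J x $ a $ c * A x $ b $ d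
     - J x $ b $ d * A x $ a $ c + J x $ a $ d * A x $ b $ c"
    using x J_swap[of b a] torsion_free[of x _ a b] by (simp add: D D1_J_row A_row algebra_simps)
  finally have *: "(- (curv \<Gamma> a b x ** J x) - J x ** transpose (curv \<Gamma> a b x)) $ c $ d = \<dots>" .
  have "(J x ** transpose (curv \<Gamma> a b x)) $ c $ d = - (curv \<Gamma> a b x ** J x) $ d $ c"
    by (simp add: matrix_matrix_mult_def transpose_def sum_negf[symmetric] mult.commute J_swap[of c])
  with * show ?thesis
    using x J_swap[of b c] J_swap[of a c] J_swap[of b d] J_swap[of a d]
    by (simp add: Q_of_def curvature_low_eq algebra_simps)
qed

lemma curvature_algebra:
  assumes x: "x \<in> S"
  shows "curvature_algebra (J x) n (curvature_low J \<Gamma> x) (A x)"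
proof -
  interpret symplectic "J x" by (rule symplectic[OF x])
  show ?thesis
  proof unfold_locales
    fix a b c d
    have "curv \<Gamma> a b x = - curv \<Gamma> b a x" by (simp add: curv_def)
    then show "curvature_low J \<Gamma> x $ a $ b $ c $ d = - curvature_low J \<Gamma> x $ b $ a $ c $ d"
      using x by (simp add: curvature_low_eq matrix_minus_left)
    have "curvature_low J \<Gamma> x $ a $ b $ c $ d + curvature_low J \<Gamma> x $ b $ d $ c $ a + curvature_low J \<Gamma> x $ d $ a $ c $ b
      = (\<Sum>e\<in>UNIV. (curv \<Gamma> a b x $ d $ e + curv \<Gamma> b d x $ a $ e + curv \<Gamma> d a x $ b $ e) * J x $ e $ c)"
      using x by (simp add: curvature_low_eq matrix_matrix_mult_def sum.distrib algebra_simps)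
    then show "curvature_low J \<Gamma> x $ a $ b $ c $ d + curvature_low J \<Gamma> x $ b $ d $ c $ a + curvature_low J \<Gamma> x $ d $ a $ c $ b = 0"
      using first_bianchi[OF S x smooth_\<Gamma> torsion_free] by simp
  qed (use dim A_sym Q_symmetric x in auto)
qed

text \<open>The third equation expresses \<open>Rho\<close> through \<open>Phi\<close> and
  \<open>A\<close>, and it is only in this form that \<open>Rho\<close> enters the later
  proofs.\<close>

lemma decomposition_eq:
  assumes x: "x \<in> S"
  shows "Vten n J \<Gamma> x = V_of n (J x) (curvature_low J \<Gamma> x) (A x)"
    "Phi n J \<Gamma> x = Phi_of n (J x) (curvature_low J \<Gamma> x) (A x)"
    "Rho n J \<Gamma> x = ((2 * real n + 2) / (2 * real n - 1)) *\<^sub>R Phi n J \<Gamma> x - A x"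
  unfolding Vten_def Phi_def Rho_def curvature_algebra.decomposition_the[OF curvature_algebra[OF x]]
  by (simp_all add: Rho_of_def)

lemma Phi_sym: "x \<in> S \<Longrightarrow> Phi n J \<Gamma> x $ a $ b = Phi n J \<Gamma> x $ b $ a"
  using curvature_algebra.Phi_of_sym[OF curvature_algebra] by (simp add: decomposition_eq)

lemma smooth_Phi: "smooth_on S (Phi n J \<Gamma>)"
proof -
  let ?f = "\<lambda>x. \<chi> c d. (\<Sum>a\<in>UNIV. \<Sum>b\<in>UNIV. Jup (J x) $ a $ b *
      ((curv \<Gamma> a b x ** J x) $ d $ c - J x $ c $ a * A x $ b $ d + J x $ c $ b * A x $ a $ d))
      * inverse (4 * real n + 4)"
  have "smooth_on S ?f"
    by (intro smooth_on_vec smooth_on_mult smooth_on_sum smooth_on_add smooth_on_diff smooth_on_nth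
        smooth_on_bilinear[OF bounded_bilinear_matrix_mult] smooth_on_curv smooth_on_const
        S smooth_\<Gamma> smooth_J smooth_Jup smooth_A)
  moreover have "Phi n J \<Gamma> x = ?f x" if "x \<in> S" for x
    using that by (simp add: decomposition_eq Phi_of_def ctr_def Q_of_def curvature_low_eq divide_inverse)
  ultimately show ?thesis by (rule smooth_on_eq[OF S])
qed

lemma smooth_divPhi: "smooth_on S (divPhi n J \<Gamma>)"
  unfolding divPhi_def[abs_def]
  by (intro smooth_on_vec smooth_on_sum smooth_on_mult smooth_on_nth smooth_on_cov2 S smooth_\<Gamma> smooth_Jup smooth_Phi)

text \<open>With N for \<open>Jup (J x)\<close>, differentiating JN = -1 gives N' = N J' N.
  Substituting J' from \<open>D2_J\<close>, the connection terms collapse by JN = NJ = -1 and the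
  last summand is $N(\<nabla>_aJ)N$.\<close>

lemma partial_Jup:
  assumes x: "x \<in> S"
  shows "partial a (\<lambda>y. Jup (J y)) x = - (Jup (J x) ** conn \<Gamma> a x) - transpose (conn \<Gamma> a x) ** Jup (J x)
     + Jup (J x) ** (outer (J x $ a) (\<alpha> x) - outer (\<alpha> x) (J x $ a)) ** Jup (J x)"
proof -
  let ?N = "Jup (J x)" and ?N' = "partial a (\<lambda>y. Jup (J y)) x" and ?J' = "partial a J x"
  have NJ: "J y ** Jup (J y) = - mat 1" "Jup (J y) ** J y = - mat 1" if "y \<in> S" for y
    using symplectic.J_Jup[OF symplectic[OF that]] .
  have "partial a (\<lambda>y. J y ** Jup (J y)) x = partial a (\<lambda>y. - mat 1 :: real^'d^'d) x"
    by (rule partial_cong[OF S x]) (rule NJ)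
  then have "J x ** ?N' = - (?J' ** ?N)"
    using x by (simp add: partial_bilinear[OF bounded_bilinear_matrix_mult] eq_neg_iff_add_eq_0)
  then have "?N ** (J x ** ?N') = - (?N ** (?J' ** ?N))" by (simp add: matrix_minus_right)
  then have N': "?N' = ?N ** ?J' ** ?N"
    by (simp add: matrix_mul_assoc NJ[OF x] matrix_minus_left)
  have "?J' = conn \<Gamma> a x ** J x + J x ** transpose (conn \<Gamma> a x) + (outer (J x $ a) (\<alpha> x) - outer (\<alpha> x) (J x $ a))"
    using D2_J[OF x, of a] by (simp add: D2_def algebra_simps)
  moreover have "?N ** (conn \<Gamma> a x ** J x + J x ** transpose (conn \<Gamma> a x) + Z) ** ?N
     = - (?N ** conn \<Gamma> a x) - transpose (conn \<Gamma> a x) ** ?N + ?N ** Z ** ?N" for Z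
  proof -
    have "?N ** conn \<Gamma> a x ** J x ** ?N = - (?N ** conn \<Gamma> a x)"
      by (simp add: NJ[OF x] matrix_minus_right flip: matrix_mul_assoc)
    moreover have "?N ** J x ** transpose (conn \<Gamma> a x) ** ?N = - (transpose (conn \<Gamma> a x) ** ?N)"
      by (simp add: NJ[OF x] matrix_minus_left)
    ultimately show ?thesis by (simp add: matrix_add_rdistrib' matrix_add_ldistrib matrix_mul_assoc)
  qed
  ultimately show ?thesis by (simp add: N')
qed

lemma partial_pr:
  assumes x: "x \<in> S" and d: "\<phi> differentiable (at x)" "\<psi> differentiable (at x)"
  shows "partial a (\<lambda>y. pr (J y) (\<phi> y) (\<psi> y)) x =
    pr (J x) (D1 \<Gamma> a \<phi> x) (\<psi> x) + pr (J x) (\<phi> x) (D1 \<Gamma> a \<psi> x)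
    + \<phi> x $ a * pr (J x) (\<alpha> x) (\<psi> x) - \<psi> x $ a * pr (J x) (\<alpha> x) (\<phi> x)"
    and "(\<lambda>y. pr (J y) (\<phi> y) (\<psi> y)) differentiable (at x)"
proof -
  interpret symplectic "J x" by (rule symplectic[OF x])
  note bil = bounded_bilinear_matrix_vector_mult
  have dN: "(\<lambda>y. Jup (J y) *v \<phi> y) differentiable (at x)"
    using x d by (intro differentiable_bilinear[OF bil]) auto
  then show "(\<lambda>y. pr (J y) (\<phi> y) (\<psi> y)) differentiable (at x)"
    unfolding pr_def using d by (intro differentiable_bilinear[OF bounded_bilinear_inner])
  let ?N = "Jup (J x)" and ?G = "conn \<Gamma> a x"
  \<comment> \<open>Contraction of $\<nabla>_aJ$ with the raised \<phi>: the two extra summands of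
    the claim, those with \<alpha>, come from here.\<close>
  have X: "(outer (J x $ a) (\<alpha> x) - outer (\<alpha> x) (J x $ a)) *v (?N *v \<phi> x)
     = pr (J x) (\<phi> x) (\<alpha> x) *\<^sub>R J x $ a + \<phi> x $ a *\<^sub>R \<alpha> x"
    using pr_row_right[of "\<phi> x" a]
    by (simp add: matrix_vector_mult_diff_rdistrib outer_mult_vector pr_def inner_commute)
  have "(partial a (\<lambda>y. Jup (J y)) x *v \<phi> x) \<bullet> \<psi> x =
     - pr (J x) (?G *v \<phi> x) (\<psi> x) - pr (J x) (\<phi> x) (?G *v \<psi> x)
     + pr (J x) (pr (J x) (\<phi> x) (\<alpha> x) *\<^sub>R J x $ a + \<phi> x $ a *\<^sub>R \<alpha> x) (\<psi> x)"
    unfolding partial_Jup[OF x] X[symmetric]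
    by (simp add: pr_def matrix_vector_mult_diff_rdistrib matrix_vector_mult_add_rdistrib dot_lmul_matrix
        bounded_bilinear.minus_left[OF bil] inner_add_left inner_diff_left flip: matrix_vector_mul_assoc)
  moreover have "partial a (\<lambda>y. pr (J y) (\<phi> y) (\<psi> y)) x =
     pr (J x) (\<phi> x) (partial a \<psi> x) + (?N *v partial a \<phi> x + partial a (\<lambda>y. Jup (J y)) x *v \<phi> x) \<bullet> \<psi> x"
    unfolding pr_def
    using x d by (simp add: partial_bilinear[OF bounded_bilinear_inner] dN partial_bilinear[OF bil])
  ultimately show "partial a (\<lambda>y. pr (J y) (\<phi> y) (\<psi> y)) x =
    pr (J x) (D1 \<Gamma> a \<phi> x) (\<psi> x) + pr (J x) (\<phi> x) (D1 \<Gamma> a \<psi> x)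
    + \<phi> x $ a * pr (J x) (\<alpha> x) (\<psi> x) - \<psi> x $ a * pr (J x) (\<alpha> x) (\<phi> x)"
    using pr_swap[of "\<phi> x" "\<alpha> x"]
    by (simp add: D1_def inner_add_left algebra_simps) (simp add: pr_def)
qed

end

section \<open>The tractor connection in terms of \<open>Phi\<close>, \<open>A\<close> and
  \<open>\<alpha>\<close>\<close>

lemma pr_sum: "pr J \<phi> \<psi> = (\<Sum>a\<in>UNIV. \<Sum>b\<in>UNIV. Jup J $ a $ b * (\<phi> $ b * \<psi> $ a))"
  by (simp add: pr_def inner_vec_def matrix_vector_mult_def sum_distrib_left sum_distrib_right mult_ac)

lemma pr_ctr: "pr J \<phi> \<psi> = ctr J (\<lambda>a b. \<phi> $ b * \<psi> $ a)"
  by (simp add: pr_sum ctr_def)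

text \<open>The sign changes because $\<mu>^b=J^{bc}\<mu>_c$ contracts the second index of $J^{bc}$:
  thus $-J^{bc}\<mu>_b\<nu>_c=\<mu>^b\<nu>_b$.\<close>

lemma skew_form_pr:
  assumes "symplectic J"
  shows "skew_form J s t = fst s * snd (snd t) + pr J (fst (snd s)) (fst (snd t)) - snd (snd s) * fst t"
proof -
  interpret symplectic J by (rule assms)
  have "(\<Sum>b\<in>UNIV. \<Sum>c\<in>UNIV. Jup J $ b $ c * \<mu> $ b * \<nu> $ c) = - pr J \<mu> \<nu>" for \<mu> \<nu>
    unfolding pr_swap[of \<mu> \<nu>] by (simp add: pr_sum mult_ac)
  then show ?thesis by (simp add: skew_form_def case_prod_beta)
qed

lemma tractor_deriv_cong:
  assumes "open S" "x \<in> S" "\<And>y. y \<in> S \<Longrightarrow> s y = t y"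
  shows "tractor_deriv n J \<Gamma> s a x = tractor_deriv n J \<Gamma> t a x"
proof -
  have "partial a (\<lambda>y. fst (s y)) x = partial a (\<lambda>y. fst (t y)) x"
    "partial a (\<lambda>y. fst (snd (s y))) x = partial a (\<lambda>y. fst (snd (t y))) x"
    "partial a (\<lambda>y. snd (snd (s y))) x = partial a (\<lambda>y. snd (snd (t y))) x"
    using assms by (auto intro!: partial_cong[OF assms(1,2)])
  then show ?thesis using assms by (simp add: tractor_deriv_def cov1_D1 D1_def)
qed

context gauge begin

text \<open>The coefficient of -\<sigma> in the last slot. The quotient is kept as one group because
  the sum inside it is merely multiplied by $\<Omega>^{-2}$ under rescaling.\<close>

definition Z :: "'d \<Rightarrow> real^'d \<Rightarrow> real" where
  "Z a x = (divPhi n J \<Gamma> x $ a + pr (J x) (\<alpha> x) (Phi n J \<Gamma> x $ a)) / (2 * real n + 1)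
     + 2 * pr (J x) (\<alpha> x) (Phi n J \<Gamma> x $ a) - pr (J x) (\<alpha> x) (D1 \<Gamma> a \<alpha> x)"

lemma tractor_deriv_eq:
  assumes x: "x \<in> S"
  shows "tractor_deriv n J \<Gamma> s a x =
    (partial a (\<lambda>y. fst (s y)) x - fst (snd (s x)) $ a,
     D1 \<Gamma> a (\<lambda>y. fst (snd (s y))) x - snd (snd (s x)) *\<^sub>R J x $ a
       + fst (s x) *\<^sub>R (Phi n J \<Gamma> x $ a - A x $ a) - pr (J x) (\<alpha> x) (fst (snd (s x))) *\<^sub>R J x $ a,
     partial a (\<lambda>y. snd (snd (s y))) x + pr (J x) (fst (snd (s x))) (Phi n J \<Gamma> x $ a - A x $ a)
       - Z a x * fst (s x))"
proof -
  interpret symplectic "J x" by (rule symplectic[OF x])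
  let ?F = "Phi n J \<Gamma> x" and ?P = "Rho n J \<Gamma> x"
  have D\<alpha>: "cov1 \<Gamma> (alpha J \<Gamma>) x $ a = D1 \<Gamma> a \<alpha> x"
    unfolding cov1_D1 by (rule D1_cong[OF S x]) (rule alpha_eq)
  have pr: "(\<Sum>b\<in>UNIV. u $ b * raise (J x) v $ b) = pr (J x) v u" for u v
    unfolding pr_raise[symmetric] by (simp add: mult.commute)
  have P: "?P $ a = ?F $ a + (3 / (2 * real n - 1)) *\<^sub>R ?F $ a - A x $ a"
  proof -
    have "(2 * real n + 2) / (2 * real n - 1) = 1 + 3 / (2 * real n - 1)"
      using n_pos by (simp add: field_simps)
    then show ?thesis by (simp add: decomposition_eq(3)[OF x] scaleR_add_left)
  qed
  \<comment> \<open>The part $\<alpha>_a\<alpha>_b$ of \<open>A\<close> vanishes when contracted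
    with $\<alpha>^b$.\<close>
  have A\<alpha>: "pr (J x) (\<alpha> x) (A x $ a) = pr (J x) (\<alpha> x) (D1 \<Gamma> a \<alpha> x)"
    by (simp add: A_row)
  \<comment> \<open>The origin of 10n+7: since 6(2n+1) - (10n+7) = 2n-1, exactly 1/(2n+1) remains
    besides the coefficient 2.\<close>
  have k: "2 * (t + 3 / (2 * real n - 1) * t - z) + z - (10 * real n + 7) / ((2 * real n + 1) * (2 * real n - 1)) * t
    = t / (2 * real n + 1) + 2 * t - z" for t z :: real
    using n_pos by (simp add: divide_simps) (simp add: algebra_simps)
  have "2 * pr (J x) (\<alpha> x) (?P $ a) + pr (J x) (\<alpha> x) (D1 \<Gamma> a \<alpha> x)
      - (10 * real n + 7) / ((2 * real n + 1) * (2 * real n - 1)) * pr (J x) (\<alpha> x) (?F $ a)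
    = Z a x - divPhi n J \<Gamma> x $ a / (2 * real n + 1)"
    using k[of "pr (J x) (\<alpha> x) (?F $ a)" "pr (J x) (\<alpha> x) (D1 \<Gamma> a \<alpha> x)"]
    by (simp add: P A\<alpha> Z_def add_divide_distrib)
  then have Z: "Z a x = divPhi n J \<Gamma> x $ a / (2 * real n + 1) + (2 * pr (J x) (\<alpha> x) (?P $ a) + pr (J x) (\<alpha> x) (D1 \<Gamma> a \<alpha> x)
      - (10 * real n + 7) / ((2 * real n + 1) * (2 * real n - 1)) * pr (J x) (\<alpha> x) (?F $ a))"
    by simp
  have 2: "(\<chi> b. cov1 \<Gamma> (\<lambda>y. fst (snd (s y))) x $ a $ b - J x $ a $ b * snd (snd (s x)) + ?P $ a $ b * fst (s x)
          - 3 / (2 * real n - 1) * ?F $ a $ b * fst (s x) - J x $ a $ b * pr (J x) (\<alpha> x) (fst (snd (s x))))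
    = D1 \<Gamma> a (\<lambda>y. fst (snd (s y))) x - snd (snd (s x)) *\<^sub>R J x $ a
       + fst (s x) *\<^sub>R (?F $ a - A x $ a) - pr (J x) (\<alpha> x) (fst (snd (s x))) *\<^sub>R J x $ a"
    by (simp add: vec_eq_iff cov1_D1 P algebra_simps)
  have 3: "pr (J x) \<mu> (?P $ a) - 3 / (2 * real n - 1) * pr (J x) \<mu> (?F $ a) = pr (J x) \<mu> (?F $ a - A x $ a)" for \<mu>
    by (simp add: P)
  show ?thesis
    unfolding tractor_deriv_def Let_def alpha_eq[OF x] pr_raise pr D\<alpha> 2 prod.inject 3[symmetric] Z
    by (simp add: algebra_simps)
qed

text \<open>The row of $\<Phi>-A$ enters the middle slot through \<sigma> and the last slot through
  \<mu>, and the two contributions cancel by skewness of \<open>pr\<close>. The Z-terms multiply the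
  product of the two \<sigma>'s with opposite signs.\<close>

lemma skew_form_parallel:
  assumes x: "x \<in> S" and s: "smooth_on S s" "smooth_on S t"
  shows "partial a (\<lambda>y. skew_form (J y) (s y) (t y)) x =
    skew_form (J x) (tractor_deriv n J \<Gamma> s a x) (t x) + skew_form (J x) (s x) (tractor_deriv n J \<Gamma> t a x)"
proof -
  interpret symplectic "J x" by (rule symplectic[OF x])
  have d [simp]: "(\<lambda>y. fst (u y)) differentiable (at x)" "(\<lambda>y. fst (snd (u y))) differentiable (at x)"
    "(\<lambda>y. snd (snd (u y))) differentiable (at x)" if "smooth_on S u" for u :: "real^'d \<Rightarrow> 'd tractor"
    using that S x by (auto intro!: smooth_differentiable smooth_on_fst smooth_on_snd)
  note s [simp]
  have "partial a (\<lambda>y. skew_form (J y) (s y) (t y)) x =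
     partial a (\<lambda>y. fst (s y) * snd (snd (t y)) + pr (J y) (fst (snd (s y))) (fst (snd (t y))) - snd (snd (s y)) * fst (t y)) x"
    by (rule partial_cong[OF S x]) (rule skew_form_pr[OF symplectic])
  also have "\<dots> = skew_form (J x) (tractor_deriv n J \<Gamma> s a x) (t x) + skew_form (J x) (s x) (tractor_deriv n J \<Gamma> t a x)"
    unfolding skew_form_pr[OF symplectic[OF x]] tractor_deriv_eq[OF x]
    using pr_swap[of "fst (snd (t x))" "Phi n J \<Gamma> x $ a"] pr_swap[of "fst (snd (t x))" "A x $ a"]
    by (simp add: partial_diff partial_add partial_mult partial_pr[OF x] algebra_simps)
  finally show ?thesis .
qed

lemma smooth_on_pr: "smooth_on S \<phi> \<Longrightarrow> smooth_on S \<psi> \<Longrightarrow> smooth_on S (\<lambda>x. pr (J x) (\<phi> x) (\<psi> x))"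
  unfolding pr_def
  by (intro smooth_on_bilinear[OF bounded_bilinear_inner] smooth_on_bilinear[OF bounded_bilinear_matrix_vector_mult] S smooth_Jup)

lemma smooth_on_Z: "smooth_on S (Z a)"
  unfolding Z_def[abs_def] divide_inverse
  by (intro smooth_on_diff smooth_on_add smooth_on_mult smooth_on_const smooth_on_nth smooth_on_pr smooth_on_D1
      smooth_Phi smooth_divPhi smooth_\<alpha> smooth_\<Gamma> S)

lemma smooth_on_tractor_deriv:
  assumes "smooth_on S s"
  shows "smooth_on S (tractor_deriv n J \<Gamma> s a)"
  by (rule smooth_on_eq[OF S _ tractor_deriv_eq])
     (intro smooth_on_Pair smooth_on_diff smooth_on_add smooth_on_mult smooth_on_scaleR smooth_on_nth smooth_on_pr
      smooth_on_partial smooth_on_D1 smooth_on_Z smooth_Phi smooth_A smooth_\<alpha> smooth_\<Gamma> smooth_J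
      smooth_on_fst smooth_on_snd S assms)

end

section \<open>Fedosov gauge: traces commute with covariant derivatives\<close>

lemma raise2_contract:
  "(\<Sum>c\<in>UNIV. \<Sum>e\<in>UNIV. X $ c $ e * raise2 J F $ c $ e) = ctr J (\<lambda>d c. pr J (F $ c) (X $ d))"
proof -
  have "(\<Sum>c\<in>UNIV. \<Sum>e\<in>UNIV. X $ c $ e * raise2 J F $ c $ e)
    = (\<Sum>c\<in>UNIV. \<Sum>e\<in>UNIV. \<Sum>d\<in>UNIV. \<Sum>f\<in>UNIV. Jup J $ c $ d * (Jup J $ e $ f * (F $ d $ f * X $ c $ e)))"
    by (simp add: raise2_def sum_distrib_left mult_ac)
  also have "\<dots> = (\<Sum>c\<in>UNIV. \<Sum>d\<in>UNIV. \<Sum>e\<in>UNIV. \<Sum>f\<in>UNIV. Jup J $ c $ d * (Jup J $ e $ f * (F $ d $ f * X $ c $ e)))"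
    by (intro sum.cong refl sum.swap)
  finally show ?thesis by (simp add: ctr_def pr_sum sum_distrib_left)
qed

text \<open>The gauge with the zero form in place of \<alpha>, so that the general results
  specialise by simplification.\<close>

locale fedosov = gauge S n J \<Gamma> "\<lambda>_. 0" for S :: "(real^'d::finite) set" and n J \<Gamma>
begin

lemma A_zero: "A x = 0"
  by (simp add: vec_eq_iff A_row D1_def)

lemma parallel_J: "x \<in> S \<Longrightarrow> D2 \<Gamma> a J x = 0"
  by (simp add: D2_J vec_eq_iff)

lemma Z_eq: "Z a x = Sten n J \<Gamma> x $ a"
  by (simp add: Z_def Sten_def D1_def)

text \<open>With A = 0 the curvature itself is symmetric in its last two indices, which removes the
  transposition of \<open>curvature_low_eq\<close>.\<close>

lemma Rlow:
  assumes x: "x \<in> S"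
  shows "Q_of (J x) (curvature_low J \<Gamma> x) (A x) a b c d = (curv \<Gamma> a b x ** J x) $ c $ d"
  using Q_symmetric[OF x, of a b c d] x
  by (simp add: Q_of_def curvature_low_eq A_zero)

text \<open>Raising undoes the lowering up to sign, so that $R_{abcd}\<mu>^d$ is minus the matrix
  action, in agreement with the sign in \<open>ricci_vector\<close>.\<close>

lemma pr_Rlow:
  assumes x: "x \<in> S"
  shows "pr (J x) \<mu> ((M ** J x) $ c) = - (M *v \<mu>) $ c"
proof -
  interpret symplectic "J x" by (rule symplectic[OF x])
  have "pr (J x) \<mu> ((M ** J x) $ c) = ((M ** J x) *v (Jup (J x) *v \<mu>)) $ c"
    by (simp add: pr_def inner_vec_def matrix_vector_mult_def[of "M ** J x"] mult.commute)
  also have "\<dots> = ((M ** (J x ** Jup (J x))) *v \<mu>) $ c"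
    by (simp add: matrix_vector_mul_assoc matrix_mul_assoc)
  finally show ?thesis
    by (simp add: J_Jup matrix_minus_right bounded_bilinear.minus_left[OF bounded_bilinear_matrix_vector_mult])
qed

lemma V_row:
  assumes x: "x \<in> S"
  shows "Vten n J \<Gamma> x $ a $ b $ c = (curv \<Gamma> a b x ** J x) $ c - (2 * J x $ a $ b) *\<^sub>R Phi n J \<Gamma> x $ c
     + Phi n J \<Gamma> x $ c $ a *\<^sub>R J x $ b - Phi n J \<Gamma> x $ c $ b *\<^sub>R J x $ a
     + J x $ c $ a *\<^sub>R Phi n J \<Gamma> x $ b - J x $ c $ b *\<^sub>R Phi n J \<Gamma> x $ a"
  by (simp add: vec_eq_iff decomposition_eq(1,2)[OF x] V_of_def Let_def Rlow[OF x] mult_ac)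

lemma pr_V:
  assumes x: "x \<in> S"
  shows "pr (J x) \<mu> (Vten n J \<Gamma> x $ a $ b $ c) = - (curv \<Gamma> a b x *v \<mu>) $ c
     - 2 * J x $ a $ b * pr (J x) \<mu> (Phi n J \<Gamma> x $ c) - Phi n J \<Gamma> x $ c $ a * \<mu> $ b + Phi n J \<Gamma> x $ c $ b * \<mu> $ a
     + J x $ c $ a * pr (J x) \<mu> (Phi n J \<Gamma> x $ b) - J x $ c $ b * pr (J x) \<mu> (Phi n J \<Gamma> x $ a)"
  using symplectic.pr_row_right[OF symplectic[OF x]]
  by (simp add: V_row[OF x] pr_Rlow[OF x])

lemma Y_row: "Yten n J \<Gamma> x $ a $ b = D2 \<Gamma> a (Phi n J \<Gamma>) x $ b - D2 \<Gamma> b (Phi n J \<Gamma>) x $ a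
    + Sten n J \<Gamma> x $ b *\<^sub>R J x $ a - Sten n J \<Gamma> x $ a *\<^sub>R J x $ b + (2 * J x $ a $ b) *\<^sub>R Sten n J \<Gamma> x"
  by (simp add: Yten_def Let_def vec_eq_iff mult_ac flip: cov2_D2)

lemma smooth_Sten: "smooth_on S (Sten n J \<Gamma>)"
  unfolding Sten_def[abs_def] by (intro smooth_on_scaleR smooth_on_const S smooth_divPhi)

text \<open>Since J is parallel, the derivative of $J^{cd}$ consists of connection terms only. Facts
  1 and 2 move them onto the two indices of T.\<close>

lemma partial_ctr:
  assumes x: "x \<in> S" and T: "T differentiable (at x)"
  shows "partial a (\<lambda>y. ctr (J y) (\<lambda>c d. T y $ c $ d)) x = ctr (J x) (\<lambda>c d. D2 \<Gamma> a T x $ c $ d)"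
proof -
  let ?N = "Jup (J x)" and ?G = "conn \<Gamma> a x"
  have ctr: "ctr K (\<lambda>c d. M $ c $ d) = Jup K \<bullet> M" for K M :: "real^'d^'d"
    by (simp add: ctr_def inner_vec_def)
  have "(?N ** ?G) \<bullet> T x = (\<Sum>c\<in>UNIV. \<Sum>d\<in>UNIV. \<Sum>e\<in>UNIV. ?N $ c $ e * (?G $ e $ d * T x $ c $ d))"
    by (simp add: inner_vec_def matrix_matrix_mult_def sum_distrib_left sum_distrib_right mult_ac)
  also have "\<dots> = (\<Sum>c\<in>UNIV. \<Sum>e\<in>UNIV. \<Sum>d\<in>UNIV. ?N $ c $ e * (?G $ e $ d * T x $ c $ d))"
    by (intro sum.cong refl sum.swap)
  also have "\<dots> = ?N \<bullet> (T x ** transpose ?G)"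
    by (simp add: inner_vec_def matrix_matrix_mult_def transpose_def sum_distrib_left mult_ac)
  finally have 1: "(?N ** ?G) \<bullet> T x = ?N \<bullet> (T x ** transpose ?G)" .
  have "(transpose ?G ** ?N) \<bullet> T x = (\<Sum>c\<in>UNIV. \<Sum>d\<in>UNIV. \<Sum>e\<in>UNIV. ?N $ e $ d * (?G $ e $ c * T x $ c $ d))"
    by (simp add: inner_vec_def matrix_matrix_mult_def transpose_def sum_distrib_left sum_distrib_right mult_ac)
  also have "\<dots> = (\<Sum>c\<in>UNIV. \<Sum>e\<in>UNIV. \<Sum>d\<in>UNIV. ?N $ e $ d * (?G $ e $ c * T x $ c $ d))"
    by (intro sum.cong refl sum.swap)
  also have "\<dots> = (\<Sum>e\<in>UNIV. \<Sum>c\<in>UNIV. \<Sum>d\<in>UNIV. ?N $ e $ d * (?G $ e $ c * T x $ c $ d))"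
    by (rule sum.swap)
  also have "\<dots> = (\<Sum>e\<in>UNIV. \<Sum>d\<in>UNIV. \<Sum>c\<in>UNIV. ?N $ e $ d * (?G $ e $ c * T x $ c $ d))"
    by (intro sum.cong refl sum.swap)
  also have "\<dots> = ?N \<bullet> (?G ** T x)"
    by (simp add: inner_vec_def matrix_matrix_mult_def sum_distrib_left mult_ac)
  finally have 2: "(transpose ?G ** ?N) \<bullet> T x = ?N \<bullet> (?G ** T x)" .
  have "outer (J x $ a) 0 - outer 0 (J x $ a) = 0" by (simp add: vec_eq_iff)
  then have N': "partial a (\<lambda>y. Jup (J y)) x = - (?N ** ?G) - transpose ?G ** ?N"
    using partial_Jup[OF x, of a] by (simp add: matrix_matrix_mult_def vec_eq_iff)
  show ?thesis
    unfolding ctr using x T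
    by (simp add: partial_bilinear[OF bounded_bilinear_inner] N' D2_def inner_diff_left inner_diff_right 1 2)
qed

text \<open>The derivative passes through the trace. Of the connection terms in \<open>cov3\<close>
  the trace accounts for those of d and c; the one of the free index b is the one that
  \<open>cov1\<close> subtracts.\<close>

lemma cov1_divPhi:
  assumes x: "x \<in> S"
  shows "cov1 \<Gamma> (divPhi n J \<Gamma>) x $ a $ b = ctr (J x) (\<lambda>c d. cov3 \<Gamma> (cov2 \<Gamma> (Phi n J \<Gamma>)) x $ a $ d $ b $ c)"
proof -
  let ?X = "cov2 \<Gamma> (Phi n J \<Gamma>)"
  have X: "?X differentiable (at x)"
    using x by (intro smooth_differentiable smooth_on_cov2 S smooth_\<Gamma> smooth_Phi)
  let ?M = "\<lambda>y. \<chi> c d. ?X y $ d $ b $ c"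
  have "linear (\<lambda>X :: real^'d^'d^'d. \<chi> c d. X $ d $ b $ c)"
    by (auto intro!: linearI simp: vec_eq_iff)
  then have l: "bounded_linear (\<lambda>X :: real^'d^'d^'d. \<chi> c d. X $ d $ b $ c)"
    by (simp add: linear_conv_bounded_linear)
  have div: "divPhi n J \<Gamma> y $ b = ctr (J y) (\<lambda>c d. ?X y $ d $ b $ c)" for y b
    by (simp add: divPhi_def ctr_def)
  have "partial a (divPhi n J \<Gamma>) x $ b = partial a (\<lambda>y. ctr (J y) (\<lambda>c d. ?M y $ c $ d)) x"
    using x smooth_divPhi by (simp add: div[symmetric] partial_nth smooth_differentiable)
  also have "\<dots> = ctr (J x) (\<lambda>c d. D2 \<Gamma> a ?M x $ c $ d)"
    by (rule partial_ctr[OF x differentiable_linear[OF l X]])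
  also have "\<dots> = ctr (J x) (\<lambda>c d. cov3 \<Gamma> ?X x $ a $ d $ b $ c + (\<Sum>e\<in>UNIV. \<Gamma> x $ e $ a $ b * ?X x $ d $ e $ c))"
    by (simp add: D2_def cov3_def partial_linear[OF l X] conn_def matrix_matrix_mult_def transpose_def mult.commute
        algebra_simps)
  also have "\<dots> = ctr (J x) (\<lambda>c d. cov3 \<Gamma> ?X x $ a $ d $ b $ c) + ctr (J x) (\<lambda>c d. \<Sum>e\<in>UNIV. \<Gamma> x $ e $ a $ b * ?X x $ d $ e $ c)"
    by (rule ctr_linear)
  also have "ctr (J x) (\<lambda>c d. \<Sum>e\<in>UNIV. \<Gamma> x $ e $ a $ b * ?X x $ d $ e $ c) = (\<Sum>e\<in>UNIV. \<Gamma> x $ e $ a $ b * divPhi n J \<Gamma> x $ e)"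
  proof -
    have "ctr (J x) (\<lambda>c d. \<Sum>e\<in>I. f e c d) = (\<Sum>e\<in>I. ctr (J x) (f e))" if "finite I" for f and I :: "'d set"
      using that by (induction I rule: finite_induct) (simp_all add: ctr_linear)
    then show ?thesis by (simp add: div ctr_linear)
  qed
  finally show ?thesis by (simp add: cov1_def)
qed

lemma cov3_Y:
  assumes x: "x \<in> S"
  shows "cov3 \<Gamma> (Yten n J \<Gamma>) x $ d $ a $ b $ c =
     cov3 \<Gamma> (cov2 \<Gamma> (Phi n J \<Gamma>)) x $ d $ a $ b $ c - cov3 \<Gamma> (cov2 \<Gamma> (Phi n J \<Gamma>)) x $ d $ b $ a $ c
     + J x $ a $ c * cov1 \<Gamma> (Sten n J \<Gamma>) x $ d $ b - J x $ b $ c * cov1 \<Gamma> (Sten n J \<Gamma>) x $ d $ a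
     + 2 * J x $ a $ b * cov1 \<Gamma> (Sten n J \<Gamma>) x $ d $ c"
proof -
  let ?X = "cov2 \<Gamma> (Phi n J \<Gamma>)" and ?S = "Sten n J \<Gamma>"
  let ?Y = "\<lambda>y a b c. ?X y $ a $ b $ c - ?X y $ b $ a $ c
       + J y $ a $ c * ?S y $ b - J y $ b $ c * ?S y $ a + 2 * J y $ a $ b * ?S y $ c"
  have d: "?X differentiable (at x)" "?S differentiable (at x)" "J differentiable (at x)"
    using x by (auto intro!: smooth_differentiable smooth_on_cov2 S smooth_\<Gamma> smooth_Phi smooth_Sten)
  have Y: "Yten n J \<Gamma> y $ a $ b $ c = ?Y y a b c" for y a b c
    by (simp add: Yten_def Let_def)
  have sY: "Yten n J \<Gamma> differentiable (at x)"
  proof -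
    have "Yten n J \<Gamma> = (\<lambda>y. \<chi> a b c. ?Y y a b c)" by (simp add: fun_eq_iff vec_eq_iff Y)
    moreover have "smooth_on S (\<lambda>y. \<chi> a b c. ?Y y a b c)"
      by (intro smooth_on_vec smooth_on_add smooth_on_diff smooth_on_mult smooth_on_nth smooth_on_const S
        smooth_on_cov2 smooth_\<Gamma> smooth_Phi smooth_Sten smooth_J)
    ultimately show ?thesis using x smooth_differentiable by metis
  qed
  have nth: "partial d f x $ i $ j $ k = partial d (\<lambda>y. f y $ i $ j $ k) x" if "f differentiable (at x)"
    for f :: "real^'d \<Rightarrow> real^'d^'d^'d" and d i j k
    using that by (simp add: partial_nth differentiable_nth)
  note dn = differentiable_nth
  have "partial d (\<lambda>y. ?Y y a b c) x = partial d ?X x $ a $ b $ c - partial d ?X x $ b $ a $ c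
     + (J x $ a $ c * partial d ?S x $ b + partial d J x $ a $ c * ?S x $ b)
     - (J x $ b $ c * partial d ?S x $ a + partial d J x $ b $ c * ?S x $ a)
     + 2 * (J x $ a $ b * partial d ?S x $ c + partial d J x $ a $ b * ?S x $ c)"
    using d by (simp add: partial_add partial_diff partial_mult partial_cmult partial_nth dn mult.assoc)
  then have p: "partial d (Yten n J \<Gamma>) x $ a $ b $ c = partial d ?X x $ a $ b $ c - partial d ?X x $ b $ a $ c
     + (J x $ a $ c * partial d ?S x $ b + partial d J x $ a $ c * ?S x $ b)
     - (J x $ b $ c * partial d ?S x $ a + partial d J x $ b $ c * ?S x $ a)
     + 2 * (J x $ a $ b * partial d ?S x $ c + partial d J x $ a $ b * ?S x $ c)"
    unfolding nth[OF sY] Y .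
  have J': "partial d J x $ i $ j = (\<Sum>e\<in>UNIV. \<Gamma> x $ e $ d $ i * J x $ e $ j) + (\<Sum>e\<in>UNIV. \<Gamma> x $ e $ d $ j * J x $ i $ e)" for i j
    using arg_cong[OF parallel_J[OF x, of d], of "\<lambda>M. M $ i $ j"] unfolding cov2_D2[symmetric]
    by (simp add: cov2_def)
  show ?thesis
    unfolding cov3_def cov1_def
    by (simp add: p J' Y sum.distrib sum_subtractf sum_distrib_left algebra_simps)
qed

text \<open>The curvature is expressed through its lowered rows, so that the cyclic identity can be
  applied to them in \<open>contracted_identity\<close>.\<close>

lemma ricci_Phi:
  assumes x: "x \<in> S"
  shows "cov3 \<Gamma> (cov2 \<Gamma> (Phi n J \<Gamma>)) x $ d $ a $ b $ c - cov3 \<Gamma> (cov2 \<Gamma> (Phi n J \<Gamma>)) x $ a $ d $ b $ c =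
     - pr (J x) ((curv \<Gamma> d a x ** J x) $ b) (Phi n J \<Gamma> x $ c) - pr (J x) ((curv \<Gamma> d a x ** J x) $ c) (Phi n J \<Gamma> x $ b)"
proof -
  let ?X = "cov2 \<Gamma> (Phi n J \<Gamma>)" and ?F = "Phi n J \<Gamma>"
  interpret symplectic "J x" by (rule symplectic[OF x])
  have X: "?X differentiable (at x)"
    using x by (intro smooth_differentiable smooth_on_cov2 S smooth_\<Gamma> smooth_Phi)
  have "cov3 \<Gamma> ?X x $ d $ a $ b $ c - cov3 \<Gamma> ?X x $ a $ d $ b $ c
    = (D2 \<Gamma> d (D2 \<Gamma> a ?F) x - D2 \<Gamma> a (D2 \<Gamma> d ?F) x) $ b $ c"
    using x by (simp add: cov3_D2[OF X] cov2_D2 torsion_free[of x _ a d])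
  also have "\<dots> = - (curv \<Gamma> d a x ** ?F x) $ b $ c - (?F x ** transpose (curv \<Gamma> d a x)) $ b $ c"
    by (simp add: ricci_matrix[OF S x smooth_\<Gamma> smooth_Phi])
  also have "(curv \<Gamma> d a x ** ?F x) $ b $ c = (curv \<Gamma> d a x *v ?F x $ c) $ b"
    by (simp add: matrix_matrix_mult_def matrix_vector_mult_def Phi_sym[OF x])
  also have "(?F x ** transpose (curv \<Gamma> d a x)) $ b $ c = (curv \<Gamma> d a x *v ?F x $ b) $ c"
    by (simp add: matrix_matrix_mult_def matrix_vector_mult_def transpose_def mult.commute)
  finally show ?thesis
    using pr_Rlow[OF x, of "?F x $ c" "curv \<Gamma> d a x" b] pr_Rlow[OF x, of "?F x $ b" "curv \<Gamma> d a x" c]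
      pr_swap[of "(curv \<Gamma> d a x ** J x) $ b" "?F x $ c"] pr_swap[of "(curv \<Gamma> d a x ** J x) $ c" "?F x $ b"]
    by simp
qed

end

section \<open>The curvature in Fedosov gauge\<close>

lemma ctr_sum: "finite I \<Longrightarrow> ctr J (\<lambda>c d. \<Sum>e\<in>I. f e c d) = (\<Sum>e\<in>I. ctr J (f e))"
  by (induction I rule: finite_induct) (simp_all add: ctr_linear)

lemma ctr_pr: "ctr K (\<lambda>c d. pr J (X c d) u) = pr J (\<chi> f. ctr K (\<lambda>c d. X c d $ f)) u"
  by (simp add: pr_sum ctr_sum ctr_linear)

context fedosov begin

text \<open>Commuting the derivatives in $\nabla^c\nabla_a\Phi_{bc}$ gives $(2n+1)\nabla_aS_b$ and terms in
  curvature times $\Phi$, so that no differential Bianchi identity is needed.\<close>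
lemma contracted_identity:
  assumes x: "x \<in> S"
  shows "(\<Sum>c\<in>UNIV. \<Sum>d\<in>UNIV. Jup (J x) $ c $ d * cov3 \<Gamma> (Yten n J \<Gamma>) x $ d $ a $ b $ c)
    = 2 * real n * (cov1 \<Gamma> (Sten n J \<Gamma>) x $ a $ b - cov1 \<Gamma> (Sten n J \<Gamma>) x $ b $ a)
      + 2 * J x $ a $ b * (\<Sum>c\<in>UNIV. \<Sum>d\<in>UNIV. Jup (J x) $ c $ d * cov1 \<Gamma> (Sten n J \<Gamma>) x $ d $ c)
      + (\<Sum>c\<in>UNIV. \<Sum>e\<in>UNIV. Vten n J \<Gamma> x $ a $ b $ c $ e * raise2 (J x) (Phi n J \<Gamma> x) $ c $ e)
      + 2 * J x $ a $ b * (\<Sum>d\<in>UNIV. \<Sum>e\<in>UNIV. Phi n J \<Gamma> x $ d $ e * raise2 (J x) (Phi n J \<Gamma> x) $ d $ e)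
      + 4 * real n * pr (J x) (Phi n J \<Gamma> x $ a) (Phi n J \<Gamma> x $ b)"
proof -
  let ?J = "J x" and ?F = "Phi n J \<Gamma> x" and ?S = "cov1 \<Gamma> (Sten n J \<Gamma>) x"
    and ?D = "cov3 \<Gamma> (cov2 \<Gamma> (Phi n J \<Gamma>)) x"
  interpret curvature_algebra ?J n "curvature_low J \<Gamma> x" "A x" by (rule curvature_algebra[OF x])
  define R where "R = (\<lambda>a b. curv \<Gamma> a b x ** ?J)"
  have R: "Q_of ?J (curvature_low J \<Gamma> x) (A x) a b c d = R a b $ c $ d" for a b c d
    by (simp add: Rlow[OF x] R_def)
  have R_skew: "R a b = - R b a" for a b
  proof -
    have "curv \<Gamma> a b x = - curv \<Gamma> b a x" by (simp add: curv_def)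
    then show ?thesis by (simp add: R_def matrix_minus_left)
  qed
  have R_cyc: "R a b $ c + R b c $ a + R c a $ b = 0" for a b c
    using Q_cyclic by (simp add: R vec_eq_iff)
  have F_sym: "?F $ i $ j = ?F $ j $ i" for i j by (rule Phi_sym[OF x])
  have F_trace: "ctr ?J (\<lambda>a b. R a b $ c $ d) = (4 * real n + 4) * ?F $ c $ d" for c d
    using n_pos by (simp add: decomposition_eq(2)[OF x] Phi_of_def R)
  \<comment> \<open>By the cyclic identity and skewness, twice this trace is minus the trace over
    the first two indices; hence 2n+2 from 4n+4.\<close>
  have ricci_trace: "ctr ?J (\<lambda>c d. R d a $ c $ f) = - (2 * real n + 2) * ?F $ a $ f" for a f
  proof -
    have "ctr ?J (\<lambda>c d. R d a $ c $ f) - ctr ?J (\<lambda>c d. R c a $ d $ f) = ctr ?J (\<lambda>c d. R d a $ c $ f - R c a $ d $ f)"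
      by (simp add: ctr_linear)
    also have "(\<lambda>c d. R d a $ c $ f - R c a $ d $ f) = (\<lambda>c d. - R c d $ a $ f)"
    proof (intro ext)
      fix c d
      have "R d a $ c $ f + R a c $ d $ f + R c d $ a $ f = 0"
        using R_cyc[of d a c] by (simp add: vec_eq_iff)
      then show "R d a $ c $ f - R c a $ d $ f = - R c d $ a $ f"
        using R_skew[of a c] by simp
    qed
    finally show ?thesis
      using ctr_swap[of "\<lambda>c d. R c a $ d $ f"] by (simp add: ctr_linear F_trace algebra_simps)
  qed
  have FF: "ctr ?J (\<lambda>d c. ?F $ d $ i * ?F $ c $ j) = pr ?J (?F $ j) (?F $ i)"
    "ctr ?J (\<lambda>d c. ?F $ i $ d * ?F $ c $ j) = pr ?J (?F $ j) (?F $ i)"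
    "ctr ?J (\<lambda>d c. ?F $ d $ i * ?F $ j $ c) = pr ?J (?F $ j) (?F $ i)"
    "ctr ?J (\<lambda>d c. ?F $ c $ i * ?F $ d $ j) = pr ?J (?F $ i) (?F $ j)" for i j
    by (simp_all add: pr_ctr F_sym[of _ i] F_sym[of _ j] mult.commute)
  define RF where "RF = ctr ?J (\<lambda>d c. pr ?J (?F $ c) (R a b $ d))"
  have VF: "(\<Sum>c\<in>UNIV. \<Sum>e\<in>UNIV. Vten n J \<Gamma> x $ a $ b $ c $ e * raise2 ?J ?F $ c $ e)
    = RF - 2 * ?J $ a $ b * (\<Sum>d\<in>UNIV. \<Sum>e\<in>UNIV. ?F $ d $ e * raise2 ?J ?F $ d $ e) + 4 * pr ?J (?F $ a) (?F $ b)"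
  proof -
    have "pr ?J (?F $ c) (Vten n J \<Gamma> x $ a $ b $ d) = pr ?J (?F $ c) (R a b $ d)
       - (2 * ?J $ a $ b) * pr ?J (?F $ c) (?F $ d) - ?F $ d $ a * ?F $ c $ b + ?F $ d $ b * ?F $ c $ a
       + ?J $ d $ a * pr ?J (?F $ c) (?F $ b) - ?J $ d $ b * pr ?J (?F $ c) (?F $ a)" for c d
      by (simp add: V_row[OF x] R_def)
    then show ?thesis
      unfolding raise2_contract RF_def
      using pr_swap[of "?F $ b" "?F $ a"] by (simp add: ctr_simps FF)
  qed
  \<comment> \<open>The commutator of derivatives on \<Phi> from \<open>ricci_Phi\<close>. By
    \<open>div\<close> below, $\<nabla>^c\<nabla>_a\<Phi>_{bc}$ is traded for $(2n+1)\<nabla>_aS_b$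
    and the trace of this term.\<close>
  define W where "W = (\<lambda>a b c d. - pr ?J (R d a $ b) (?F $ c) - pr ?J (R d a $ c) (?F $ b))"
  have W: "ctr ?J (\<lambda>c d. W a b c d) - ctr ?J (\<lambda>c d. W b a c d) = RF + (4 * real n + 4) * pr ?J (?F $ a) (?F $ b)"
  proof -
    \<comment> \<open>The cyclic identity merges the two curvature terms that begin with d into the
      one occurring in \<open>RF\<close>.\<close>
    have 1: "- pr ?J (R d a $ b) u + pr ?J (R d b $ a) u = pr ?J (R a b $ d) u" for d u
    proof -
      have "pr ?J (R d a $ b + R a b $ d + R b d $ a) u = 0" by (simp only: R_cyc pr_linear)
      then show ?thesis using R_skew[of b d] by simp
    qed
    have 2: "ctr ?J (\<lambda>c d. pr ?J (R d i $ c) u) = - (2 * real n + 2) * pr ?J (?F $ i) u" for i u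
    proof -
      have "(\<chi> f. ctr ?J (\<lambda>c d. R d i $ c $ f)) = (- (2 * real n + 2)) *\<^sub>R ?F $ i"
        by (simp add: vec_eq_iff ricci_trace)
      then show ?thesis unfolding ctr_pr by simp
    qed
    have "ctr ?J (\<lambda>c d. W a b c d) - ctr ?J (\<lambda>c d. W b a c d)
       = ctr ?J (\<lambda>c d. (- pr ?J (R d a $ b) (?F $ c) + pr ?J (R d b $ a) (?F $ c)) - pr ?J (R d a $ c) (?F $ b) + pr ?J (R d b $ c) (?F $ a))"
      by (simp add: W_def ctr_linear)
    also have "\<dots> = ctr ?J (\<lambda>c d. pr ?J (R a b $ d) (?F $ c)) - ctr ?J (\<lambda>c d. pr ?J (R d a $ c) (?F $ b))
      + ctr ?J (\<lambda>c d. pr ?J (R d b $ c) (?F $ a))"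
      unfolding 1 by (simp only: ctr_linear)
    also have "ctr ?J (\<lambda>c d. pr ?J (R a b $ d) (?F $ c)) = RF"
    proof -
      have "ctr ?J (\<lambda>c d. pr ?J (R a b $ d) (?F $ c)) = ctr ?J (\<lambda>c d. - pr ?J (?F $ c) (R a b $ d))"
        by (simp only: pr_swap[symmetric])
      also have "\<dots> = RF"
        unfolding RF_def by (subst ctr_swap) (simp add: ctr_linear)
      finally show ?thesis .
    qed
    finally show ?thesis
      using pr_swap[of "?F $ b" "?F $ a"] by (simp add: 2 algebra_simps)
  qed
  have DS: "cov1 \<Gamma> (divPhi n J \<Gamma>) x $ i $ j = (2 * real n + 1) * ?S $ i $ j" for i j
  proof -
    have "D1 \<Gamma> i (Sten n J \<Gamma>) x = (1 / (2 * real n + 1)) *\<^sub>R D1 \<Gamma> i (divPhi n J \<Gamma>) x"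
      unfolding Sten_def[abs_def] using x smooth_divPhi
      by (subst D1_scaleR) (auto intro!: smooth_differentiable)
    then show ?thesis using n_pos by (simp add: cov1_D1)
  qed
  have D: "?D $ d $ i $ j $ c = ?D $ i $ d $ j $ c + W i j c d" for d i j c
    using ricci_Phi[OF x, of d i j c] by (simp add: W_def R_def)
  have div: "ctr ?J (\<lambda>c d. ?D $ d $ i $ j $ c) = (2 * real n + 1) * ?S $ i $ j + ctr ?J (\<lambda>c d. W i j c d)" for i j
  proof -
    have "ctr ?J (\<lambda>c d. ?D $ d $ i $ j $ c) = ctr ?J (\<lambda>c d. ?D $ i $ d $ j $ c + W i j c d)"
      by (intro arg_cong[of _ _ "ctr ?J"] ext) (rule D)
    then show ?thesis by (simp add: ctr_linear cov1_divPhi[OF x, symmetric] DS)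
  qed
  have "(\<Sum>c\<in>UNIV. \<Sum>d\<in>UNIV. Jup ?J $ c $ d * cov3 \<Gamma> (Yten n J \<Gamma>) x $ d $ a $ b $ c) =
     ctr ?J (\<lambda>c d. ?D $ d $ a $ b $ c - ?D $ d $ b $ a $ c + ?J $ a $ c * ?S $ d $ b - ?J $ b $ c * ?S $ d $ a
       + (2 * ?J $ a $ b) * ?S $ d $ c)"
    by (simp add: ctr_def cov3_Y[OF x])
  also have "\<dots> = ctr ?J (\<lambda>c d. ?D $ d $ a $ b $ c) - ctr ?J (\<lambda>c d. ?D $ d $ b $ a $ c) - ?S $ a $ b + ?S $ b $ a
      + 2 * ?J $ a $ b * ctr ?J (\<lambda>c d. ?S $ d $ c)"
    by (simp add: ctr_simps)
  \<comment> \<open>The traces of the J-terms with $S_b$ and $S_a$ lower 2n+1 to 2n. Afterwards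
    \<open>VF\<close> lowers 4n+4 to 4n.\<close>
  also have "\<dots> = 2 * real n * (?S $ a $ b - ?S $ b $ a) + 2 * ?J $ a $ b * ctr ?J (\<lambda>c d. ?S $ d $ c)
     + (RF + (4 * real n + 4) * pr ?J (?F $ a) (?F $ b))"
    unfolding W[symmetric] div by (simp add: algebra_simps)
  finally show ?thesis
    unfolding VF ctr_def by (simp add: algebra_simps)
qed

lemma tractor_deriv_fedosov:
  assumes x: "x \<in> S"
  shows "tractor_deriv n J \<Gamma> s a x =
    (partial a (\<lambda>y. fst (s y)) x - fst (snd (s x)) $ a,
     D1 \<Gamma> a (\<lambda>y. fst (snd (s y))) x - snd (snd (s x)) *\<^sub>R J x $ a + fst (s x) *\<^sub>R Phi n J \<Gamma> x $ a,
     partial a (\<lambda>y. snd (snd (s y))) x + pr (J x) (fst (snd (s x))) (Phi n J \<Gamma> x $ a)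
       - Sten n J \<Gamma> x $ a * fst (s x))"
  by (simp add: tractor_deriv_eq[OF x] A_zero Z_eq)

lemma commutator:
  assumes x: "x \<in> S" and s: "smooth_on S s" and \<Gamma>': "\<And>k i j. \<Gamma>' x $ k $ i $ j = \<Gamma>' x $ k $ j $ i"
  shows "tractor_commutator n J \<Gamma> \<Gamma>' s a b x = tractor_curvature n J \<Gamma> x a b (s x)"
proof -
  interpret symplectic "J x" by (rule symplectic[OF x])
  let ?J = "J x" and ?F = "Phi n J \<Gamma>" and ?T = "Sten n J \<Gamma>"
  define \<sigma> where "\<sigma> = (\<lambda>y. fst (s y))"
  define \<mu> where "\<mu> = (\<lambda>y. fst (snd (s y)))"
  define \<rho> where "\<rho> = (\<lambda>y. snd (snd (s y)))"
  have sm: "smooth_on S \<sigma>" "smooth_on S \<mu>" "smooth_on S \<rho>"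
    unfolding \<sigma>_def \<mu>_def \<rho>_def by (intro smooth_on_fst smooth_on_snd S s)+
  have d: "\<sigma> differentiable (at x)" "\<mu> differentiable (at x)" "\<rho> differentiable (at x)"
    "?F differentiable (at x)" "?T differentiable (at x)"
    "(\<lambda>y. ?F y $ c) differentiable (at x)" "(\<lambda>y. ?T y $ c) differentiable (at x)"
    "(\<lambda>y. \<mu> y $ c) differentiable (at x)"
    "partial c \<sigma> differentiable (at x)" "partial c \<rho> differentiable (at x)"
    "D1 \<Gamma> c \<mu> differentiable (at x)" "(\<lambda>y. pr (J y) (\<mu> y) (?F y $ c)) differentiable (at x)" for c
    using x sm smooth_Phi smooth_Sten smooth_\<Gamma>
    by (auto intro!: smooth_differentiable smooth_on_partial smooth_on_D1 smooth_on_nth smooth_on_pr S)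
  define s' where "s' = (\<lambda>b y. (partial b \<sigma> y - \<mu> y $ b, D1 \<Gamma> b \<mu> y - \<rho> y *\<^sub>R J y $ b + \<sigma> y *\<^sub>R ?F y $ b,
     partial b \<rho> y + pr (J y) (\<mu> y) (?F y $ b) - ?T y $ b * \<sigma> y))"
  have TT: "tractor_deriv n J \<Gamma> (tractor_deriv n J \<Gamma> s b) a x = tractor_deriv n J \<Gamma> (s' b) a x" for a b
    by (rule tractor_deriv_cong[OF S x])
       (simp add: tractor_deriv_fedosov s'_def \<sigma>_def \<mu>_def \<rho>_def)
  \<comment> \<open>The correction term is symmetric in a and b, so every torsion-free
    \<open>\<Gamma>'\<close> gives the same commutator.\<close>
  have comm: "tractor_commutator n J \<Gamma> \<Gamma>' s a b x = tractor_deriv n J \<Gamma> (s' b) a x - tractor_deriv n J \<Gamma> (s' a) b x"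
    by (simp add: tractor_commutator_def tractor_deriv2_def TT \<Gamma>'[of _ a b])
  have part_row: "partial a (\<lambda>y. \<mu> y $ b) x = D1 \<Gamma> a \<mu> x $ b + (conn \<Gamma> a x *v \<mu> x) $ b" for a b
    using d by (simp add: partial_nth D1_def)
  have conn_sym: "(conn \<Gamma> a x *v v) $ b = (conn \<Gamma> b x *v v) $ a" for v
    using x by (simp add: conn_def matrix_vector_mult_def torsion_free[of x _ a b])
  have \<Gamma>_sym: "(\<Sum>e\<in>UNIV. \<Gamma> x $ e $ b $ a *\<^sub>R M $ e) = (\<Sum>e\<in>UNIV. \<Gamma> x $ e $ a $ b *\<^sub>R M $ e)" for M :: "real^'d^'d"
    using x by (simp add: torsion_free[of x _ b a])
  have pp: "partial a (partial b f) x = partial b (partial a f) x" if "smooth_on S f" for f :: "real^'d \<Rightarrow> real"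
    by (rule partial_commute[OF S that x])
  \<comment> \<open>Rows of J and \<Phi> are differentiated as covectors; the resulting sums with
    $\<Gamma>^e_{ab}$ are symmetric in a and b and cancel in the second slot.\<close>
  have D1s': "D1 \<Gamma> a (\<lambda>y. D1 \<Gamma> b \<mu> y - \<rho> y *\<^sub>R J y $ b + \<sigma> y *\<^sub>R ?F y $ b) x =
     D1 \<Gamma> a (D1 \<Gamma> b \<mu>) x - partial a \<rho> x *\<^sub>R ?J $ b - \<rho> x *\<^sub>R (\<Sum>e\<in>UNIV. \<Gamma> x $ e $ a $ b *\<^sub>R ?J $ e)
      + partial a \<sigma> x *\<^sub>R ?F x $ b + \<sigma> x *\<^sub>R (D2 \<Gamma> a ?F x $ b + (\<Sum>e\<in>UNIV. \<Gamma> x $ e $ a $ b *\<^sub>R ?F x $ e))" for a b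
    using x d by (simp add: D1_add D1_diff D1_scaleR D1_row parallel_J algebra_simps)
  have 1: "fst (tractor_deriv n J \<Gamma> (s' b) a x) - fst (tractor_deriv n J \<Gamma> (s' a) b x) = - (2 * ?J $ a $ b) * \<rho> x"
    using d J_swap[of b a] conn_sym[of "\<mu> x"] Phi_sym[OF x, of a b]
    by (simp add: tractor_deriv_fedosov[OF x] s'_def partial_diff part_row pp[OF sm(1)] algebra_simps)
  have 2: "fst (snd (tractor_deriv n J \<Gamma> (s' b) a x)) - fst (snd (tractor_deriv n J \<Gamma> (s' a) b x))
    = - (curv \<Gamma> a b x *v \<mu> x) + \<sigma> x *\<^sub>R (D2 \<Gamma> a ?F x $ b - D2 \<Gamma> b ?F x $ a)
      - pr ?J (\<mu> x) (?F x $ b) *\<^sub>R ?J $ a + pr ?J (\<mu> x) (?F x $ a) *\<^sub>R ?J $ b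
      + (\<sigma> x * ?T x $ b) *\<^sub>R ?J $ a - (\<sigma> x * ?T x $ a) *\<^sub>R ?J $ b
      - \<mu> x $ b *\<^sub>R ?F x $ a + \<mu> x $ a *\<^sub>R ?F x $ b"
    unfolding ricci_vector[OF S x smooth_\<Gamma> sm(2), symmetric]
    by (simp add: tractor_deriv_fedosov[OF x] s'_def D1s' \<Gamma>_sym) (simp add: algebra_simps)
  have p3: "partial a (\<lambda>y. partial b \<rho> y + pr (J y) (\<mu> y) (?F y $ b) - ?T y $ b * \<sigma> y) x
    = partial a (partial b \<rho>) x + pr ?J (D1 \<Gamma> a \<mu> x) (?F x $ b)
      + pr ?J (\<mu> x) (D2 \<Gamma> a ?F x $ b) + pr ?J (\<mu> x) (\<Sum>e\<in>UNIV. \<Gamma> x $ e $ a $ b *\<^sub>R ?F x $ e)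
      - (partial a (\<lambda>y. ?T y $ b) x * \<sigma> x + ?T x $ b * partial a \<sigma> x)" for a b
    using d by (simp add: partial_add partial_diff partial_mult partial_pr[OF x] D1_row)
  have 3: "snd (snd (tractor_deriv n J \<Gamma> (s' b) a x)) - snd (snd (tractor_deriv n J \<Gamma> (s' a) b x))
    = pr ?J (\<mu> x) (D2 \<Gamma> a ?F x $ b - D2 \<Gamma> b ?F x $ a)
      - (cov1 \<Gamma> ?T x $ a $ b - cov1 \<Gamma> ?T x $ b $ a) * \<sigma> x
      - 2 * \<sigma> x * pr ?J (?F x $ a) (?F x $ b) + ?T x $ a * \<mu> x $ b - ?T x $ b * \<mu> x $ a"
    using d conn_sym[of "?T x"] Phi_sym[OF x, of a b] pr_swap[of "?F x $ b" "?F x $ a"]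
    by (simp add: tractor_deriv_fedosov[OF x] s'_def pp[OF sm(3)] \<Gamma>_sym p3 cov1_D1 D1_def[of _ _ ?T] partial_nth)
      (simp add: algebra_simps)
  have pr1: "(\<Sum>d\<in>UNIV. u $ d * raise ?J (\<mu> x) $ d) = pr ?J (\<mu> x) u" for u
    unfolding pr_raise[symmetric] by (simp add: mult.commute)
  have rhs: "tractor_curvature n J \<Gamma> x a b (s x) =
    (- (2 * ?J $ a $ b) * \<rho> x,
     (\<chi> c. pr ?J (\<mu> x) (Vten n J \<Gamma> x $ a $ b $ c) + Yten n J \<Gamma> x $ a $ b $ c * \<sigma> x
        - 2 * ?J $ a $ b * (?T x $ c * \<sigma> x - pr ?J (\<mu> x) (?F x $ c))),
     pr ?J (\<mu> x) (Yten n J \<Gamma> x $ a $ b)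
       - 1 / (2 * real n) *
            ((\<Sum>c\<in>UNIV. \<Sum>d\<in>UNIV. Jup ?J $ c $ d * cov3 \<Gamma> (Yten n J \<Gamma>) x $ d $ a $ b $ c)
             - (\<Sum>c\<in>UNIV. \<Sum>e\<in>UNIV. Vten n J \<Gamma> x $ a $ b $ c $ e * raise2 ?J (?F x) $ c $ e)) * \<sigma> x
       - 2 * ?J $ a $ b * (pr ?J (\<mu> x) (?T x)
          - 1 / (2 * real n) *
            ((\<Sum>d\<in>UNIV. \<Sum>e\<in>UNIV. ?F x $ d $ e * raise2 ?J (?F x) $ d $ e)
             + (\<Sum>c\<in>UNIV. \<Sum>d\<in>UNIV. Jup ?J $ c $ d * cov1 \<Gamma> ?T x $ d $ c)) * \<sigma> x))"
    unfolding tractor_curvature_def Let_def case_prod_beta \<sigma>_def[symmetric] \<mu>_def[symmetric] \<rho>_def[symmetric]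
    unfolding \<sigma>_def[THEN fun_cong, symmetric] \<mu>_def[THEN fun_cong, symmetric] \<rho>_def[THEN fun_cong, symmetric] pr1
    by (simp add: vec_eq_iff)
  have "tractor_deriv n J \<Gamma> (s' b) a x - tractor_deriv n J \<Gamma> (s' a) b x = tractor_curvature n J \<Gamma> x a b (s x)"
  proof (intro prod_eqI)
    show "fst (tractor_deriv n J \<Gamma> (s' b) a x - tractor_deriv n J \<Gamma> (s' a) b x) = fst (tractor_curvature n J \<Gamma> x a b (s x))"
      using 1 by (simp add: rhs)
    show "fst (snd (tractor_deriv n J \<Gamma> (s' b) a x - tractor_deriv n J \<Gamma> (s' a) b x)) = fst (snd (tractor_curvature n J \<Gamma> x a b (s x)))"
      unfolding snd_diff fst_diff 2 rhs fst_conv snd_conv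
    proof (subst vec_eq_iff, intro allI)
      fix c
      show "(- (curv \<Gamma> a b x *v \<mu> x) + \<sigma> x *\<^sub>R (D2 \<Gamma> a ?F x $ b - D2 \<Gamma> b ?F x $ a)
        - pr ?J (\<mu> x) (?F x $ b) *\<^sub>R ?J $ a + pr ?J (\<mu> x) (?F x $ a) *\<^sub>R ?J $ b
        + (\<sigma> x * ?T x $ b) *\<^sub>R ?J $ a - (\<sigma> x * ?T x $ a) *\<^sub>R ?J $ b
        - \<mu> x $ b *\<^sub>R ?F x $ a + \<mu> x $ a *\<^sub>R ?F x $ b) $ c =
        (\<chi> c. pr ?J (\<mu> x) (Vten n J \<Gamma> x $ a $ b $ c) + Yten n J \<Gamma> x $ a $ b $ c * \<sigma> x
        - 2 * ?J $ a $ b * (?T x $ c * \<sigma> x - pr ?J (\<mu> x) (?F x $ c))) $ c"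
        using J_swap[of c a] J_swap[of c b] Phi_sym[OF x, of c a] Phi_sym[OF x, of c b]
        by (simp add: pr_V[OF x] Y_row algebra_simps)
    qed
    show "snd (snd (tractor_deriv n J \<Gamma> (s' b) a x - tractor_deriv n J \<Gamma> (s' a) b x)) = snd (snd (tractor_curvature n J \<Gamma> x a b (s x)))"
      \<comment> \<open>The contracted identity cancels the V-term and the $J_{ab}$-terms with
        $\<nabla>^cS_c$ and $\<Phi>_{de}\<Phi>^{de}$. What is left is 2n times the negative of the
        commuted coefficient of \<sigma>, which explains the factor -1/(2n).\<close>
      unfolding snd_diff 3 rhs snd_conv contracted_identity[OF x]
      using n_pos by (simp add: Y_row divide_simps) (simp add: algebra_simps)
  qed
  then show ?thesis by (simp add: comm)
qed

end

section \<open>Rescaling\<close>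

lemma tractor_rescale_pr:
  "tractor_rescale \<Omega> J \<Gamma> x t = (\<Omega> x * fst t, \<Omega> x *\<^sub>R (fst (snd t) + fst t *\<^sub>R Upsilon \<Omega> x),
     inverse (\<Omega> x) * (snd (snd t) - pr (J x) (Upsilon \<Omega> x) (fst (snd t)) + pr (J x) (Upsilon \<Omega> x) (alpha J \<Gamma> x) * fst t))"
  by (simp add: tractor_rescale_def case_prod_beta Let_def pr_raise)

lemma matrix_scaleR: "(c *\<^sub>R M) ** N = c *\<^sub>R (M ** (N :: real^'c^'b))" "M ** (c *\<^sub>R N) = c *\<^sub>R (M ** (N :: real^'c^'b))"
  using bounded_bilinear.scaleR_left[OF bounded_bilinear_matrix_mult] bounded_bilinear.scaleR_right[OF bounded_bilinear_matrix_mult]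
  by blast+

lemma transpose_scaleR: "transpose (c *\<^sub>R M) = c *\<^sub>R transpose (M :: real^'b^'a)"
  by (simp add: vec_eq_iff transpose_def)

lemma matrix_vector_axis: "M *v axis i 1 = (\<chi> k. M $ k $ i)"
  by (simp add: vec_eq_iff matrix_vector_mult_def axis_def if_distrib cong: if_cong)

text \<open>The law for the connection is recorded on constant covectors v, which already determines
  the matrix \<open>conn \<Gamma>' a x\<close>.\<close>

locale rescale = g: gauge S n J \<Gamma> \<alpha> + g': gauge S n J' \<Gamma>' \<alpha>'
  for S :: "(real^'d::finite) set" and n J \<Gamma> \<alpha> J' \<Gamma>' \<alpha>' +
  fixes \<Omega> :: "real^'d \<Rightarrow> real"
  assumes smooth_\<Omega>: "smooth_on S \<Omega>" and pos: "x \<in> S \<Longrightarrow> \<Omega> x > 0"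
    and J': "x \<in> S \<Longrightarrow> J' x = (\<Omega> x)\<^sup>2 *\<^sub>R J x"
    and conn': "x \<in> S \<Longrightarrow> conn \<Gamma>' a x *v v = conn \<Gamma> a x *v v + Upsilon \<Omega> x $ a *\<^sub>R v + v $ a *\<^sub>R Upsilon \<Omega> x"
begin

abbreviation \<Upsilon> where "\<Upsilon> \<equiv> Upsilon \<Omega>"

lemma \<Omega>_differentiable: "x \<in> S \<Longrightarrow> \<Omega> differentiable (at x)"
  using smooth_\<Omega> smooth_on_differentiable by blast

lemma partial_\<Omega>: "x \<in> S \<Longrightarrow> partial a \<Omega> x = \<Omega> x * \<Upsilon> x $ a"
  using pos[of x] partial_ln(1)[of \<Omega> x a] \<Omega>_differentiable[of x]
  by (simp add: Upsilon_def field_simps)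

lemma conn'_matrix: "x \<in> S \<Longrightarrow> conn \<Gamma>' a x = conn \<Gamma> a x + \<Upsilon> x $ a *\<^sub>R mat 1 + outer (\<Upsilon> x) (axis a 1)"
proof -
  assume x: "x \<in> S"
  have "conn \<Gamma>' a x *v v = (conn \<Gamma> a x + \<Upsilon> x $ a *\<^sub>R mat 1 + outer (\<Upsilon> x) (axis a 1)) *v v" for v
    using conn'[OF x, of a v]
    by (simp add: matrix_vector_mult_add_rdistrib outer_mult_vector inner_axis' scaleR_matrix_vector_assoc[symmetric])
  then show ?thesis by (simp add: matrix_eq)
qed

lemma D1': "x \<in> S \<Longrightarrow> D1 \<Gamma>' a \<phi> x = D1 \<Gamma> a \<phi> x - \<Upsilon> x $ a *\<^sub>R \<phi> x - \<phi> x $ a *\<^sub>R \<Upsilon> x"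
  by (simp add: D1_def conn')

lemma D2':
  assumes x: "x \<in> S"
  shows "D2 \<Gamma>' a T x = D2 \<Gamma> a T x - (2 * \<Upsilon> x $ a) *\<^sub>R T x - outer (\<Upsilon> x) (T x $ a) - outer (\<chi> k. T x $ k $ a) (\<Upsilon> x)"
proof -
  have 1: "outer (\<Upsilon> x) (axis a 1) ** T x = outer (\<Upsilon> x) (T x $ a)"
    by (simp add: vec_eq_iff matrix_matrix_mult_def axis_def if_distrib if_distribR cong: if_cong)
  have 2: "T x ** transpose (outer (\<Upsilon> x) (axis a 1)) = outer (\<chi> k. T x $ k $ a) (\<Upsilon> x)"
    by (simp add: vec_eq_iff matrix_matrix_mult_def transpose_def axis_def if_distrib if_distribR cong: if_cong)
  have 3: "(c *\<^sub>R mat 1) ** M = c *\<^sub>R M" "M ** transpose (c *\<^sub>R mat 1) = c *\<^sub>R M" for c and M :: "real^'d^'d"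
    by (simp_all add: matrix_scaleR transpose_scaleR)
  show ?thesis
    unfolding D2_def conn'_matrix[OF x] matrix_algebra 1 2 3
    by (simp add: vec_eq_iff algebra_simps)
qed

text \<open>The derivative of J' satisfies the defining equation with $\<alpha>+\<Upsilon>$, and
  uniqueness of the form does the rest.\<close>

lemma alpha': "x \<in> S \<Longrightarrow> \<alpha>' x = \<alpha> x + \<Upsilon> x"
proof -
  assume x: "x \<in> S"
  interpret symplectic "J x" by (rule g.symplectic[OF x])
  have pJ: "partial a J' x = (\<Omega> x)\<^sup>2 *\<^sub>R partial a J x + (2 * (\<Omega> x)\<^sup>2 * \<Upsilon> x $ a) *\<^sub>R J x" for a
  proof -
    have "partial a J' x = partial a (\<lambda>y. (\<Omega> y * \<Omega> y) *\<^sub>R J y) x"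
      by (rule partial_cong[OF g.S x]) (simp add: J' power2_eq_square)
    also have "\<dots> = (\<Omega> x)\<^sup>2 *\<^sub>R partial a J x + (2 * (\<Omega> x)\<^sup>2 * \<Upsilon> x $ a) *\<^sub>R J x"
      using x \<Omega>_differentiable
      by (simp add: partial_scaleR partial_mult partial_\<Omega> power2_eq_square algebra_simps)
    finally show ?thesis .
  qed
  have "D2 \<Gamma> a J' x = (\<Omega> x)\<^sup>2 *\<^sub>R D2 \<Gamma> a J x + (2 * (\<Omega> x)\<^sup>2 * \<Upsilon> x $ a) *\<^sub>R J x" for a
    by (simp add: D2_def pJ J'[OF x] matrix_scaleR algebra_simps)
  then have D: "D2 \<Gamma>' a J' x = (\<Omega> x)\<^sup>2 *\<^sub>R (outer (J x $ a) (\<alpha> x + \<Upsilon> x) - outer (\<alpha> x + \<Upsilon> x) (J x $ a))" for a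
    unfolding D2'[OF x] g.D2_J[OF x]
    by (simp add: J'[OF x] vec_eq_iff J_swap[of _ a] algebra_simps)
  have "cov2 \<Gamma>' J' x $ a $ b $ c = 2 * alt (\<lambda>b c. J' x $ a $ b * (\<alpha> x + \<Upsilon> x) $ c) b c" for a b c
    unfolding cov2_D2 D by (simp add: alt_def J'[OF x] algebra_simps)
  then show "\<alpha>' x = \<alpha> x + \<Upsilon> x"
    using g'.alpha_unique[OF x] unfolding is_alpha_at_def by metis
qed

text \<open>As a difference of two smooth forms \<Upsilon> is smooth without any study of the higher
  derivatives of the logarithm. Its closedness is obtained from \<alpha> and \<alpha>' in the same
  way.\<close>

lemma smooth_\<Upsilon>: "smooth_on S \<Upsilon>"
proof -
  have "smooth_on S (\<lambda>x. \<alpha>' x - \<alpha> x)" by (intro smooth_on_diff g.S g.smooth_\<alpha> g'.smooth_\<alpha>)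
  then show ?thesis by (rule smooth_on_eq[OF g.S]) (simp add: alpha')
qed

lemma \<Upsilon>_differentiable [simp]: "x \<in> S \<Longrightarrow> \<Upsilon> differentiable (at x)"
  using smooth_\<Upsilon> smooth_on_differentiable by blast

lemma partial_\<alpha>': "x \<in> S \<Longrightarrow> partial a \<alpha>' x = partial a \<alpha> x + partial a \<Upsilon> x"
proof -
  assume x: "x \<in> S"
  have "partial a \<alpha>' x = partial a (\<lambda>y. \<alpha> y + \<Upsilon> y) x"
    by (rule partial_cong[OF g.S x]) (rule alpha')
  then show ?thesis using x by (simp add: partial_add)
qed

lemma \<Upsilon>_closed: "x \<in> S \<Longrightarrow> partial a \<Upsilon> x $ b = partial b \<Upsilon> x $ a"
  using g.closed[of x a b] g'.closed[of x a b] by (simp add: partial_\<alpha>')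

text \<open>The rows of $\hat{\mathrm{P}}_{ab}-\mathrm{P}_{ab}$\<close>
definition B :: "'d \<Rightarrow> real^'d \<Rightarrow> real^'d" where
  "B a x = \<Upsilon> x $ a *\<^sub>R \<Upsilon> x - D1 \<Gamma> a \<Upsilon> x"

text \<open>The Ricci identity is applied to a constant covector v, which suffices for an identity
  of matrices. Closedness of \<Upsilon> removes the terms proportional to v itself.\<close>

lemma curv':
  assumes x: "x \<in> S"
  shows "curv \<Gamma>' a b x *v v = curv \<Gamma> a b x *v v - v $ b *\<^sub>R B a x + v $ a *\<^sub>R B b x"
proof -
  have v: "smooth_on S (\<lambda>_. v)" by simp
  have d: "D1 \<Gamma> c (\<lambda>_. v) differentiable (at x)" "(\<lambda>y. \<Upsilon> y $ c) differentiable (at x)" for c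
    using x smooth_\<Upsilon> by (auto intro!: smooth_on_differentiable[of S] smooth_on_D1 smooth_on_nth g.S g.smooth_\<Gamma>)
  have DD: "D1 \<Gamma>' a (D1 \<Gamma>' b (\<lambda>_. v)) x = D1 \<Gamma> a (D1 \<Gamma> b (\<lambda>_. v)) x
     - partial a (\<lambda>y. \<Upsilon> y $ b) x *\<^sub>R v - \<Upsilon> x $ b *\<^sub>R D1 \<Gamma> a (\<lambda>_. v) x - v $ b *\<^sub>R D1 \<Gamma> a \<Upsilon> x
     - \<Upsilon> x $ a *\<^sub>R (D1 \<Gamma> b (\<lambda>_. v) x - \<Upsilon> x $ b *\<^sub>R v - v $ b *\<^sub>R \<Upsilon> x)
     - (D1 \<Gamma> b (\<lambda>_. v) x - \<Upsilon> x $ b *\<^sub>R v - v $ b *\<^sub>R \<Upsilon> x) $ a *\<^sub>R \<Upsilon> x" for a b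
  proof -
    have eq: "D1 \<Gamma>' a (D1 \<Gamma>' b (\<lambda>_. v)) x = D1 \<Gamma>' a (\<lambda>y. D1 \<Gamma> b (\<lambda>_. v) y - \<Upsilon> y $ b *\<^sub>R v - v $ b *\<^sub>R \<Upsilon> y) x"
      by (rule D1_cong[OF g.S x]) (rule D1')
    show ?thesis unfolding eq unfolding D1'[OF x] using x d by (simp add: D1_diff D1_scaleR)
  qed
  have sym: "D1 \<Gamma> b (\<lambda>_. v) x $ a = D1 \<Gamma> a (\<lambda>_. v) x $ b"
    using x by (simp add: D1_def conn_def matrix_vector_mult_def g.torsion_free[of x _ a b])
  have pU: "partial a (\<lambda>y. \<Upsilon> y $ b) x = partial b (\<lambda>y. \<Upsilon> y $ a) x"
    using x \<Upsilon>_closed[OF x, of a b] by (simp add: partial_nth)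
  have "- (curv \<Gamma>' a b x *v v) = - (curv \<Gamma> a b x *v v) + v $ b *\<^sub>R B a x - v $ a *\<^sub>R B b x"
    unfolding ricci_vector[OF g.S x g.smooth_\<Gamma> v, symmetric] ricci_vector[OF g.S x g'.smooth_\<Gamma> v, symmetric] DD B_def
    by (simp add: sym pU algebra_simps)
  then show ?thesis by (simp add: algebra_simps eq_neg_iff_add_eq_0)
qed

lemma A': "x \<in> S \<Longrightarrow> g'.A x $ a = g.A x $ a - B a x"
proof -
  assume x: "x \<in> S"
  have eq: "D1 \<Gamma>' a \<alpha>' x = D1 \<Gamma>' a (\<lambda>y. \<alpha> y + \<Upsilon> y) x"
    by (rule D1_cong[OF g.S x]) (rule alpha')
  show ?thesis
    unfolding g.A_row g'.A_row B_def eq unfolding D1'[OF x] using x by (simp add: D1_add alpha' algebra_simps)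
qed

lemma Jup': "x \<in> S \<Longrightarrow> Jup (J' x) = inverse ((\<Omega> x)\<^sup>2) *\<^sub>R Jup (J x)"
proof -
  assume x: "x \<in> S"
  have o: "(\<Omega> x)\<^sup>2 \<noteq> 0" using pos[OF x] by simp
  have "J x ** Jup (J' x) = inverse ((\<Omega> x)\<^sup>2) *\<^sub>R (J' x ** Jup (J' x))"
    using o by (simp add: J'[OF x] matrix_scaleR)
  also have "\<dots> = - inverse ((\<Omega> x)\<^sup>2) *\<^sub>R mat 1"
    by (simp add: symplectic.J_Jup[OF g'.symplectic[OF x]])
  finally have "Jup (J x) ** (J x ** Jup (J' x)) = - inverse ((\<Omega> x)\<^sup>2) *\<^sub>R Jup (J x)"
    by (simp add: matrix_scaleR matrix_minus_right)
  then show ?thesis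
    by (simp add: matrix_mul_assoc symplectic.J_Jup[OF g.symplectic[OF x]] matrix_minus_left)
qed

lemma pr': "x \<in> S \<Longrightarrow> pr (J' x) u v = inverse ((\<Omega> x)\<^sup>2) * pr (J x) u v"
  by (simp add: pr_def Jup' scaleR_matrix_vector_assoc[symmetric])

lemma ctr': "x \<in> S \<Longrightarrow> ctr (J' x) F = inverse ((\<Omega> x)\<^sup>2) * ctr (J x) F"
  by (simp add: ctr_def Jup' sum_distrib_left mult_ac)

text \<open>The curvature changes by J-multiples of B and \<open>A\<close> changes by -B. In Q these
  contributions cancel, and the factor $\<Omega>^2$ of the lowered index remains.\<close>

lemma Q':
  assumes x: "x \<in> S"
  shows "Q_of (J' x) (curvature_low J' \<Gamma>' x) (g'.A x) a b c d = (\<Omega> x)\<^sup>2 * Q_of (J x) (curvature_low J \<Gamma> x) (g.A x) a b c d"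
proof -
  interpret symplectic "J x" by (rule g.symplectic[OF x])
  have F: "curv \<Gamma>' a b x $ d $ e = curv \<Gamma> a b x $ d $ e - (if e = b then B a x $ d else 0) + (if e = a then B b x $ d else 0)" for e
    using arg_cong[OF curv'[OF x, of a b "axis e 1"], of "\<lambda>u. u $ d"]
    unfolding matrix_vector_axis by (simp add: axis_def split: if_splits)
  have if_mult: "(if P then u else 0) * v = (if P then u * v else 0)" for P and u v :: real by simp
  have F: "(curv \<Gamma>' a b x ** J x) $ d $ c = (curv \<Gamma> a b x ** J x) $ d $ c - B a x $ d * J x $ b $ c + B b x $ d * J x $ a $ c"
    by (simp add: matrix_matrix_mult_def F distrib_right left_diff_distrib if_mult sum.distrib sum_subtractf)
  show ?thesis
    using J_swap[of c a] J_swap[of c b] x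
    by (simp add: Q_of_def g.curvature_low_eq g'.curvature_low_eq J' A' matrix_scaleR F) (simp add: algebra_simps)
qed

text \<open>The $\<Omega>^2$ of Q is cancelled by the $\<Omega>^{-2}$ of the trace.\<close>

lemma Phi': "x \<in> S \<Longrightarrow> Phi n J' \<Gamma>' x = Phi n J \<Gamma> x"
proof -
  assume x: "x \<in> S"
  have o: "(\<Omega> x)\<^sup>2 \<noteq> 0" using pos[OF x] by simp
  interpret symplectic "J x" by (rule g.symplectic[OF x])
  show ?thesis
    unfolding g.decomposition_eq[OF x] g'.decomposition_eq[OF x] Phi_of_def ctr'[OF x] Q'[OF x] ctr_linear
    by (simp only: mult.assoc[symmetric] right_inverse[OF o] mult_1_left)
qed

text \<open>Of the three correction terms of \<open>D2'\<close>, the first contributes -2, the one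
  with $\<Upsilon>_a$ is a trace of the symmetric \<Phi> and vanishes, and the last contributes
  +1.\<close>

lemma divPhi': "x \<in> S \<Longrightarrow> divPhi n J' \<Gamma>' x $ a
    = inverse ((\<Omega> x)\<^sup>2) * (divPhi n J \<Gamma> x $ a - pr (J x) (\<Upsilon> x) (Phi n J \<Gamma> x $ a))"
proof -
  assume x: "x \<in> S"
  interpret symplectic "J x" by (rule g.symplectic[OF x])
  let ?F = "Phi n J \<Gamma>"
  have div: "divPhi n J \<Gamma> x $ a = ctr (J x) (\<lambda>b c. D2 \<Gamma> c (Phi n J \<Gamma>) x $ a $ b)" for J \<Gamma>
    by (simp add: divPhi_def ctr_def cov2_D2)
  have 1: "ctr (J x) (\<lambda>b c. \<Upsilon> x $ c * ?F x $ a $ b) = pr (J x) (\<Upsilon> x) (?F x $ a)"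
    by (simp add: pr_ctr)
  have 2: "ctr (J x) (\<lambda>b c. ?F x $ c $ b) = 0"
    by (rule ctr_sym) (simp add: g.Phi_sym[OF x])
  have 3: "ctr (J x) (\<lambda>b c. ?F x $ a $ c * \<Upsilon> x $ b) = - pr (J x) (\<Upsilon> x) (?F x $ a)"
    using pr_swap[of "\<Upsilon> x" "?F x $ a"] by (simp add: pr_ctr)
  have "D2 \<Gamma>' c (Phi n J' \<Gamma>') x = D2 \<Gamma>' c ?F x" for c
    by (rule D2_cong[OF g.S x]) (rule Phi')
  then have D: "D2 \<Gamma>' c (Phi n J' \<Gamma>') x $ a $ b = D2 \<Gamma> c ?F x $ a $ b - 2 * (\<Upsilon> x $ c * ?F x $ a $ b)
     - \<Upsilon> x $ a * ?F x $ c $ b - ?F x $ a $ c * \<Upsilon> x $ b" for b c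
    using x by (simp add: D2' g.Phi_sym[OF x, of _ c])
  show ?thesis
    unfolding div ctr'[OF x] D ctr_linear 1 2 3 by (simp add: right_diff_distrib)
qed

text \<open>In the quotient the terms $\<Upsilon>^b\<Phi>_{ab}$ coming from \<open>divPhi'\<close>
  and \<open>alpha'\<close> cancel. The last summand stems from the change of the connection on
  \<alpha>', its other part being annihilated by $\<alpha>^b+\<Upsilon>^b$.\<close>

lemma Z': "x \<in> S \<Longrightarrow> g'.Z a x = inverse ((\<Omega> x)\<^sup>2) *
    ((divPhi n J \<Gamma> x $ a + pr (J x) (\<alpha> x) (Phi n J \<Gamma> x $ a)) / (2 * real n + 1)
     + 2 * pr (J x) (\<alpha> x + \<Upsilon> x) (Phi n J \<Gamma> x $ a) - pr (J x) (\<alpha> x + \<Upsilon> x) (D1 \<Gamma> a \<alpha> x + D1 \<Gamma> a \<Upsilon> x)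
     + (\<alpha> x $ a + \<Upsilon> x $ a) * pr (J x) (\<alpha> x) (\<Upsilon> x))"
proof -
  assume x: "x \<in> S"
  interpret symplectic "J x" by (rule g.symplectic[OF x])
  have eq: "D1 \<Gamma>' a \<alpha>' x = D1 \<Gamma>' a (\<lambda>y. \<alpha> y + \<Upsilon> y) x"
    by (rule D1_cong[OF g.S x]) (rule alpha')
  have D: "D1 \<Gamma>' a \<alpha>' x = D1 \<Gamma> a \<alpha> x + D1 \<Gamma> a \<Upsilon> x - \<Upsilon> x $ a *\<^sub>R (\<alpha> x + \<Upsilon> x) - (\<alpha> x + \<Upsilon> x) $ a *\<^sub>R \<Upsilon> x"
    unfolding eq unfolding D1'[OF x] using x by (simp add: D1_add)
  have "(i * (u - v) + i * (w + v)) / m = i * ((u + w) / m)" for i u v w m :: real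
    by (simp add: algebra_simps add_divide_distrib[symmetric])
  note this[simp]
  show ?thesis
    unfolding g'.Z_def D pr'[OF x] divPhi'[OF x] Phi'[OF x] alpha'[OF x]
    by (simp add: pr_swap[of "\<Upsilon> x" "\<alpha> x"]) (simp add: algebra_simps diff_divide_distrib add_divide_distrib)
qed

lemma tractor_deriv_rescale:
  assumes x: "x \<in> S" and s: "smooth_on S s"
  shows "tractor_deriv n J' \<Gamma>' (\<lambda>y. tractor_rescale \<Omega> J \<Gamma> y (s y)) a x
    = tractor_rescale \<Omega> J \<Gamma> x (tractor_deriv n J \<Gamma> s a x)"
proof -
  interpret symplectic "J x" by (rule g.symplectic[OF x])
  define \<sigma> where "\<sigma> = (\<lambda>y. fst (s y))"
  define \<mu> where "\<mu> = (\<lambda>y. fst (snd (s y)))"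
  define \<rho> where "\<rho> = (\<lambda>y. snd (snd (s y)))"
  have "smooth_on S (\<lambda>y. inverse (\<Omega> y))"
    using pos by (intro smooth_on_inverse g.S smooth_\<Omega>) (metis less_irrefl)
  then have d: "\<sigma> differentiable (at x)" "\<mu> differentiable (at x)" "\<rho> differentiable (at x)"
    "\<Omega> differentiable (at x)" "(\<lambda>y. \<sigma> y *\<^sub>R \<Upsilon> y) differentiable (at x)"
    "(\<lambda>y. inverse (\<Omega> y)) differentiable (at x)"
    using x s smooth_\<Upsilon> smooth_\<Omega> unfolding \<sigma>_def \<mu>_def \<rho>_def
    by (auto intro!: smooth_on_differentiable[of S] smooth_on_fst smooth_on_snd smooth_on_scaleR g.S)
  \<comment> \<open>The last slot without its factor $\<Omega>^{-1}$, whose derivative is accounted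
    for in \<open>pw'\<close>.\<close>
  define w where "w = (\<lambda>y. \<rho> y - pr (J y) (\<Upsilon> y) (\<mu> y) + pr (J y) (\<Upsilon> y) (\<alpha> y) * \<sigma> y)"
  define s' where "s' = (\<lambda>y. (\<Omega> y * \<sigma> y, \<Omega> y *\<^sub>R (\<mu> y + \<sigma> y *\<^sub>R \<Upsilon> y), inverse (\<Omega> y) * w y))"
  have s': "tractor_rescale \<Omega> J \<Gamma> y (s y) = s' y" if "y \<in> S" for y
    by (simp add: tractor_rescale_pr g.alpha_eq[OF that] s'_def w_def \<sigma>_def \<mu>_def \<rho>_def)
  have o: "\<Omega> x > 0" by (rule pos[OF x])
  have pinv: "partial a (\<lambda>y. inverse (\<Omega> y)) x = - inverse (\<Omega> x) * \<Upsilon> x $ a"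
  proof -
    have "partial a (\<lambda>y. inverse (\<Omega> y)) x = - (inverse (\<Omega> x) * partial a \<Omega> x * inverse (\<Omega> x))"
      using d(4) o unfolding frechet_derivative_works
      by (subst has_partial[OF Deriv.has_derivative_inverse]) (auto simp: partial_def)
    then show ?thesis using o by (simp add: partial_\<Omega>[OF x])
  qed
  have prd: "(\<lambda>y. pr (J y) (\<Upsilon> y) (\<mu> y)) differentiable (at x)" "(\<lambda>y. pr (J y) (\<Upsilon> y) (\<alpha> y)) differentiable (at x)"
    using x d by (auto intro!: g.partial_pr(2))
  have wd: "w differentiable (at x)"
    unfolding w_def using d prd by simp
  \<comment> \<open>The summands $\<Upsilon>_a\<alpha>^b\<mu>_b$ and $\<mu>_a\<alpha>^b\<Upsilon>_b$
    come from the derivative of J. They are matched by the term $J_{ab}\<alpha>^c\<mu>_c$ of the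
    connection and by the term $\<Upsilon>^b\<alpha>_b\<sigma>$ of the change of splitting.\<close>
  have pw: "partial a w x = partial a \<rho> x
     - (pr (J x) (D1 \<Gamma> a \<Upsilon> x) (\<mu> x) + pr (J x) (\<Upsilon> x) (D1 \<Gamma> a \<mu> x) + \<Upsilon> x $ a * pr (J x) (\<alpha> x) (\<mu> x) - \<mu> x $ a * pr (J x) (\<alpha> x) (\<Upsilon> x))
     + (pr (J x) (D1 \<Gamma> a \<Upsilon> x) (\<alpha> x) + pr (J x) (\<Upsilon> x) (D1 \<Gamma> a \<alpha> x) - \<alpha> x $ a * pr (J x) (\<alpha> x) (\<Upsilon> x)) * \<sigma> x
     + pr (J x) (\<Upsilon> x) (\<alpha> x) * partial a \<sigma> x"
    unfolding w_def using x d prd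
    by (simp add: partial_add partial_diff partial_mult g.partial_pr[OF x] algebra_simps)
  have D\<mu>: "D1 \<Gamma>' a (\<lambda>y. \<Omega> y *\<^sub>R (\<mu> y + \<sigma> y *\<^sub>R \<Upsilon> y)) x = \<Omega> x *\<^sub>R (D1 \<Gamma> a \<mu> x + partial a \<sigma> x *\<^sub>R \<Upsilon> x + \<sigma> x *\<^sub>R D1 \<Gamma> a \<Upsilon> x
     - (\<mu> x $ a + \<sigma> x * \<Upsilon> x $ a) *\<^sub>R \<Upsilon> x)"
    unfolding D1'[OF x] using x d by (simp add: D1_scaleR D1_add partial_\<Omega>) (simp add: vec_eq_iff algebra_simps)
  let ?F = "Phi n J \<Gamma> x $ a" and ?d\<alpha> = "D1 \<Gamma> a \<alpha> x" and ?dU = "D1 \<Gamma> a \<Upsilon> x" and ?d\<mu> = "D1 \<Gamma> a \<mu> x"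
  note swaps = pr_swap[of "\<alpha> x" "\<Upsilon> x"] pr_swap[of "\<mu> x" "\<Upsilon> x"] pr_swap[of ?F "\<Upsilon> x"] pr_swap[of ?d\<alpha> "\<Upsilon> x"] pr_swap[of ?dU "\<Upsilon> x"]
    pr_swap[of ?d\<mu> "\<Upsilon> x"] pr_swap[of "\<mu> x" "\<alpha> x"] pr_swap[of ?F "\<alpha> x"] pr_swap[of ?d\<alpha> "\<alpha> x"] pr_swap[of ?dU "\<alpha> x"]
    pr_swap[of ?d\<mu> "\<alpha> x"] pr_swap[of ?F "\<mu> x"] pr_swap[of ?d\<alpha> "\<mu> x"] pr_swap[of ?dU "\<mu> x"] pr_swap[of ?d\<mu> "\<mu> x"]
  have T: "tractor_deriv n J \<Gamma> s a x =
    (partial a \<sigma> x - \<mu> x $ a, ?d\<mu> - \<rho> x *\<^sub>R J x $ a + \<sigma> x *\<^sub>R (?F - (?d\<alpha> + \<alpha> x $ a *\<^sub>R \<alpha> x)) - pr (J x) (\<alpha> x) (\<mu> x) *\<^sub>R J x $ a,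
     partial a \<rho> x + pr (J x) (\<mu> x) (?F - (?d\<alpha> + \<alpha> x $ a *\<^sub>R \<alpha> x)) - g.Z a x * \<sigma> x)"
    by (simp add: g.tractor_deriv_eq[OF x] g.A_row \<sigma>_def \<mu>_def \<rho>_def)
  have "tractor_deriv n J' \<Gamma>' (\<lambda>y. tractor_rescale \<Omega> J \<Gamma> y (s y)) a x = tractor_deriv n J' \<Gamma>' s' a x"
    by (rule tractor_deriv_cong[OF g.S x]) (rule s')
  also have "\<dots> = (partial a (\<lambda>y. \<Omega> y * \<sigma> y) x - \<Omega> x * (\<mu> x $ a + \<sigma> x * \<Upsilon> x $ a),
     \<Omega> x *\<^sub>R (?d\<mu> + partial a \<sigma> x *\<^sub>R \<Upsilon> x + \<sigma> x *\<^sub>R ?dU - (\<mu> x $ a + \<sigma> x * \<Upsilon> x $ a) *\<^sub>R \<Upsilon> x)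
       - (inverse (\<Omega> x) * w x) *\<^sub>R (\<Omega> x)\<^sup>2 *\<^sub>R J x $ a + (\<Omega> x * \<sigma> x) *\<^sub>R (?F - (?d\<alpha> + \<alpha> x $ a *\<^sub>R \<alpha> x - B a x))
       - (inverse ((\<Omega> x)\<^sup>2) * pr (J x) (\<alpha> x + \<Upsilon> x) (\<Omega> x *\<^sub>R (\<mu> x + \<sigma> x *\<^sub>R \<Upsilon> x))) *\<^sub>R (\<Omega> x)\<^sup>2 *\<^sub>R J x $ a,
     partial a (\<lambda>y. inverse (\<Omega> y) * w y) x
       + inverse ((\<Omega> x)\<^sup>2) * pr (J x) (\<Omega> x *\<^sub>R (\<mu> x + \<sigma> x *\<^sub>R \<Upsilon> x)) (?F - (?d\<alpha> + \<alpha> x $ a *\<^sub>R \<alpha> x - B a x)) - g'.Z a x * (\<Omega> x * \<sigma> x))"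
    unfolding g'.tractor_deriv_eq[OF x] pr'[OF x]
    by (simp only: A'[OF x] g.A_row Phi'[OF x] J'[OF x] alpha'[OF x] D\<mu> s'_def
       fst_conv snd_conv vector_scaleR_component vector_add_component real_scaleR_def)
  also have "\<dots> = tractor_rescale \<Omega> J \<Gamma> x (tractor_deriv n J \<Gamma> s a x)"
    unfolding tractor_rescale_pr T fst_conv snd_conv prod.inject g.alpha_eq[OF x]
  proof (intro conjI)
    show "partial a (\<lambda>y. \<Omega> y * \<sigma> y) x - \<Omega> x * (\<mu> x $ a + \<sigma> x * \<Upsilon> x $ a) = \<Omega> x * (partial a \<sigma> x - \<mu> x $ a)"
      using d by (simp add: partial_mult partial_\<Omega>[OF x] algebra_simps)
    have e1: "(inverse (\<Omega> x) * k) *\<^sub>R (\<Omega> x)\<^sup>2 *\<^sub>R v = (\<Omega> x * k) *\<^sub>R v"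
      "(inverse ((\<Omega> x)\<^sup>2) * k) *\<^sub>R (\<Omega> x)\<^sup>2 *\<^sub>R v = k *\<^sub>R v" for k and v :: "real^'d"
    proof -
      have "inverse (\<Omega> x) * k * (\<Omega> x)\<^sup>2 = \<Omega> x * k" "inverse ((\<Omega> x)\<^sup>2) * k * (\<Omega> x)\<^sup>2 = k"
        using o by (simp_all add: power2_eq_square field_simps)
      then show "(inverse (\<Omega> x) * k) *\<^sub>R (\<Omega> x)\<^sup>2 *\<^sub>R v = (\<Omega> x * k) *\<^sub>R v"
        "(inverse ((\<Omega> x)\<^sup>2) * k) *\<^sub>R (\<Omega> x)\<^sup>2 *\<^sub>R v = k *\<^sub>R v"
        by (simp_all only: scaleR_scaleR)
    qed
    show "\<Omega> x *\<^sub>R (?d\<mu> + partial a \<sigma> x *\<^sub>R \<Upsilon> x + \<sigma> x *\<^sub>R ?dU - (\<mu> x $ a + \<sigma> x * \<Upsilon> x $ a) *\<^sub>R \<Upsilon> x)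
       - (inverse (\<Omega> x) * w x) *\<^sub>R (\<Omega> x)\<^sup>2 *\<^sub>R J x $ a + (\<Omega> x * \<sigma> x) *\<^sub>R (?F - (?d\<alpha> + \<alpha> x $ a *\<^sub>R \<alpha> x - B a x))
       - (inverse ((\<Omega> x)\<^sup>2) * pr (J x) (\<alpha> x + \<Upsilon> x) (\<Omega> x *\<^sub>R (\<mu> x + \<sigma> x *\<^sub>R \<Upsilon> x))) *\<^sub>R (\<Omega> x)\<^sup>2 *\<^sub>R J x $ a
      = \<Omega> x *\<^sub>R (?d\<mu> - \<rho> x *\<^sub>R J x $ a + \<sigma> x *\<^sub>R (?F - (?d\<alpha> + \<alpha> x $ a *\<^sub>R \<alpha> x)) - pr (J x) (\<alpha> x) (\<mu> x) *\<^sub>R J x $ a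
         + (partial a \<sigma> x - \<mu> x $ a) *\<^sub>R \<Upsilon> x)"
      unfolding e1 by (simp add: w_def B_def swaps algebra_simps)
    have e2: "inverse ((\<Omega> x)\<^sup>2) * (\<Omega> x * k) = inverse (\<Omega> x) * k" "inverse ((\<Omega> x)\<^sup>2) * z * (\<Omega> x * k) = inverse (\<Omega> x) * (z * k)" for k z
      using o by (simp_all add: power2_eq_square field_simps)
    have Z: "g.Z a x = (divPhi n J \<Gamma> x $ a + pr (J x) (\<alpha> x) ?F) / (2 * real n + 1) + 2 * pr (J x) (\<alpha> x) ?F - pr (J x) (\<alpha> x) ?d\<alpha>"
      by (simp add: g.Z_def)
    \<comment> \<open>Both sides contain this quotient unchanged, so it is kept opaque during the
      simplification.\<close>
    define z where "z = (divPhi n J \<Gamma> x $ a + pr (J x) (\<alpha> x) ?F) / (2 * real n + 1)"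
    have pw': "partial a (\<lambda>y. inverse (\<Omega> y) * w y) x = inverse (\<Omega> x) * (partial a w x - \<Upsilon> x $ a * w x)"
      using d wd by (simp add: partial_mult pinv algebra_simps)
    show "partial a (\<lambda>y. inverse (\<Omega> y) * w y) x
       + inverse ((\<Omega> x)\<^sup>2) * pr (J x) (\<Omega> x *\<^sub>R (\<mu> x + \<sigma> x *\<^sub>R \<Upsilon> x)) (?F - (?d\<alpha> + \<alpha> x $ a *\<^sub>R \<alpha> x - B a x)) - g'.Z a x * (\<Omega> x * \<sigma> x)
     = inverse (\<Omega> x) * (partial a \<rho> x + pr (J x) (\<mu> x) (?F - (?d\<alpha> + \<alpha> x $ a *\<^sub>R \<alpha> x)) - g.Z a x * \<sigma> x
        - pr (J x) (\<Upsilon> x) (?d\<mu> - \<rho> x *\<^sub>R J x $ a + \<sigma> x *\<^sub>R (?F - (?d\<alpha> + \<alpha> x $ a *\<^sub>R \<alpha> x)) - pr (J x) (\<alpha> x) (\<mu> x) *\<^sub>R J x $ a)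
        + pr (J x) (\<Upsilon> x) (\<alpha> x) * (partial a \<sigma> x - \<mu> x $ a))"
      unfolding pr_linear(5) Z'[OF x] Z e2 pw' pw z_def[symmetric]
      unfolding distrib_left[symmetric] right_diff_distrib[symmetric]
      by (rule arg_cong[of _ _ "(*) (inverse (\<Omega> x))"]) (simp add: w_def B_def swaps algebra_simps)
  qed
  finally show ?thesis .
qed

end

section \<open>Change of chart\<close>

lemma vector_matrix_assoc: "u v* A v* B = u v* (A ** (B :: real^'c^'b))"
  by (simp add: transpose_matrix_vector[symmetric] matrix_transpose_mul matrix_vector_mul_assoc del: transpose_matrix_vector)

lemma matrix_vector_transpose: "(A :: real^'b^'a) *v u = u v* transpose A"
  using transpose_matrix_vector[of "transpose A" u] by simp

lemma vector_matrix_linear: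
  "(u + v) v* A = u v* A + v v* (A :: real^'b^'a)" "(u - v) v* A = u v* A - v v* A"
  "(c *\<^sub>R u) v* A = c *\<^sub>R (u v* A)" "(- u) v* A = - (u v* A)" "0 v* A = 0"
  "(sum f I) v* A = (\<Sum>i\<in>I. f i v* A)"
  "u v* (A + B) = u v* A + u v* B" "u v* (c *\<^sub>R A) = c *\<^sub>R (u v* A)" "u v* (sum g I) = (\<Sum>i\<in>I. u v* (g i :: real^'b^'a))"
proof -
  interpret bounded_bilinear "(v*) :: real^'a \<Rightarrow> real^'b^'a \<Rightarrow> real^'b" by (rule bounded_bilinear_vector_matrix_mult)
  show "(u + v) v* A = u v* A + v v* (A :: real^'b^'a)" "(u - v) v* A = u v* A - v v* A"
    "(c *\<^sub>R u) v* A = c *\<^sub>R (u v* A)" "(- u) v* A = - (u v* A)" "0 v* A = 0"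
    "(sum f I) v* A = (\<Sum>i\<in>I. f i v* A)"
    "u v* (A + B) = u v* A + u v* B" "u v* (c *\<^sub>R A) = c *\<^sub>R (u v* A)" "u v* (sum g I) = (\<Sum>i\<in>I. u v* (g i :: real^'b^'a))"
    by (simp_all add: add_left diff_left scaleR_left minus_left zero_left sum_left add_right scaleR_right sum_right)
qed

lemma matrix_mult_sum_distrib: "(sum f I) ** A = (\<Sum>i\<in>I. f i ** (A :: real^'c^'b))" "B ** (sum h I) = (\<Sum>i\<in>I. B ** (h i :: real^'c^'b))"
  using bounded_bilinear.sum_left[OF bounded_bilinear_matrix_mult] bounded_bilinear.sum_right[OF bounded_bilinear_matrix_mult]
  by blast+

lemma transpose_sum: "transpose (sum f I) = (\<Sum>i\<in>I. transpose (f i :: real^'b^'a))"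
  by (rule linear_sum[OF bounded_linear.linear[OF bounded_linear_transpose]])

lemma pr_sum_right: "pr J u (sum f I) = (\<Sum>i\<in>I. pr J u (f i))"
  by (simp add: pr_def inner_sum_right)

text \<open>Lets a tensor with two indices be handled as a tuple of covectors: the row index picks
  up one factor of M, and each row is pulled back as a covector.\<close>

lemma congruence_row: "(transpose M ** T ** M) $ a = (\<Sum>p\<in>UNIV. M $ p $ a *\<^sub>R (T $ p v* (M :: real^'a^'b)))"
proof -
  have "(transpose M ** X) $ a = (\<Sum>p\<in>UNIV. M $ p $ a *\<^sub>R X $ p)" for X :: "real^'a^'b"
    by (simp add: vec_eq_iff matrix_matrix_mult_def transpose_def)
  moreover have "(T ** M) $ p = T $ p v* M" for p
    by (simp add: vec_eq_iff matrix_matrix_mult_def vector_matrix_mult_def mult.commute)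
  ultimately show ?thesis by (simp flip: matrix_mul_assoc)
qed

lemma congruence_entry: "(transpose M ** T ** M) $ c $ d = (\<Sum>r\<in>UNIV. \<Sum>s\<in>UNIV. M $ r $ c * (M $ s $ d * T $ r $ (s :: 'b)))"
  for M :: "real^'a^'b"
  by (simp add: congruence_row vector_matrix_mult_def sum_distrib_left mult_ac)

lemma outer_congruence: "outer (u v* M) (v v* M) = transpose M ** outer u v ** (M :: real^'d^'d)"
  by (simp add: matrix_mult_outer matrix_mul_assoc[symmetric] vec_eq_iff)
     (simp add: matrix_matrix_mult_def vector_matrix_mult_def transpose_def sum_distrib_left sum_distrib_right mult_ac)

text \<open>In the application \<open>W\<close> is the overlap seen in the first chart, and the
  transition map \<psi> carries it into the region \<open>W'\<close> of the second.\<close>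

locale chart_change = g: gauge W n J \<Gamma> \<alpha> + g': gauge W' n J' \<Gamma>' \<alpha>'
  for W W' :: "(real^'d::finite) set" and n J \<Gamma> \<alpha> J' \<Gamma>' \<alpha>' +
  fixes \<psi> :: "real^'d \<Rightarrow> real^'d" and M :: "real^'d \<Rightarrow> real^'d^'d"
  assumes M_def: "M x = (\<chi> k i. partial i \<psi> x $ k)"
    and smooth_\<psi>: "smooth_on W \<psi>" and \<psi>: "x \<in> W \<Longrightarrow> \<psi> x \<in> W'"
    and J_pull: "x \<in> W \<Longrightarrow> J x = transpose (M x) ** J' (\<psi> x) ** M x"
    and \<alpha>_pull: "x \<in> W \<Longrightarrow> \<alpha> x = \<alpha>' (\<psi> x) v* M x"
    and \<Gamma>_law: "x \<in> W \<Longrightarrow> (\<Sum>k\<in>UNIV. M x $ l $ k * \<Gamma> x $ k $ i $ j) =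
        partial i (\<lambda>y. M y $ l $ j) x +
        (\<Sum>p\<in>UNIV. \<Sum>q\<in>UNIV. M x $ p $ i * M x $ q $ j * \<Gamma>' (\<psi> x) $ l $ p $ q)"
begin

lemma smooth_M: "smooth_on W M"
  unfolding M_def[abs_def] by (intro smooth_on_vec smooth_on_nth smooth_on_partial smooth_\<psi> g.S)

lemma M_differentiable [simp]: "x \<in> W \<Longrightarrow> M differentiable (at x)"
  using smooth_M smooth_on_differentiable by blast

lemma \<psi>_differentiable [simp]: "x \<in> W \<Longrightarrow> \<psi> differentiable (at x)"
  using smooth_\<psi> smooth_on_differentiable by blast

lemma compose_differentiable: "x \<in> W \<Longrightarrow> f differentiable (at (\<psi> x)) \<Longrightarrow> (\<lambda>y. f (\<psi> y)) differentiable (at x)"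
  using differentiable_chain_at[of \<psi> x f] by (simp add: o_def)

lemma partial_compose: "x \<in> W \<Longrightarrow> f differentiable (at (\<psi> x)) \<Longrightarrow>
    partial i (\<lambda>y. f (\<psi> y)) x = (\<Sum>p\<in>UNIV. M x $ p $ i *\<^sub>R partial p f (\<psi> x))"
  by (simp add: partial_chain M_def)

lemma conn_law: "x \<in> W \<Longrightarrow> M x ** transpose (conn \<Gamma> i x) =
    partial i M x + (\<Sum>p\<in>UNIV. M x $ p $ i *\<^sub>R (transpose (conn \<Gamma>' p (\<psi> x)) ** M x))"
proof -
  assume x: "x \<in> W"
  have "partial i (\<lambda>y. M y $ l $ j) x = partial i M x $ l $ j" for l j
    using x by (simp add: partial_nth differentiable_nth)
  then show ?thesis
    using \<Gamma>_law[OF x]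
    by (simp add: vec_eq_iff matrix_matrix_mult_def transpose_def conn_def sum_distrib_left mult_ac)
qed

lemma partial_M_sym: "x \<in> W \<Longrightarrow> partial a (\<lambda>y. M y $ q $ b) x = partial b (\<lambda>y. M y $ q $ a) x"
proof -
  assume x: "x \<in> W"
  have d: "partial c \<psi> differentiable (at x)" for c
    using smooth_\<psi> x smooth_on_partial smooth_on_differentiable by blast
  show ?thesis
    by (simp add: M_def partial_nth[OF d] partial_commute[OF g.S smooth_\<psi> x, of a b])
qed

text \<open>The derivative of M produced by the product rule cancels against the inhomogeneous term
  of \<open>conn_law\<close>; in \<open>D2_pull\<close> this happens once for each index.\<close>

lemma D1_pull:
  assumes x: "x \<in> W" and \<phi>: "\<And>y. y \<in> W \<Longrightarrow> \<phi> y = \<phi>' (\<psi> y) v* M y" and d: "\<phi>' differentiable (at (\<psi> x))"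
  shows "D1 \<Gamma> i \<phi> x = (\<Sum>p\<in>UNIV. M x $ p $ i *\<^sub>R (D1 \<Gamma>' p \<phi>' (\<psi> x) v* M x))"
proof -
  note bil = bounded_bilinear_vector_matrix_mult
  have "partial i \<phi> x = partial i (\<lambda>y. \<phi>' (\<psi> y) v* M y) x"
    by (rule partial_cong[OF g.S x]) (rule \<phi>)
  also have "\<dots> = \<phi>' (\<psi> x) v* partial i M x + (\<Sum>p\<in>UNIV. M x $ p $ i *\<^sub>R (partial p \<phi>' (\<psi> x) v* M x))"
    using x d by (simp add: partial_bilinear[OF bil] compose_differentiable partial_compose vector_matrix_linear)
  finally have 1: "partial i \<phi> x = \<dots>" .
  have "conn \<Gamma> i x *v \<phi> x = \<phi>' (\<psi> x) v* (M x ** transpose (conn \<Gamma> i x))"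
    by (simp only: \<phi>[OF x] matrix_vector_transpose[of "conn \<Gamma> i x"] vector_matrix_assoc)
  also have "\<dots> = \<phi>' (\<psi> x) v* partial i M x + (\<Sum>p\<in>UNIV. M x $ p $ i *\<^sub>R ((conn \<Gamma>' p (\<psi> x) *v \<phi>' (\<psi> x)) v* M x))"
    by (simp only: conn_law[OF x] vector_matrix_linear vector_matrix_assoc[symmetric] matrix_vector_transpose)
  finally show ?thesis
    unfolding D1_def 1 by (simp add: vector_matrix_linear sum_subtractf scaleR_diff_right)
qed

lemma D2_pull:
  assumes x: "x \<in> W" and T: "\<And>y. y \<in> W \<Longrightarrow> T y = transpose (M y) ** T' (\<psi> y) ** M y" and d: "T' differentiable (at (\<psi> x))"
  shows "D2 \<Gamma> i T x = (\<Sum>p\<in>UNIV. M x $ p $ i *\<^sub>R (transpose (M x) ** D2 \<Gamma>' p T' (\<psi> x) ** M x))"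
proof -
  note bil = bounded_bilinear_matrix_mult
  let ?M = "M x" and ?T = "T' (\<psi> x)"
  have dt: "(\<lambda>y. transpose (M y)) differentiable (at x)" "(\<lambda>y. transpose (M y) ** T' (\<psi> y)) differentiable (at x)"
    using x d compose_differentiable[OF x d]
    by (auto intro!: differentiable_linear[OF bounded_linear_transpose] differentiable_bilinear[OF bil])
  have "partial i T x = partial i (\<lambda>y. (transpose (M y) ** T' (\<psi> y)) ** M y) x"
    by (rule partial_cong[OF g.S x]) (rule T)
  also have "\<dots> = transpose ?M ** ?T ** partial i M x + transpose (partial i M x) ** ?T ** ?M
     + (\<Sum>p\<in>UNIV. M x $ p $ i *\<^sub>R (transpose ?M ** partial p T' (\<psi> x) ** ?M))"
    using x d dt
    by (simp add: partial_bilinear[OF bil] compose_differentiable partial_compose partial_linear[OF bounded_linear_transpose]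
        matrix_add_rdistrib' matrix_mult_sum_distrib matrix_scaleR matrix_mul_assoc)
  finally have 1: "partial i T x = \<dots>" .
  have "T x ** transpose (conn \<Gamma> i x) = transpose ?M ** ?T ** (?M ** transpose (conn \<Gamma> i x))"
    by (simp only: T[OF x] matrix_mul_assoc)
  also have "\<dots> = transpose ?M ** ?T ** partial i M x + (\<Sum>p\<in>UNIV. M x $ p $ i *\<^sub>R (transpose ?M ** (?T ** transpose (conn \<Gamma>' p (\<psi> x))) ** ?M))"
    by (simp only: conn_law[OF x] matrix_add_ldistrib matrix_mult_sum_distrib matrix_scaleR matrix_mul_assoc)
  finally have 2: "T x ** transpose (conn \<Gamma> i x) = \<dots>" .
  have "conn \<Gamma> i x ** T x = transpose (?M ** transpose (conn \<Gamma> i x)) ** ?T ** ?M"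
    by (simp add: T[OF x] matrix_mul_assoc matrix_transpose_mul)
  also have "\<dots> = transpose (partial i M x) ** ?T ** ?M + (\<Sum>p\<in>UNIV. M x $ p $ i *\<^sub>R (transpose ?M ** (conn \<Gamma>' p (\<psi> x) ** ?T) ** ?M))"
    unfolding conn_law[OF x]
    by (simp add: transpose_linear transpose_sum transpose_scaleR matrix_transpose_mul matrix_add_rdistrib' matrix_mult_sum_distrib matrix_scaleR matrix_mul_assoc)
  finally show ?thesis
    unfolding D2_def 1 2
    by (simp add: matrix_diff_ldistrib' matrix_diff_rdistrib' sum_subtractf scaleR_diff_right)
qed

text \<open>The Ricci identity is applied to the pullbacks of constant covector fields: only the symmetry of
  the second derivatives of the transition map enters, and no third derivatives.\<close>
lemma curv_pull:
  assumes x: "x \<in> W"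
  shows "curv \<Gamma> a b x ** transpose (M x) = (\<Sum>p\<in>UNIV. \<Sum>q\<in>UNIV. (M x $ p $ a * M x $ q $ b) *\<^sub>R (transpose (M x) ** curv \<Gamma>' p q (\<psi> x)))"
proof -
  have "(curv \<Gamma> a b x ** transpose (M x)) *v v = (\<Sum>p\<in>UNIV. \<Sum>q\<in>UNIV. (M x $ p $ a * M x $ q $ b) *\<^sub>R (transpose (M x) ** curv \<Gamma>' p q (\<psi> x))) *v v" for v
  proof -
    define \<theta> where "\<theta> = (\<lambda>q. D1 \<Gamma>' q (\<lambda>_. v))"
    define \<phi> where "\<phi> = (\<lambda>y. v v* M y)"
    note bil = bounded_bilinear_vector_matrix_mult
    have sm: "smooth_on W \<phi>" unfolding \<phi>_def by (intro smooth_on_bilinear[OF bil] smooth_on_const smooth_M g.S)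
    have s\<theta>: "smooth_on W' (\<theta> q)" for q unfolding \<theta>_def by (intro smooth_on_D1 g'.S g'.smooth_\<Gamma> smooth_on_const)
    have d\<theta>: "\<theta> q differentiable (at (\<psi> y))" if "y \<in> W" for q y
      using s\<theta> \<psi>[OF that] smooth_on_differentiable by blast
    have d: "(\<lambda>y. M y $ q $ b) differentiable (at x)" "(\<lambda>y. \<theta> q (\<psi> y) v* M y) differentiable (at x)" for q b
      using x by (auto intro!: differentiable_nth differentiable_bilinear[OF bil] compose_differentiable d\<theta>)
    \<comment> \<open>The first sum is symmetric in a and b by \<open>partial_M_sym\<close> and
      disappears from the commutator.\<close>
    have DD: "D1 \<Gamma> a (D1 \<Gamma> b \<phi>) x = (\<Sum>q\<in>UNIV. partial a (\<lambda>y. M y $ q $ b) x *\<^sub>R (\<theta> q (\<psi> x) v* M x))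
       + (\<Sum>p\<in>UNIV. \<Sum>q\<in>UNIV. (M x $ p $ a * M x $ q $ b) *\<^sub>R (D1 \<Gamma>' p (\<theta> q) (\<psi> x) v* M x))" for a b
    proof -
      have "D1 \<Gamma> a (D1 \<Gamma> b \<phi>) x = D1 \<Gamma> a (\<lambda>y. \<Sum>q\<in>UNIV. M y $ q $ b *\<^sub>R (\<theta> q (\<psi> y) v* M y)) x"
        unfolding \<theta>_def by (rule D1_cong[OF g.S x]) (rule D1_pull, auto simp: \<phi>_def)
      also have "\<dots> = (\<Sum>q\<in>UNIV. D1 \<Gamma> a (\<lambda>y. M y $ q $ b *\<^sub>R (\<theta> q (\<psi> y) v* M y)) x)"
        using d by (simp add: D1_def partial_sum sum_subtractf bounded_bilinear.sum_right[OF bounded_bilinear_matrix_vector_mult])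
      also have "\<dots> = (\<Sum>q\<in>UNIV. partial a (\<lambda>y. M y $ q $ b) x *\<^sub>R (\<theta> q (\<psi> x) v* M x)
         + M x $ q $ b *\<^sub>R (\<Sum>p\<in>UNIV. M x $ p $ a *\<^sub>R (D1 \<Gamma>' p (\<theta> q) (\<psi> x) v* M x)))"
        using d by (simp add: D1_scaleR D1_pull[OF x refl d\<theta>[OF x]])
      also have "\<dots> = (\<Sum>q\<in>UNIV. partial a (\<lambda>y. M y $ q $ b) x *\<^sub>R (\<theta> q (\<psi> x) v* M x))
         + (\<Sum>q\<in>UNIV. \<Sum>p\<in>UNIV. (M x $ p $ a * M x $ q $ b) *\<^sub>R (D1 \<Gamma>' p (\<theta> q) (\<psi> x) v* M x))"
        by (simp add: sum.distrib scaleR_sum_right mult.commute)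
      finally show ?thesis by (subst (asm) sum.swap)
    qed
    have "- (curv \<Gamma> a b x *v \<phi> x) = (\<Sum>p\<in>UNIV. \<Sum>q\<in>UNIV. (M x $ p $ a * M x $ q $ b) *\<^sub>R (D1 \<Gamma>' p (\<theta> q) (\<psi> x) v* M x))
       - (\<Sum>p\<in>UNIV. \<Sum>q\<in>UNIV. (M x $ p $ b * M x $ q $ a) *\<^sub>R (D1 \<Gamma>' p (\<theta> q) (\<psi> x) v* M x))"
      unfolding ricci_vector[OF g.S x g.smooth_\<Gamma> sm, symmetric] DD by (simp add: partial_M_sym[OF x, of a _ b])
    also have "(\<Sum>p\<in>UNIV. \<Sum>q\<in>UNIV. (M x $ p $ b * M x $ q $ a) *\<^sub>R (D1 \<Gamma>' p (\<theta> q) (\<psi> x) v* M x))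
       = (\<Sum>p\<in>UNIV. \<Sum>q\<in>UNIV. (M x $ p $ a * M x $ q $ b) *\<^sub>R (D1 \<Gamma>' q (\<theta> p) (\<psi> x) v* M x))"
      by (subst sum.swap) (simp add: mult.commute)
    finally have "- (curv \<Gamma> a b x *v \<phi> x) = (\<Sum>p\<in>UNIV. \<Sum>q\<in>UNIV. (M x $ p $ a * M x $ q $ b) *\<^sub>R
         ((D1 \<Gamma>' p (\<theta> q) (\<psi> x) - D1 \<Gamma>' q (\<theta> p) (\<psi> x)) v* M x))"
      by (simp add: sum_subtractf[symmetric] vector_matrix_linear scaleR_diff_right)
    also have "\<dots> = - (\<Sum>p\<in>UNIV. \<Sum>q\<in>UNIV. (M x $ p $ a * M x $ q $ b) *\<^sub>R ((curv \<Gamma>' p q (\<psi> x) *v v) v* M x))"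
      unfolding \<theta>_def ricci_vector[OF g'.S \<psi>[OF x] g'.smooth_\<Gamma> smooth_on_const]
      by (simp add: vector_matrix_linear sum_negf)
    finally have "curv \<Gamma> a b x *v (v v* M x) = (\<Sum>p\<in>UNIV. \<Sum>q\<in>UNIV. (M x $ p $ a * M x $ q $ b) *\<^sub>R ((curv \<Gamma>' p q (\<psi> x) *v v) v* M x))"
      by (simp add: \<phi>_def)
    then show ?thesis
      by (simp add: transpose_matrix_vector[symmetric] matrix_vector_mul_assoc bounded_bilinear.sum_left[OF bounded_bilinear_matrix_vector_mult]
          bounded_bilinear.scaleR_left[OF bounded_bilinear_matrix_vector_mult] del: transpose_matrix_vector)
  qed
  then show ?thesis by (simp add: matrix_eq)
qed

lemma curv_J_pull:
  assumes x: "x \<in> W"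
  shows "curv \<Gamma> a b x ** J x = (\<Sum>p\<in>UNIV. \<Sum>q\<in>UNIV. (M x $ p $ a * M x $ q $ b) *\<^sub>R
    (transpose (M x) ** (curv \<Gamma>' p q (\<psi> x) ** J' (\<psi> x)) ** M x))"
proof -
  have "curv \<Gamma> a b x ** J x = (curv \<Gamma> a b x ** transpose (M x)) ** (J' (\<psi> x) ** M x)"
    by (simp add: J_pull[OF x] matrix_mul_assoc)
  then show ?thesis
    by (simp add: curv_pull[OF x] matrix_mult_sum_distrib matrix_scaleR matrix_mul_assoc)
qed

text \<open>Invertibility of M comes from that of J: a right inverse of the square matrix $M^T$ is
  read off from the pullback law, and it is then also a left inverse.\<close>

lemma Jup_pull:
  assumes x: "x \<in> W"
  shows "Jup (J' (\<psi> x)) = M x ** Jup (J x) ** transpose (M x)"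
proof -
  let ?N = "Jup (J x)" and ?N' = "Jup (J' (\<psi> x))" and ?K = "M x ** Jup (J x) ** transpose (M x)"
  note j = symplectic.J_Jup[OF g.symplectic[OF x]] and j' = symplectic.J_Jup[OF g'.symplectic[OF \<psi>[OF x]]]
  have "transpose (M x) ** (- (J' (\<psi> x) ** M x ** ?N)) = mat 1"
    using j(1) by (simp add: J_pull[OF x] matrix_minus_right matrix_mul_assoc)
  then have "- (J' (\<psi> x) ** M x ** ?N) ** transpose (M x) = mat 1"
    using matrix_left_right_inverse by blast
  then have "J' (\<psi> x) ** ?K = - mat 1"
    by (simp add: matrix_minus_left matrix_mul_assoc eq_neg_iff_add_eq_0 minus_equation_iff[of _ "mat 1"])
  then have "?N' ** (J' (\<psi> x) ** ?K) = - ?N'" by (simp add: matrix_minus_right)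
  then show ?thesis by (simp add: matrix_mul_assoc j' matrix_minus_left)
qed

lemma pr_pull: "x \<in> W \<Longrightarrow> pr (J x) (u v* M x) (v v* M x) = pr (J' (\<psi> x)) u v"
  by (simp add: pr_def Jup_pull matrix_vector_mul_assoc[symmetric] transpose_matrix_vector inner_commute[of _ "v v* M x"] dot_lmul_matrix)
     (simp add: inner_commute)

lemma ctr_pull:
  assumes x: "x \<in> W"
  shows "ctr (J x) (\<lambda>a b. \<Sum>p\<in>UNIV. \<Sum>q\<in>UNIV. (M x $ p $ a * M x $ q $ b) * F p q) = ctr (J' (\<psi> x)) F"
proof -
  have "ctr (J x) (\<lambda>a b. M x $ p $ a * M x $ q $ b) = Jup (J' (\<psi> x)) $ p $ q" for p q
  proof -
    have "ctr (J x) (\<lambda>a b. M x $ p $ a * M x $ q $ b) = (\<Sum>b\<in>UNIV. \<Sum>a\<in>UNIV. Jup (J x) $ a $ b * (M x $ p $ a * M x $ q $ b))"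
      unfolding ctr_def by (rule sum.swap)
    then show ?thesis
      by (simp add: Jup_pull[OF x] matrix_matrix_mult_def transpose_def sum_distrib_left sum_distrib_right mult_ac)
  qed
  then show ?thesis by (simp add: ctr_sum ctr_linear) (simp add: ctr_def)
qed

lemma A_row_pull:
  assumes x: "x \<in> W"
  shows "g.A x $ a = (\<Sum>p\<in>UNIV. M x $ p $ a *\<^sub>R (g'.A (\<psi> x) $ p v* M x))"
proof -
  have "\<alpha> x $ a = (\<Sum>p\<in>UNIV. M x $ p $ a * \<alpha>' (\<psi> x) $ p)"
    by (simp add: \<alpha>_pull[OF x] vector_matrix_mult_def mult.commute)
  then have "\<alpha> x $ a *\<^sub>R \<alpha> x = (\<Sum>p\<in>UNIV. M x $ p $ a *\<^sub>R (\<alpha>' (\<psi> x) $ p *\<^sub>R (\<alpha>' (\<psi> x) v* M x)))"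
    by (simp add: \<alpha>_pull[OF x] scaleR_sum_left)
  moreover have "D1 \<Gamma> a \<alpha> x = (\<Sum>p\<in>UNIV. M x $ p $ a *\<^sub>R (D1 \<Gamma>' p \<alpha>' (\<psi> x) v* M x))"
    using \<psi>[OF x] by (intro D1_pull[OF x \<alpha>_pull]) auto
  ultimately show ?thesis
    by (simp add: g.A_row g'.A_row vector_matrix_linear scaleR_add_right sum.distrib)
qed

lemma J_row_pull: "x \<in> W \<Longrightarrow> J x $ a = (\<Sum>p\<in>UNIV. M x $ p $ a *\<^sub>R (J' (\<psi> x) $ p v* M x))"
  by (simp add: J_pull congruence_row)

text \<open>Follows from the trace formula: Q is tensorial because the lowered curvature, J and
  \<open>A\<close> are, and the contraction absorbs the jacobians of a and b.\<close>

lemma Phi_pull: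
  assumes x: "x \<in> W"
  shows "Phi n J \<Gamma> x = transpose (M x) ** Phi n J' \<Gamma>' (\<psi> x) ** M x"
proof -
  let ?M = "M x" and ?z = "\<psi> x"
  \<comment> \<open>For fixed a and b a matrix in c and d, so that the transformation law becomes a
    sum of congruences.\<close>
  define Q where "Q = (\<lambda>a b. transpose (curv \<Gamma> a b x ** J x) + outer (J x $ a) (g.A x $ b) - outer (J x $ b) (g.A x $ a))"
  define Q' where "Q' = (\<lambda>a b. transpose (curv \<Gamma>' a b ?z ** J' ?z) + outer (J' ?z $ a) (g'.A ?z $ b) - outer (J' ?z $ b) (g'.A ?z $ a))"
  have Q: "Q_of (J x) (curvature_low J \<Gamma> x) (g.A x) a b c d = Q a b $ c $ d" for a b c d
    using symplectic.J_swap[OF g.symplectic[OF x], of c a] symplectic.J_swap[OF g.symplectic[OF x], of c b] x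
    by (simp add: Q_of_def Q_def g.curvature_low_eq transpose_def)
  have Q': "Q_of (J' ?z) (curvature_low J' \<Gamma>' ?z) (g'.A ?z) a b c d = Q' a b $ c $ d" for a b c d
    using symplectic.J_swap[OF g'.symplectic[OF \<psi>[OF x]], of c a] symplectic.J_swap[OF g'.symplectic[OF \<psi>[OF x]], of c b] \<psi>[OF x]
    by (simp add: Q_of_def Q'_def g'.curvature_low_eq transpose_def)
  note obil = bounded_bilinear_outer
  have o1: "outer (J x $ a) (g.A x $ b) = (\<Sum>p\<in>UNIV. \<Sum>q\<in>UNIV. (?M $ p $ a * ?M $ q $ b) *\<^sub>R (transpose ?M ** outer (J' ?z $ p) (g'.A ?z $ q) ** ?M))" for a b
  proof -
    have "outer (J x $ a) (g.A x $ b) = (\<Sum>q\<in>UNIV. \<Sum>p\<in>UNIV. (?M $ p $ a * ?M $ q $ b) *\<^sub>R (transpose ?M ** outer (J' ?z $ p) (g'.A ?z $ q) ** ?M))"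
      by (simp add: J_row_pull[OF x] A_row_pull[OF x] bounded_bilinear.sum_left[OF obil] bounded_bilinear.sum_right[OF obil]
        bounded_bilinear.scaleR_left[OF obil] bounded_bilinear.scaleR_right[OF obil] outer_congruence scaleR_sum_right mult_ac)
    also have "\<dots> = (\<Sum>p\<in>UNIV. \<Sum>q\<in>UNIV. (?M $ p $ a * ?M $ q $ b) *\<^sub>R (transpose ?M ** outer (J' ?z $ p) (g'.A ?z $ q) ** ?M))"
      by (rule sum.swap)
    finally show ?thesis .
  qed
  have o2: "outer (J x $ b) (g.A x $ a) = (\<Sum>p\<in>UNIV. \<Sum>q\<in>UNIV. (?M $ p $ a * ?M $ q $ b) *\<^sub>R (transpose ?M ** outer (J' ?z $ q) (g'.A ?z $ p) ** ?M))" for a b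
    unfolding o1 by (subst sum.swap) (simp add: mult.commute)
  have "transpose (curv \<Gamma> a b x ** J x) = (\<Sum>p\<in>UNIV. \<Sum>q\<in>UNIV. (?M $ p $ a * ?M $ q $ b) *\<^sub>R (transpose ?M ** transpose (curv \<Gamma>' p q ?z ** J' ?z) ** ?M))" for a b
    unfolding curv_J_pull[OF x]
    by (simp add: transpose_sum transpose_scaleR matrix_transpose_mul matrix_mul_assoc)
  then have Qp: "Q a b = (\<Sum>p\<in>UNIV. \<Sum>q\<in>UNIV. (?M $ p $ a * ?M $ q $ b) *\<^sub>R (transpose ?M ** Q' p q ** ?M))" for a b
    unfolding Q_def Q'_def o1[where a=a and b=b] o2[where a=a and b=b]
    by (simp add: matrix_add_ldistrib matrix_add_rdistrib' matrix_diff_ldistrib' matrix_diff_rdistrib' scaleR_add_right scaleR_diff_right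
        sum.distrib sum_subtractf)
  have "ctr (J x) (\<lambda>a b. Q a b $ c $ d) = ctr (J' ?z) (\<lambda>p q. (transpose ?M ** Q' p q ** ?M) $ c $ d)" for c d
    unfolding Qp using ctr_pull[OF x, of "\<lambda>p q. (transpose ?M ** Q' p q ** ?M) $ c $ d"] by simp
  also have "ctr (J' ?z) (\<lambda>p q. (transpose ?M ** Q' p q ** ?M) $ c $ d) = (\<Sum>r\<in>UNIV. \<Sum>s\<in>UNIV. ?M $ r $ c * (?M $ s $ d * ctr (J' ?z) (\<lambda>p q. Q' p q $ r $ s)))" for c d
    by (simp add: congruence_entry ctr_sum ctr_linear)
  finally show ?thesis
    using x \<psi>[OF x]
    by (simp add: vec_eq_iff congruence_entry g.decomposition_eq g'.decomposition_eq Phi_of_def Q Q' sum_divide_distrib)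
qed

lemma divPhi_pull:
  assumes x: "x \<in> W"
  shows "divPhi n J \<Gamma> x $ a = (\<Sum>p\<in>UNIV. M x $ p $ a * divPhi n J' \<Gamma>' (\<psi> x) $ p)"
proof -
  let ?M = "M x" and ?D = "\<lambda>p. D2 \<Gamma>' p (Phi n J' \<Gamma>') (\<psi> x)"
  have div: "divPhi n J \<Gamma> x $ a = ctr (J x) (\<lambda>b c. D2 \<Gamma> c (Phi n J \<Gamma>) x $ a $ b)" for J \<Gamma> x a
    by (simp add: divPhi_def ctr_def cov2_D2)
  have D0: "D2 \<Gamma> c (Phi n J \<Gamma>) x = (\<Sum>p\<in>UNIV. ?M $ p $ c *\<^sub>R (transpose ?M ** ?D p ** ?M))" for c
    using \<psi>[OF x] g'.smooth_Phi by (intro D2_pull[OF x Phi_pull]) (auto intro: smooth_on_differentiable)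
  \<comment> \<open>The sums are ordered so that the jacobians of the two contracted indices stand
    in the form that \<open>ctr_pull\<close> expects.\<close>
  have D: "D2 \<Gamma> c (Phi n J \<Gamma>) x $ a $ b = (\<Sum>s\<in>UNIV. \<Sum>p\<in>UNIV. (?M $ s $ b * ?M $ p $ c) * (\<Sum>r\<in>UNIV. ?M $ r $ a * ?D p $ r $ s))" for b c
  proof -
    have "D2 \<Gamma> c (Phi n J \<Gamma>) x $ a $ b = (\<Sum>p\<in>UNIV. \<Sum>r\<in>UNIV. \<Sum>s\<in>UNIV. (?M $ s $ b * ?M $ p $ c) * (?M $ r $ a * ?D p $ r $ s))"
      by (simp add: D0 congruence_entry sum_distrib_left mult_ac)
    also have "\<dots> = (\<Sum>p\<in>UNIV. \<Sum>s\<in>UNIV. \<Sum>r\<in>UNIV. (?M $ s $ b * ?M $ p $ c) * (?M $ r $ a * ?D p $ r $ s))"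
      by (intro sum.cong refl sum.swap)
    also have "\<dots> = (\<Sum>s\<in>UNIV. \<Sum>p\<in>UNIV. \<Sum>r\<in>UNIV. (?M $ s $ b * ?M $ p $ c) * (?M $ r $ a * ?D p $ r $ s))"
      by (rule sum.swap)
    finally show ?thesis by (simp add: sum_distrib_left)
  qed
  show ?thesis
    unfolding div D ctr_pull[OF x] by (simp add: ctr_sum ctr_linear)
qed

lemma Phi_row_pull: "x \<in> W \<Longrightarrow> Phi n J \<Gamma> x $ a = (\<Sum>p\<in>UNIV. M x $ p $ a *\<^sub>R (Phi n J' \<Gamma>' (\<psi> x) $ p v* M x))"
  by (simp add: Phi_pull congruence_row)

lemma Z_pull:
  assumes x: "x \<in> W"
  shows "g.Z a x = (\<Sum>p\<in>UNIV. M x $ p $ a * g'.Z p (\<psi> x))"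
proof -
  have D: "D1 \<Gamma> a \<alpha> x = (\<Sum>p\<in>UNIV. M x $ p $ a *\<^sub>R (D1 \<Gamma>' p \<alpha>' (\<psi> x) v* M x))"
    using \<psi>[OF x] by (intro D1_pull[OF x \<alpha>_pull]) auto
  show ?thesis
    unfolding g.Z_def g'.Z_def D Phi_row_pull[OF x] divPhi_pull[OF x] \<alpha>_pull[OF x] pr_sum_right pr_linear pr_pull[OF x]
    by (simp add: sum.distrib sum_subtractf sum_divide_distrib sum_distrib_left algebra_simps add_divide_distrib)
qed

text \<open>Every ingredient of \<open>tractor_deriv_eq\<close> picks up one jacobian for the
  direction a, and the middle slot one more for its own index.\<close>

lemma tractor_deriv_pull:
  assumes x: "x \<in> W" and s': "smooth_on W' s'"
    and s: "\<And>y. y \<in> W \<Longrightarrow> s y = tractor_pullback (M y) (s' (\<psi> y))"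
  shows "tractor_deriv n J \<Gamma> s a x = (\<Sum>k\<in>UNIV. M x $ k $ a *\<^sub>R tractor_pullback (M x) (tractor_deriv n J' \<Gamma>' s' k (\<psi> x)))"
proof -
  have pb: "tractor_pullback B t = (fst t, fst (snd t) v* B, snd (snd t))" for B :: "real^'d^'d" and t
    by (simp add: tractor_pullback_def case_prod_beta)
  let ?z = "\<psi> x"
  have d: "(\<lambda>z. fst (s' z)) differentiable (at ?z)" "(\<lambda>z. fst (snd (s' z))) differentiable (at ?z)"
    "(\<lambda>z. snd (snd (s' z))) differentiable (at ?z)"
    using s' \<psi>[OF x] by (auto intro!: smooth_on_differentiable[of W'] smooth_on_fst smooth_on_snd g'.S)
  have f: "partial a (\<lambda>y. fst (s y)) x = (\<Sum>k\<in>UNIV. M x $ k $ a *\<^sub>R partial k (\<lambda>z. fst (s' z)) ?z)"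
    unfolding partial_compose[OF x d(1), symmetric]
    by (rule partial_cong[OF g.S x]) (simp add: s pb)
  have r: "partial a (\<lambda>y. snd (snd (s y))) x = (\<Sum>k\<in>UNIV. M x $ k $ a *\<^sub>R partial k (\<lambda>z. snd (snd (s' z))) ?z)"
    unfolding partial_compose[OF x d(3), symmetric]
    by (rule partial_cong[OF g.S x]) (simp add: s pb)
  have m: "D1 \<Gamma> a (\<lambda>y. fst (snd (s y))) x = (\<Sum>k\<in>UNIV. M x $ k $ a *\<^sub>R (D1 \<Gamma>' k (\<lambda>z. fst (snd (s' z))) ?z v* M x))"
    by (rule D1_pull[OF x _ d(2)]) (simp add: s pb)
  have mu: "(u v* M x) $ a = (\<Sum>k\<in>UNIV. M x $ k $ a * u $ k)" for u
    by (simp add: vector_matrix_mult_def mult.commute)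
  show ?thesis
    unfolding g.tractor_deriv_eq[OF x] g'.tractor_deriv_eq[OF \<psi>[OF x]] pb s[OF x] fst_conv snd_conv f r m
      J_row_pull[OF x, of a] Phi_row_pull[OF x, of a] A_row_pull[OF x, of a] Z_pull[OF x] \<alpha>_pull[OF x]
    by (intro prod_eqI)
       (simp_all add: fst_sum snd_sum pr_sum_right pr_pull[OF x] mu vector_matrix_linear sum.distrib sum_subtractf
         scaleR_sum_right sum_distrib_left sum_distrib_right algebra_simps)
qed

end

section \<open>The tractor connection\<close>

lemma (in gauge) tractor_deriv_add:
  assumes x: "x \<in> S" and s: "smooth_on S s" "smooth_on S t"
  shows "tractor_deriv n J \<Gamma> (\<lambda>y. s y + t y) a x = tractor_deriv n J \<Gamma> s a x + tractor_deriv n J \<Gamma> t a x"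
proof -
  have d: "(\<lambda>y. fst (u y)) differentiable (at x)" "(\<lambda>y. fst (snd (u y))) differentiable (at x)"
    "(\<lambda>y. snd (snd (u y))) differentiable (at x)" if "smooth_on S u" for u :: "real^'d \<Rightarrow> 'd tractor"
    using that S x by (auto intro!: smooth_differentiable smooth_on_fst smooth_on_snd)
  show ?thesis
    unfolding tractor_deriv_eq[OF x] using d[OF s(1)] d[OF s(2)]
    by (simp add: partial_add D1_add algebra_simps)
qed

lemma (in gauge) tractor_deriv_scaleR:
  assumes x: "x \<in> S" and s: "smooth_on S f" "smooth_on S s"
  shows "tractor_deriv n J \<Gamma> (\<lambda>y. f y *\<^sub>R s y) a x = f x *\<^sub>R tractor_deriv n J \<Gamma> s a x + partial a f x *\<^sub>R s x"
proof -
  have d: "(\<lambda>y. fst (s y)) differentiable (at x)" "(\<lambda>y. fst (snd (s y))) differentiable (at x)"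
    "(\<lambda>y. snd (snd (s y))) differentiable (at x)" "f differentiable (at x)"
    using s S x by (auto intro!: smooth_differentiable smooth_on_fst smooth_on_snd)
  show ?thesis
    unfolding tractor_deriv_eq[OF x] using d
    by (intro prod_eqI) (simp_all add: partial_mult D1_scaleR algebra_simps)
qed

section \<open>From atlases and representative pairs to the locales\<close>

lemma gauge_subset:
  assumes "gauge S n J \<Gamma> \<alpha>" "open W" "W \<subseteq> S"
  shows "gauge W n J \<Gamma> \<alpha>"
proof -
  interpret gauge S n J \<Gamma> \<alpha> by (rule assms)
  show ?thesis
    by unfold_locales
      (use assms(2,3) dim smooth_J smooth_\<Gamma> smooth_\<alpha> symplectic torsion_free closed is_alpha
        in \<open>auto intro: smooth_on_subset simp: symplectic_def\<close>)
qed

lemma open_region: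
  assumes A: "smooth_atlas A" "c \<in> A" and U: "open U"
  shows "open (region U c)"
proof -
  obtain D \<phi> where c: "c = (D, \<phi>)" by (cases c)
  then obtain \<psi> where h: "open D" "open (\<phi> ` D)" "homeomorphism D (\<phi> ` D) \<phi> \<psi>"
    using A unfolding smooth_atlas_def by blast
  have "openin (top_of_set D) (D \<inter> U)" using U by (rule openin_open_Int)
  then have "openin (top_of_set (\<phi> ` D)) (\<phi> ` (D \<inter> U))"
    by (rule homeomorphism_imp_open_map[OF h(3)])
  then show ?thesis using h(2) by (simp add: region_def c openin_open_eq)
qed

lemma transition_region:
  assumes A: "smooth_atlas A" "c \<in> A" and x: "x \<in> region (U \<inter> fst c') c"
  shows "transition c c' x \<in> region U c'"
proof -
  obtain D \<phi> where c: "c = (D, \<phi>)" by (cases c)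
  then obtain \<psi> where h: "homeomorphism D (\<phi> ` D) \<phi> \<psi>"
    using A unfolding smooth_atlas_def by blast
  have inj: "inj_on (snd c) (fst c)"
    using h by (auto simp: c homeomorphism_def inj_on_def) metis
  obtain m where m: "m \<in> fst c" "m \<in> U" "m \<in> fst c'" "x = snd c m"
    using x by (auto simp: region_def)
  then have "transition c c' x = snd c' m"
    by (simp add: transition_def inv_into_f_f[OF inj])
  then show ?thesis using m by (auto simp: region_def)
qed

text \<open>A single form \<alpha> serves all charts and comes with its transformation law, as
  \<open>chart_change\<close> requires of two charts at a time.\<close>

lemma pair_gauge:
  fixes A :: "('m::{t2_space, second_countable_topology}, 'd::finite) chart set"
  assumes A: "smooth_atlas A" and dim: "CARD('d) = 2 * n" "2 * n \<ge> 4" and U: "open U"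
    and q: "conf_fedosov_pair A U q"
  obtains \<alpha> where "one_form A U \<alpha>" "\<And>c. c \<in> A \<Longrightarrow> gauge (region U c) n (fst q c) (snd q c) (\<alpha> c)"
proof -
  obtain \<alpha> where \<alpha>: "closed_one_form A U \<alpha>"
    "\<And>c x. c \<in> A \<Longrightarrow> x \<in> region U c \<Longrightarrow> is_alpha_at (fst q c) (snd q c) x (\<alpha> c x)"
    using q unfolding conf_fedosov_pair_def by blast
  have J: "nondegenerate_two_form A U (fst q)" and \<Gamma>: "torsion_free_connection A U (snd q)"
    using q unfolding conf_fedosov_pair_def by auto
  have "gauge (region U c) n (fst q c) (snd q c) (\<alpha> c)" if c: "c \<in> A" for c
  proof (rule gauge.intro)
    show "CARD('d) = 2 * n" "2 * n \<ge> 4" "open (region U c)" using dim open_region[OF A c U] by auto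
    show "smooth_on (region U c) (fst q c)" "smooth_on (region U c) (snd q c)" "smooth_on (region U c) (\<alpha> c)"
      using J \<Gamma> \<alpha>(1) c
      by (auto simp: nondegenerate_two_form_def torsion_free_connection_def closed_one_form_def one_form_def smooth_field_def)
    fix x assume x: "x \<in> region U c"
    show "symplectic (fst q c x)"
      using J c x by (auto simp: nondegenerate_two_form_def symplectic_def)
    show "snd q c x $ k $ i $ j = snd q c x $ k $ j $ i" for k i j
      using \<Gamma> c x unfolding torsion_free_connection_def by blast
    show "partial a (\<alpha> c) x $ b = partial b (\<alpha> c) x $ a" for a b
      using \<alpha>(1) c x unfolding closed_one_form_def by blast
    show "is_alpha_at (fst q c) (snd q c) x (\<alpha> c x)" by (rule \<alpha>(2)[OF c x])
  qed
  then show ?thesis using that \<alpha>(1) unfolding closed_one_form_def by blast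
qed

lemma pair_chart_change:
  fixes A :: "('m::{t2_space, second_countable_topology}, 'd::finite) chart set"
  assumes A: "smooth_atlas A" and U: "open U" and q: "conf_fedosov_pair A U q" and \<alpha>: "one_form A U \<alpha>"
    and g: "\<And>c. c \<in> A \<Longrightarrow> gauge (region U c) n (fst q c) (snd q c) (\<alpha> c)" and c: "c \<in> A" "c' \<in> A"
  shows "chart_change (region (U \<inter> fst c') c) (region U c') n (fst q c) (snd q c) (\<alpha> c)
     (fst q c') (snd q c') (\<alpha> c') (transition c c') (jacobian c c')"
proof -
  have "open (fst c')" using A c(2) unfolding smooth_atlas_def by (cases c') auto
  then have W: "open (region (U \<inter> fst c') c)" using open_region[OF A c(1)] U by auto
  have sub: "region (U \<inter> fst c') c \<subseteq> region U c" "region (U \<inter> fst c') c \<subseteq> region (fst c') c"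
    by (auto simp: region_def)
  have J: "nondegenerate_two_form A U (fst q)" and \<Gamma>: "torsion_free_connection A U (snd q)"
    using q unfolding conf_fedosov_pair_def by auto
  show ?thesis
  proof (intro chart_change.intro chart_change_axioms.intro)
    show "gauge (region (U \<inter> fst c') c) n (fst q c) (snd q c) (\<alpha> c)"
      by (rule gauge_subset[OF g[OF c(1)] W sub(1)])
    show "gauge (region U c') n (fst q c') (snd q c') (\<alpha> c')" by (rule g[OF c(2)])
    show "jacobian c c' x = (\<chi> k i. partial i (transition c c') x $ k)" for x
      by (simp add: jacobian_def)
    show "smooth_on (region (U \<inter> fst c') c) (transition c c')"
      using A c sub(2) unfolding smooth_atlas_def by (blast intro: smooth_on_subset)
    fix x assume x: "x \<in> region (U \<inter> fst c') c"
    show "transition c c' x \<in> region U c'" by (rule transition_region[OF A c(1) x])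
    show "fst q c x = transpose (jacobian c c' x) ** fst q c' (transition c c' x) ** jacobian c c' x"
      using J c x unfolding nondegenerate_two_form_def by blast
    show "\<alpha> c x = \<alpha> c' (transition c c' x) v* jacobian c c' x"
      using \<alpha> c x unfolding one_form_def by blast
    show "(\<Sum>k\<in>UNIV. jacobian c c' x $ l $ k * snd q c x $ k $ i $ j) =
        partial i (\<lambda>y. jacobian c c' y $ l $ j) x +
        (\<Sum>p\<in>UNIV. \<Sum>r\<in>UNIV. jacobian c c' x $ p $ i * jacobian c c' x $ r $ j * snd q c' (transition c c' x) $ l $ p $ r)" for l i j
      using \<Gamma> c x unfolding torsion_free_connection_def by blast
  qed
qed

lemma pair_rescale:
  fixes A :: "('m::{t2_space, second_countable_topology}, 'd::finite) chart set"
  assumes g: "gauge (region U c) n (fst q c) (snd q c) \<alpha>" "gauge (region U c) n (fst q' c) (snd q' c) \<alpha>'"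
    and \<Omega>: "rescaling A U \<Omega> q q'" and c: "c \<in> A"
  shows "rescale (region U c) n (fst q c) (snd q c) \<alpha> (fst q' c) (snd q' c) \<alpha>' (\<Omega> c)"
proof (intro rescale.intro rescale_axioms.intro g)
  show "smooth_on (region U c) (\<Omega> c)"
    using \<Omega> c unfolding rescaling_def scalar_field_def smooth_field_def by blast
  fix x assume x: "x \<in> region U c"
  show "0 < \<Omega> c x" "fst q' c x = (\<Omega> c x)\<^sup>2 *\<^sub>R fst q c x"
    using \<Omega> c x unfolding rescaling_def by blast+
  fix a v
  \<comment> \<open>The law relating the two connections is tested on a constant covector field,
    whose partial derivatives vanish.\<close>
  have "cov1 (snd q' c) (\<lambda>_. v) x $ a $ b = cov1 (snd q c) (\<lambda>_. v) x $ a $ b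
      - Upsilon (\<Omega> c) x $ a * v $ b - Upsilon (\<Omega> c) x $ b * v $ a" for b
    using \<Omega> c x smooth_on_const[of "region U c" v] unfolding rescaling_def by blast
  then show "conn (snd q' c) a x *v v = conn (snd q c) a x *v v + Upsilon (\<Omega> c) x $ a *\<^sub>R v + v $ a *\<^sub>R Upsilon (\<Omega> c) x"
    by (simp add: cov1_D1 D1_def vec_eq_iff algebra_simps)
qed

lemma fedosov_pair:
  assumes "gauge (region U c) n (fst q c) (snd q c) \<alpha>" "fedosov_gauge A U q" "c \<in> A"
  shows "fedosov (region U c) n (fst q c) (snd q c)"
proof -
  interpret gauge "region U c" n "fst q c" "snd q c" \<alpha> by (rule assms)
  show ?thesis
  proof
    show "is_alpha_at (fst q c) (snd q c) x 0" if "x \<in> region U c" for x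
      using assms(2,3) that by (simp add: fedosov_gauge_def is_alpha_at_def alt_def)
  qed (use dim S smooth_J smooth_\<Gamma> symplectic torsion_free in \<open>auto simp: symplectic_def\<close>)
qed

text \<open>Independence of the representatives is part of \<open>is_connection\<close>: through
  \<open>tractor_one_form\<close>, the derivative of a section must be smooth, covariant under
  change of chart and compatible with every rescaling between representatives on
  \<open>U\<close>.\<close>

theorem theorem2:
  fixes n :: nat
    and A :: "('m::{t2_space, second_countable_topology}, 'd::finite) chart set"
    and C :: "('m, 'd) pair set"
    and U :: "'m set"
  assumes dim: "CARD('d) = 2 * n" "2 * n \<ge> 4"
    and fedosov: "conformally_fedosov A C"
    and U: "open U" "U \<subseteq> points A"
  shows "is_connection A C U (tractor_connection n) \<and>
    (\<forall>s t. tractor_section A C U s \<longrightarrow> tractor_section A C U t \<longrightarrow>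
       (\<forall>q\<in>representatives A C U. \<forall>c\<in>A. \<forall>x\<in>region U c. \<forall>a.
          partial a (\<lambda>y. skew_form (fst q c y) (s q c y) (t q c y)) x =
          skew_form (fst q c x) (tractor_connection n s q c a x) (t q c x) +
          skew_form (fst q c x) (s q c x) (tractor_connection n t q c a x))) \<and>
    (\<forall>q\<in>representatives A C U. fedosov_gauge A U q \<longrightarrow>
       (\<forall>\<Gamma>' s. torsion_free_connection A U \<Gamma>' \<longrightarrow> tractor_section A C U s \<longrightarrow>
          (\<forall>c\<in>A. \<forall>x\<in>region U c. \<forall>a b.
             tractor_commutator n (fst q c) (snd q c) (\<Gamma>' c) (s q c) a b x =
             tractor_curvature n (fst q c) (snd q c) x a b (s q c x))))"
proof -
  have A: "smooth_atlas A" using fedosov unfolding conformally_fedosov_def by blast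
  have pair: "conf_fedosov_pair A U q" if "q \<in> representatives A C U" for q
    using that by (simp add: representatives_def)
  have smooth: "smooth_on (region U c) (s q c)"
    if "tractor_section A C U s" "q \<in> representatives A C U" "c \<in> A" for s q c
    using that unfolding tractor_section_def smooth_field_def by blast
  have gauge: "\<exists>\<alpha>. gauge (region U c) n (fst q c) (snd q c) \<alpha>" if "q \<in> representatives A C U" "c \<in> A" for q c
    using pair_gauge[OF A dim U(1) pair[OF that(1)]] that(2) by metis
  have form: "tractor_one_form A C U (tractor_connection n s)" if s: "tractor_section A C U s" for s
    unfolding tractor_one_form_def tractor_connection_def
  proof (intro conjI ballI allI impI)
    fix q c a assume q: "q \<in> representatives A C U" "c \<in> A"
    obtain \<alpha> where "gauge (region U c) n (fst q c) (snd q c) \<alpha>" using gauge[OF q] by blast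
    from gauge.smooth_on_tractor_deriv[OF this smooth[OF s q]]
    show "smooth_on (region U c) (tractor_deriv n (fst q c) (snd q c) (s q c) a)" .
  next
    fix q c c' x a assume q: "q \<in> representatives A C U" "c \<in> A" "c' \<in> A" and x: "x \<in> region (U \<inter> fst c') c"
    obtain \<alpha> where \<alpha>: "one_form A U \<alpha>" "\<And>c. c \<in> A \<Longrightarrow> gauge (region U c) n (fst q c) (snd q c) (\<alpha> c)"
      using pair_gauge[OF A dim U(1) pair[OF q(1)]] by metis
    show "tractor_deriv n (fst q c) (snd q c) (s q c) a x =
      (\<Sum>k\<in>UNIV. jacobian c c' x $ k $ a *\<^sub>R tractor_pullback (jacobian c c' x)
        (tractor_deriv n (fst q c') (snd q c') (s q c') k (transition c c' x)))"
    proof (rule chart_change.tractor_deriv_pull[OF pair_chart_change[OF A U(1) pair[OF q(1)] \<alpha> q(2,3)] x smooth[OF s q(1,3)]])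
      show "s q c y = tractor_pullback (jacobian c c' y) (s q c' (transition c c' y))" if "y \<in> region (U \<inter> fst c') c" for y
        using s q that unfolding tractor_section_def by blast
    qed
  next
    fix q q' \<Omega> c x a assume q: "q \<in> representatives A C U" "q' \<in> representatives A C U"
      and \<Omega>: "rescaling A U \<Omega> q q'" and c: "c \<in> A" and x: "x \<in> region U c"
    obtain \<alpha> \<alpha>' where g: "gauge (region U c) n (fst q c) (snd q c) \<alpha>" "gauge (region U c) n (fst q' c) (snd q' c) \<alpha>'"
      using gauge[OF q(1) c] gauge[OF q(2) c] by blast
    \<comment> \<open>On the whole region the section in the second gauge is the rescaled section of
      the first, and \<open>tractor_deriv\<close> depends only on values near x.\<close>
    have "tractor_deriv n (fst q' c) (snd q' c) (s q' c) a x =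
      tractor_deriv n (fst q' c) (snd q' c) (\<lambda>y. tractor_rescale (\<Omega> c) (fst q c) (snd q c) y (s q c y)) a x"
      using s q \<Omega> c unfolding tractor_section_def
      by (intro tractor_deriv_cong[OF open_region[OF A c U(1)] x]) blast
    also have "\<dots> = tractor_rescale (\<Omega> c) (fst q c) (snd q c) x (tractor_deriv n (fst q c) (snd q c) (s q c) a x)"
      by (rule rescale.tractor_deriv_rescale[OF pair_rescale[OF g \<Omega> c] x smooth[OF s q(1) c]])
    finally show "tractor_deriv n (fst q' c) (snd q' c) (s q' c) a x
      = tractor_rescale (\<Omega> c) (fst q c) (snd q c) x (tractor_deriv n (fst q c) (snd q c) (s q c) a x)" .
  qed
  have connection: "is_connection A C U (tractor_connection n)"
    unfolding is_connection_def
  proof (intro conjI allI ballI impI form)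
    fix s t q c x a assume st: "tractor_section A C U s" "tractor_section A C U t"
      and q: "q \<in> representatives A C U" "c \<in> A" and x: "x \<in> region U c"
    obtain \<alpha> where "gauge (region U c) n (fst q c) (snd q c) \<alpha>" using gauge[OF q] by blast
    from gauge.tractor_deriv_add[OF this x smooth[OF st(1) q] smooth[OF st(2) q]]
    show "tractor_connection n (\<lambda>q c y. s q c y + t q c y) q c a x = tractor_connection n s q c a x + tractor_connection n t q c a x"
      by (simp add: tractor_connection_def)
  next
    fix f s q c x a assume f: "scalar_field A U f" and s: "tractor_section A C U s"
      and q: "q \<in> representatives A C U" "c \<in> A" and x: "x \<in> region U c"
    obtain \<alpha> where g: "gauge (region U c) n (fst q c) (snd q c) \<alpha>" using gauge[OF q] by blast
    have "smooth_on (region U c) (f c)" using f q unfolding scalar_field_def smooth_field_def by blast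
    from gauge.tractor_deriv_scaleR[OF g x this smooth[OF s q]]
    show "tractor_connection n (\<lambda>q c y. f c y *\<^sub>R s q c y) q c a x = f c x *\<^sub>R tractor_connection n s q c a x + partial a (f c) x *\<^sub>R s q c x"
      by (simp add: tractor_connection_def)
  qed
  show ?thesis
  proof (intro conjI allI ballI impI connection)
    fix s t q c x a assume st: "tractor_section A C U s" "tractor_section A C U t"
      and q: "q \<in> representatives A C U" "c \<in> A" and x: "x \<in> region U c"
    obtain \<alpha> where "gauge (region U c) n (fst q c) (snd q c) \<alpha>" using gauge[OF q] by blast
    from gauge.skew_form_parallel[OF this x smooth[OF st(1) q] smooth[OF st(2) q]]
    show "partial a (\<lambda>y. skew_form (fst q c y) (s q c y) (t q c y)) x =
          skew_form (fst q c x) (tractor_connection n s q c a x) (t q c x) +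
          skew_form (fst q c x) (s q c x) (tractor_connection n t q c a x)"
      by (simp add: tractor_connection_def)
  next
    fix q \<Gamma>' s c x a b assume q: "q \<in> representatives A C U" and fed: "fedosov_gauge A U q"
      and \<Gamma>': "torsion_free_connection A U \<Gamma>'" and s: "tractor_section A C U s"
      and c: "c \<in> A" and x: "x \<in> region U c"
    obtain \<alpha> where g: "gauge (region U c) n (fst q c) (snd q c) \<alpha>" using gauge[OF q c] by blast
    show "tractor_commutator n (fst q c) (snd q c) (\<Gamma>' c) (s q c) a b x =
             tractor_curvature n (fst q c) (snd q c) x a b (s q c x)"
    proof (rule fedosov.commutator[OF fedosov_pair[OF g fed c] x smooth[OF s q c]])
      show "\<Gamma>' c x $ k $ i $ j = \<Gamma>' c x $ k $ j $ i" for k i j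
        using \<Gamma>' c x unfolding torsion_free_connection_def by blast
    qed
  qed
qed

end
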